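(* Fix once and for all an element $\sigma\in V$ of order three lifting the identity of $A_6$ (i.e. $\sigma\in\ker\pi$ of order $3$). For every $k\ge 6$ the space $\mathcal{H}(A_6,C_{2\times 2}^k)^{in}$ has exactly three connected components: (0) the locus $\mathcal{H}_{0}(A_6,C_{2\times 2}^k)^{in}$ of elements with lifting invariant $\sigma^0=1_V$; (1) the locus $\mathcal{H}_{1}(A_6,C_{2\times 2}^k)^{in}$ of elements with lifting invariant $\sigma^1$; (2) the locus $\mathcal{H}_{2}(A_6,C_{2\times 2}^k)^{in}$ of elements with lifting invariant $\sigma^2$. The space $\mathcal{H}(A_6,C_{2\times 2}^5)^{in}$ has two connected components: the locus $\mathcal{H}_{1}(A_6,C_{2\times 2}^5)^{in}$ of elements with lifting invariant $\sigma^1$, and the locus $\mathcal{H}_{2}(A_6,C_{2\times 2}^5)^{in}$ of elements with lifting invariant $\sigma^2$.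
   Context: All varieties are over $\mathbb{C}$. $A_6\subset S_6$ is the alternating group, and $C_{2\times 2}$ is the conjugacy class of $A_6$ consisting of the $45$ products of two disjoint transpositions. Nielsen class: $\mathrm{Ni}(A_6,C_{2\times 2}^k)$ is the set of tuples $(g_1,\dots,g_k)$ with $g_i\in C_{2\times 2}$, $g_1\cdots g_k=1$ and $\langle g_1,\dots,g_k\rangle=A_6$. Hurwitz action: the braid group $B_k$ acts on tuples through its standard generators by $\sigma_i(g_1,\dots,g_k)=(g_1,\dots,g_{i-1},g_{i+1},g_{i+1}^{-1}g_ig_{i+1},g_{i+2},\dots,g_k)$. Inner action: $s\in A_6$ acts by $\phi_s(g_1,\dots,g_k)=(s^{-1}g_1s,\dots,s^{-1}g_ks)$. Inner Hurwitz space: $\mathcal{H}(A_6,C_{2\times 2}^k)^{in}$ is the inner Hurwitz space parametrizing Galois closures of degree $6$ connected coverings $X\to\mathbb{P}^1$ with exactly $k$ branch points, monodromy group $A_6$ and local monodromies in $C_{2\times 2}$. It is described by $\mathrm{Ni}(A_6,C_{2\times 2}^k)/A_6$ (quotient by the inner action), and its connected components correspond bijectively to the orbits of the Hurwitz action on $\mathrm{Ni}(A_6,C_{2\times 2}^k)/A_6$. An element of the Nielsen class and the corresponding point of the Hurwitz space are denoted in the same way. Valentiner group and lifting invariant: identify $A_6$ with the subgroup of $S_6$ generated by $s_1=(1,2)(3,4)$, $s_2=(1,2,4,5)(3,6)$. The Valentiner group $V$ (order $1080$) is the subgroup of $S_{18}$ generated by $v_1=(2,6)(4,11)(7,9)(8,13)(10,14)(12,16)$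 and $v_2=(1,2,7,4)(3,8,6,10)(5,9,13,12)(11,15)(14,17)(16,18)$; the surjection $\pi:V\to A_6$ is given by $v_1\mapsto s_1$, $v_2\mapsto s_2$, and its kernel is central and cyclic of order $3$. Every $x\in C_{2\times 2}$ has a unique lift $\hat x\in V$ of order $2$. The lifting invariant of $\mathbf{g}=(g_1,\dots,g_k)\in\mathrm{Ni}(A_6,C_{2\times 2}^k)$ is $\gamma(\mathbf{g})=\hat g_1\cdots\hat g_k\in\ker\pi$; it is invariant under the Hurwitz and inner actions. *)

theory Defs
  imports "HOL-Algebra.Sym_Groups" "HOL-Algebra.Group_Action" "HOL-Algebra.Multiplicative_Group"
begin

text \<open>
  Permutations are multiplied as functions (right factor first), as in \<^const>\<open>sym_group\<close> and
  \<^const>\<open>alt_group\<close>. The opposite convention gives the same theory: reversing all tuples turns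
  products, lifting invariants and inner classes of one convention into those of the other, and
  the braid generators into inverses of braid generators.
\<close>

definition C22 :: "(nat \<Rightarrow> nat) set" where
  "C22 = {cycle_of_list [a, b] \<circ> cycle_of_list [c, d] | a b c d.
            {a, b, c, d} \<subseteq> {1..6} \<and> distinct [a, b, c, d]}"


section \<open>Nielsen classes, Hurwitz action and inner action\<close>

definition tuple_prod :: "('a, 'm) monoid_scheme \<Rightarrow> 'a list \<Rightarrow> 'a" where
  "tuple_prod G gs = foldr (mult G) gs \<one>\<^bsub>G\<^esub>"

definition nielsen_class :: "('a, 'm) monoid_scheme \<Rightarrow> 'a set \<Rightarrow> nat \<Rightarrow> 'a list set" where
  "nielsen_class G C k = {gs. length gs = k \<and> set gs \<subseteq> C \<and> tuple_prod G gs = \<one>\<^bsub>G\<^esub> \<and>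
                              generate G (set gs) = carrier G}"

text \<open>List positions start at 0, so \<open>braid_move G i\<close> is the generator usually written with
  index \<open>i + 1\<close>.\<close>

definition braid_move :: "('a, 'm) monoid_scheme \<Rightarrow> nat \<Rightarrow> 'a list \<Rightarrow> 'a list" where
  "braid_move G i gs =
     gs[i := gs ! Suc i,
        Suc i := inv\<^bsub>G\<^esub> (gs ! Suc i) \<otimes>\<^bsub>G\<^esub> gs ! i \<otimes>\<^bsub>G\<^esub> gs ! Suc i]"

text \<open>The image of the braid group on \<open>k\<close> strands in the group of bijections of the Nielsen
  class; it has the same orbits as the braid group itself.\<close>

definition braid_image ::
  "('a, 'm) monoid_scheme \<Rightarrow> 'a set \<Rightarrow> nat \<Rightarrow> ('a list \<Rightarrow> 'a list) monoid" where
  "braid_image G C k =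
     (let N = nielsen_class G C k in
      BijGroup N \<lparr>carrier := generate (BijGroup N) {restrict (braid_move G i) N | i. Suc i < k}\<rparr>)"

definition inner_act :: "('a, 'm) monoid_scheme \<Rightarrow> 'a \<Rightarrow> 'a list \<Rightarrow> 'a list" where
  "inner_act G s gs = map (\<lambda>g. inv\<^bsub>G\<^esub> s \<otimes>\<^bsub>G\<^esub> g \<otimes>\<^bsub>G\<^esub> s) gs"

definition inner_nielsen_class ::
  "('a, 'm) monoid_scheme \<Rightarrow> 'a set \<Rightarrow> nat \<Rightarrow> 'a list set set" where
  "inner_nielsen_class G C k = orbits G (nielsen_class G C k) (inner_act G)"

text \<open>
  The inner Hurwitz space is given by its combinatorial description: its points over a fixed
  branch divisor are the inner classes of Nielsen tuples, and a connected component is given by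
  the set of inner classes lying on it, which is an orbit of the Hurwitz action (a braid acts on
  an inner class by taking images).
\<close>

definition hurwitz_components ::
  "('a, 'm) monoid_scheme \<Rightarrow> 'a set \<Rightarrow> nat \<Rightarrow> 'a list set set set" where
  "hurwitz_components G C k =
     orbits (braid_image G C k) (inner_nielsen_class G C k) (\<lambda>\<beta> c. \<beta> ` c)"


section \<open>The Valentiner group and the lifting invariant\<close>

definition s1 :: "nat \<Rightarrow> nat" where
  "s1 = cycle_of_list [1, 2] \<circ> cycle_of_list [3, 4]"

definition s2 :: "nat \<Rightarrow> nat" where
  "s2 = cycle_of_list [1, 2, 4, 5] \<circ> cycle_of_list [3, 6]"

definition v1 :: "nat \<Rightarrow> nat" where
  "v1 = cycle_of_list [2, 6] \<circ> cycle_of_list [4, 11] \<circ> cycle_of_list [7, 9] \<circ>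
        cycle_of_list [8, 13] \<circ> cycle_of_list [10, 14] \<circ> cycle_of_list [12, 16]"

definition v2 :: "nat \<Rightarrow> nat" where
  "v2 = cycle_of_list [1, 2, 7, 4] \<circ> cycle_of_list [3, 8, 6, 10] \<circ> cycle_of_list [5, 9, 13, 12] \<circ>
        cycle_of_list [11, 15] \<circ> cycle_of_list [14, 17] \<circ> cycle_of_list [16, 18]"

definition Valentiner :: "(nat \<Rightarrow> nat) monoid" where
  "Valentiner = sym_group 18 \<lparr>carrier := generate (sym_group 18) {v1, v2}\<rparr>"

text \<open>Extensionality (a fixed junk value outside the Valentiner group) makes the homomorphism
  unique as a HOL function; existence and uniqueness are proved below.\<close>

definition is_val_proj :: "((nat \<Rightarrow> nat) \<Rightarrow> (nat \<Rightarrow> nat)) \<Rightarrow> bool" where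
  "is_val_proj h \<longleftrightarrow> h \<in> hom Valentiner (alt_group 6) \<and> h \<in> extensional (carrier Valentiner) \<and>
                     h v1 = s1 \<and> h v2 = s2"

definition val_proj :: "(nat \<Rightarrow> nat) \<Rightarrow> (nat \<Rightarrow> nat)" where
  "val_proj = (THE h. is_val_proj h)"

definition inv_lift :: "(nat \<Rightarrow> nat) \<Rightarrow> (nat \<Rightarrow> nat)" where
  "inv_lift x = (THE w. w \<in> carrier Valentiner \<and> val_proj w = x \<and> group.ord Valentiner w = 2)"

definition lifting_invariant :: "(nat \<Rightarrow> nat) list \<Rightarrow> (nat \<Rightarrow> nat)" where
  "lifting_invariant gs = tuple_prod Valentiner (map inv_lift gs)"

definition hurwitz_locus :: "nat \<Rightarrow> (nat \<Rightarrow> nat) \<Rightarrow> (nat \<Rightarrow> nat) list set set" where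
  "hurwitz_locus k z =
     {orbit (alt_group 6) (inner_act (alt_group 6)) gs | gs.
        gs \<in> nielsen_class (alt_group 6) C22 k \<and> lifting_invariant gs = z}"


section \<open>The projection is well defined\<close>

text \<open>The orbits of the central subgroup of order 3 on \<open>{1..18}\<close> are six blocks; \<open>val_block\<close>
  labels them so that the induced action of \<open>v1\<close>, \<open>v2\<close> on labels is \<open>s1\<close>, \<open>s2\<close>.\<close>

definition val_block :: "nat \<Rightarrow> nat" where
  "val_block x = [0, 5, 1, 5, 4, 5, 2, 2, 1, 1, 4, 3, 4, 2, 3, 6, 3, 6, 6] ! x"

definition val_rep :: "nat \<Rightarrow> nat" where
  "val_rep i = [0, 2, 6, 11, 4, 1, 15] ! i"

definition covers :: "(nat \<Rightarrow> nat) \<Rightarrow> (nat \<Rightarrow> nat) \<Rightarrow> bool" where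
  "covers v s \<longleftrightarrow> v permutes {1..18} \<and> s \<in> carrier (alt_group 6) \<and>
                  (\<forall>x\<in>{1..18}. val_block (v x) = s (val_block x))"

lemma ivl18: "{1..18::nat} = {1, 2, 3, 4, 5, 6, 7, 8, 9, 10, 11, 12, 13, 14, 15, 16, 17, 18}"
  by code_simp

lemma ivl6: "{1..6::nat} = {1, 2, 3, 4, 5, 6}"
  by auto

lemma val_block_in: "x \<in> {1..18} \<Longrightarrow> val_block x \<in> {1..6}"
  unfolding ivl18 val_block_def by auto

lemma val_rep_in: "i \<in> {1..6} \<Longrightarrow> val_rep i \<in> {1..18}"
  unfolding ivl6 val_rep_def by auto

lemma val_block_rep: "i \<in> {1..6} \<Longrightarrow> val_block (val_rep i) = i"
  unfolding ivl6 val_rep_def val_block_def by auto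

lemma cycle_permutes_superset: "set cs \<subseteq> A \<Longrightarrow> cycle_of_list cs permutes A"
  using cycle_permutes permutes_subset by blast

lemma v1_permutes: "v1 permutes {1..18}"
  unfolding v1_def by (intro permutes_compose cycle_permutes_superset) auto

lemma v2_permutes: "v2 permutes {1..18}"
  unfolding v2_def by (intro permutes_compose cycle_permutes_superset) auto

lemma s1_in: "s1 \<in> carrier (alt_group 6)"
proof -
  have "s1 permutes {1..6}"
    unfolding s1_def by (intro permutes_compose cycle_permutes_superset) auto
  moreover have "evenperm s1"
    unfolding s1_def by (simp add: evenperm_comp evenperm_swap permutation_swap_id)
  ultimately show ?thesis by (simp add: alt_group_carrier)
qed

lemma s2_in: "s2 \<in> carrier (alt_group 6)"
proof -
  have "s2 permutes {1..6}"
    unfolding s2_def by (intro permutes_compose cycle_permutes_superset) auto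
  moreover have "evenperm s2"
    unfolding s2_def by (simp add: evenperm_comp evenperm_swap permutation_swap_id permutation_compose)
  ultimately show ?thesis by (simp add: alt_group_carrier)
qed

lemma covers_v1: "covers v1 s1"
  unfolding covers_def ivl18 ball_simps
  by (intro conjI v1_permutes[unfolded ivl18] s1_in TrueI)
     (simp_all add: v1_def s1_def val_block_def transpose_def)

lemma covers_v2: "covers v2 s2"
  unfolding covers_def ivl18 ball_simps
  by (intro conjI v2_permutes[unfolded ivl18] s2_in TrueI)
     (simp_all add: v2_def s2_def val_block_def transpose_def)

lemma covers_unique:
  assumes "covers v s" "covers v t" shows "s = t"
proof
  fix i
  have p: "s permutes {1..6}" "t permutes {1..6}"
    using assms by (auto simp: covers_def alt_group_carrier)
  show "s i = t i"
  proof (cases "i \<in> {1..6}")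
    case True
    then show ?thesis
      using assms val_block_rep[OF True] val_rep_in[OF True] unfolding covers_def by metis
  next
    case False
    then show ?thesis using p by (metis permutes_def)
  qed
qed

lemma covers_id: "covers id id"
  unfolding covers_def by (simp add: permutes_id alt_group_carrier evenperm_id)

lemma covers_comp:
  assumes "covers v s" "covers w t" shows "covers (v \<circ> w) (s \<circ> t)"
proof -
  have "s \<circ> t \<in> carrier (alt_group 6)"
    using assms group.is_monoid[OF alt_group_is_group, of 6] monoid.m_closed
    unfolding covers_def by (metis alt_group_mult)
  then show ?thesis
    using assms permutes_in_image[of w "{1..18}"] unfolding covers_def
    by (auto simp: permutes_compose)
qed

lemma covers_inv:
  assumes "covers v s" shows "covers (inv' v) (inv' s)"
proof -
  have p: "s permutes {1..6}" "evenperm s" "v permutes {1..18}"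
    using assms by (auto simp: covers_def alt_group_carrier)
  have i: "inv' s \<in> carrier (alt_group 6)"
    using p permutes_inv evenperm_inv permutation_permutes alt_group_carrier
    by (metis finite_atLeastAtMost)
  have "val_block (inv' v x) = inv' s (val_block x)" if "x \<in> {1..18}" for x
  proof -
    have "inv' v x \<in> {1..18}"
      using that p(3) permutes_in_image permutes_inv by metis
    then have "val_block x = s (val_block (inv' v x))"
      using assms p(3) unfolding covers_def by (metis permutes_inverses(1))
    then show ?thesis using p(1) by (simp add: permutes_inverses(2))
  qed
  then show ?thesis using i p(3) permutes_inv unfolding covers_def by blast
qed

lemma sym_group_inv:
  assumes "p permutes {1..n}" shows "inv\<^bsub>sym_group n\<^esub> p = inv' p"
  using assms permutes_inv[OF assms] permutes_inv_o(2)[OF assms]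
  by (intro group.inv_equality[OF sym_group_is_group])
     (auto simp: sym_group_mult sym_group_one sym_group_carrier)

lemma covers_ex: "v \<in> carrier Valentiner \<Longrightarrow> \<exists>s. covers v s"
proof -
  assume "v \<in> carrier Valentiner"
  then have "v \<in> generate (sym_group 18) {v1, v2}" by (simp add: Valentiner_def)
  then show ?thesis
  proof (induction rule: generate.induct)
    case one
    then show ?case using covers_id unfolding sym_group_one by blast
  next
    case (incl h)
    then show ?case using covers_v1 covers_v2 by auto
  next
    case (inv h)
    then show ?case
      using covers_inv[OF covers_v1] covers_inv[OF covers_v2] sym_group_inv v1_permutes v2_permutes
      by auto
  next
    case (eng h1 h2)
    then show ?case using covers_comp unfolding sym_group_mult by blast
  qed
qed

lemma group_Valentiner: "group Valentiner"
proof -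
  have "{v1, v2} \<subseteq> carrier (sym_group 18)"
    using v1_permutes v2_permutes by (simp add: sym_group_carrier)
  then have "subgroup (generate (sym_group 18) {v1, v2}) (sym_group 18)"
    by (rule group.generate_is_subgroup[OF sym_group_is_group])
  then show ?thesis
    unfolding Valentiner_def by (rule subgroup.subgroup_is_group[OF _ sym_group_is_group])
qed

lemma Valentiner_mult: "mult Valentiner = (\<circ>)"
  by (simp add: Valentiner_def sym_group_mult)

lemma is_val_proj_covers:
  assumes "is_val_proj h" "v \<in> carrier Valentiner" shows "covers v (h v)"
proof -
  interpret group_hom Valentiner "alt_group 6" h
    using assms(1) group_Valentiner alt_group_is_group
    by (simp add: is_val_proj_def group_hom_def group_hom_axioms_def)
  interpret S: group "sym_group 18" by (rule sym_group_is_group)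
  have sub: "subgroup (carrier Valentiner) (sym_group 18)"
    using S.generate_is_subgroup[of "{v1, v2}"] v1_permutes v2_permutes
    by (simp add: Valentiner_def sym_group_carrier)
  have covers_one: "covers \<one>\<^bsub>sym_group 18\<^esub> (h \<one>\<^bsub>sym_group 18\<^esub>)"
    using hom_one covers_id by (simp add: Valentiner_def alt_group_one sym_group_one)
  have gen: "covers w (h w)" if "w \<in> {v1, v2}" for w
    using that assms(1) covers_v1 covers_v2 by (auto simp: is_val_proj_def)
  have covers_minv: "covers (inv\<^bsub>sym_group 18\<^esub> w) (h (inv\<^bsub>sym_group 18\<^esub> w))" if w: "w \<in> {v1, v2}" for w
  proof -
    have wV: "w \<in> carrier Valentiner"
      using w by (auto simp: Valentiner_def intro: generate.incl)
    have wS: "w permutes {1..18}" using w v1_permutes v2_permutes by auto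
    have eq: "inv\<^bsub>sym_group 18\<^esub> w = inv' w" using sym_group_inv[OF wS] .
    have iV: "inv' w \<in> carrier Valentiner"
      using subgroup.m_inv_closed[OF sub wV] eq by simp
    have cov: "covers (inv' w) (inv' (h w))" using covers_inv[OF gen[OF w]] .
    have hp: "h w permutes {1..6}"
      using hom_closed[OF wV] by (simp add: alt_group_carrier)
    have "h (inv' w) \<circ> h w = id"
      using hom_mult[OF iV wV] permutes_inv_o(2)[OF wS] hom_one
      by (simp add: alt_group_mult alt_group_one Valentiner_def sym_group_one sym_group_mult)
    then have "h (inv' w) = inv' (h w)"
      using permutes_inv_o(1)[OF hp] by (metis comp_assoc comp_id id_comp)
    then show ?thesis using cov eq by simp
  qed
  have "v \<in> generate (sym_group 18) {v1, v2}" using assms(2) by (simp add: Valentiner_def)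
  then show ?thesis
  proof (induction rule: generate.induct)
    case one
    show ?case by (rule covers_one)
  next
    case (incl w)
    then show ?case by (rule gen)
  next
    case (inv w)
    then show ?case by (rule covers_minv)
  next
    case (eng a b)
    have "h (a \<circ> b) = h a \<circ> h b"
      using hom_mult[of a b] eng.hyps by (simp add: Valentiner_def sym_group_mult alt_group_mult)
    then show ?case using covers_comp[OF eng.IH] unfolding sym_group_mult by metis
  qed
qed

lemma is_val_proj_ex: "\<exists>h. is_val_proj h"
proof -
  define h where "h = (\<lambda>v\<in>carrier Valentiner. THE s. covers v s)"
  have the: "(THE s. covers v s) = s" if "covers v s" for v s
    using that covers_unique by blast
  have cov: "covers v (h v)" if "v \<in> carrier Valentiner" for v
    using covers_ex[OF that] the that by (auto simp: h_def)
  have mem: "v1 \<in> carrier Valentiner" "v2 \<in> carrier Valentiner"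
    by (auto simp: Valentiner_def intro: generate.incl)
  have "h (v \<circ> w) = h v \<circ> h w" if "v \<in> carrier Valentiner" "w \<in> carrier Valentiner" for v w
  proof -
    have m: "v \<circ> w \<in> carrier Valentiner"
      using that monoid.m_closed[OF group.is_monoid[OF group_Valentiner]]
      by (metis Valentiner_mult)
    show ?thesis
      by (rule covers_unique[OF cov[OF m] covers_comp[OF cov[OF that(1)] cov[OF that(2)]]])
  qed
  then have "h \<in> hom Valentiner (alt_group 6)"
    using cov by (auto simp: hom_def Valentiner_mult alt_group_mult covers_def)
  moreover have "h v1 = s1" "h v2 = s2"
    using the[OF covers_v1] the[OF covers_v2] mem by (auto simp: h_def)
  ultimately have "is_val_proj h"
    by (simp add: is_val_proj_def) (simp add: h_def)
  then show ?thesis by (rule exI[of is_val_proj])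
qed

lemma val_proj_unique:
  assumes "is_val_proj h" "is_val_proj h'" shows "h = h'"
proof (rule extensionalityI[where A = "carrier Valentiner"])
  fix v assume v: "v \<in> carrier Valentiner"
  show "h v = h' v"
    by (rule covers_unique[OF is_val_proj_covers[OF assms(1) v] is_val_proj_covers[OF assms(2) v]])
qed (use assms in \<open>auto simp: is_val_proj_def\<close>)

theorem is_val_proj_val_proj: "is_val_proj val_proj"
  unfolding val_proj_def by (rule theI'[of is_val_proj]) (rule ex_ex1I[OF is_val_proj_ex val_proj_unique])

end

theory Submission
  imports Defs
begin

text \<open>
  Tuples are encoded by lists over the 45 indices of \<open>C22\<close>, on which conjugation is a table. The
  argument works up to braid moves and all of \<open>Aut(A_6)\<close>, a group of order 1440 that acts on
  \<open>C22\<close>: a tuple of length at most 4 is moved to one of a few representatives, and a generating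
  tuple of length at least 5 can be braided to \<open>s @ [g]\<close> with \<open>s\<close> still generating, so
  representatives of length \<open>k + 1\<close> are found among the extensions of those of length \<open>k\<close>. From
  length 8 on every generating tuple is equivalent to one of the form \<open>a, a, T\<close> with \<open>T\<close> generating.
  Since \<open>a, a\<close> can be conjugated by the entries of \<open>T\<close> without changing \<open>T\<close>, the element \<open>a\<close>
  may be replaced by any other, and as the lift of \<open>a\<close> has order 2 the lifting invariant is that
  of \<open>T\<close>. This reduces the length by two and leaves the lengths 5, 6 and 7. The kernel of the
  Valentiner group is computed from its action on the hexacode.
\<close>

text \<open>The braid action uses conjugation alone, so up to the lifting invariant everything takes
  place in the rack of 45 involutions. Removing an entry destroys a trivial product; the
  certificates therefore classify all generating tuples, and the product condition is imposed
  afterwards. Working up to \<open>Aut(A_6)\<close> keeps the lists short but hides the invariant,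
  since \<open>alpha\<close> and \<open>epsilon\<close> both exchange its two nontrivial values. To
  return to inner automorphisms, the images of the final representatives under these maps are
  braided back to representatives. The short lengths are exceptional for one reason: no generating
  4-tuple has product 1, and no Nielsen 5-tuple has trivial invariant. Hence Nielsen tuples of
  length 6, and those of length 7 with trivial invariant, cannot take the form
  \<open>a, a, T\<close> with \<open>T\<close> generating. The group \<open>V\<close> is never
  enumerated: its kernel acts freely on three points, so it has at most three elements, and the
  invariants of two explicit 5-tuples supply the nontrivial ones.\<close>

section \<open>Indexing the involutions\<close>

text \<open>Certificates are evaluated by rewriting with numerals, where \<open>1\<close> has to stay a numeral.\<close>

declare One_nat_def [simp del]

text \<open>Normal form \<open>a < b\<close>, \<open>c < d\<close>, \<open>a < c\<close> in
  lexicographic order, so that each of the 15 * 3 involutions is listed once.\<close>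

definition pts :: "(nat \<times> nat \<times> nat \<times> nat) list" where
  "pts = [
 (1,2,3,4),(1,2,3,5),(1,2,3,6),(1,2,4,5),(1,2,4,6),(1,2,5,6),(1,3,2,4),(1,3,2,5),(1,3,2,6),(1,3,4,
 5),(1,3,4,6),(1,3,5,6),(1,4,2,3),(1,4,2,5),(1,4,2,6),(1,4,3,5),(1,4,3,6),(1,4,5,6),(1,5,2,3),(1,
 5,2,4),(1,5,2,6),(1,5,3,4),(1,5,3,6),(1,5,4,6),(1,6,2,3),(1,6,2,4),(1,6,2,5),(1,6,3,4),(1,6,3,5),
 (1,6,4,5),(2,3,4,5),(2,3,4,6),(2,3,5,6),(2,4,3,5),(2,4,3,6),(2,4,5,6),(2,5,3,4),(2,5,3,6),(2,5,4,
 6),(2,6,3,4),(2,6,3,5),(2,6,4,5),(3,4,5,6),(3,5,4,6),(3,6,4,5)]"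

definition pt :: "nat \<Rightarrow> nat \<times> nat \<times> nat \<times> nat" where "pt i = pts ! i"

definition enc :: "nat \<Rightarrow> nat \<Rightarrow> nat" where
  "enc i = (case pt i of (a, b, c, d) \<Rightarrow> transpose a b \<circ> transpose c d)"

text \<open>\<open>cj x y\<close> is the index of the conjugate of \<open>x\<close> by \<open>y\<close>, \<open>alpha\<close> is conjugation by the
  transposition \<open>(1 2)\<close>, and \<open>epsilon\<close> an automorphism of \<open>A_6\<close> not induced by \<open>S_6\<close>.\<close>

definition cj_table :: "nat list list" where
  "cj_table = [
 [0,3,4,1,2,0,0,15,16,18,24,12,0,9,10,19,25,6,33,30,42,36,38,37,34,31,42,39,41,40,7,8,6,13,14,12,
 21,23,22,27,29,28,0,5,5],[3,1,5,0,1,2,21,1,22,12,18,24,36,30,43,33,35,34,1,9,11,13,26,7,37,43,32,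
 41,40,39,6,7,8,15,17,16,19,20,18,29,28,27,4,1,4],[4,5,2,2,0,1,27,28,2,24,12,18,39,44,31,35,34,33,
 40,44,32,38,37,36,2,10,11,14,20,8,8,6,7,17,16,15,23,22,21,25,26,24,3,3,2],[1,0,3,3,5,4,36,33,44,
 30,32,31,21,3,23,6,19,25,15,3,17,7,13,26,44,38,35,40,39,41,9,11,10,12,13,14,18,19,20,28,27,29,2,
 2,3],[2,4,0,5,4,3,39,43,34,32,31,30,27,29,4,25,6,19,43,41,35,37,36,38,16,4,17,8,14,20,11,10,9,14,
 12,13,22,21,23,24,25,26,1,4,1],[5,2,1,4,3,5,42,40,37,31,30,32,42,41,38,34,33,35,28,29,5,26,7,13,
 22,23,5,20,8,14,10,9,11,16,15,17,20,18,19,26,24,25,5,0,0],[6,13,14,18,24,12,6,9,10,7,8,6,6,21,27,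
 3,4,0,36,33,43,30,35,40,39,34,44,31,35,37,1,2,0,19,25,6,15,29,11,16,23,11,12,20,26],[19,7,20,12,
 18,24,9,7,11,6,7,8,33,36,42,30,38,39,7,15,28,3,5,1,40,44,37,38,32,34,0,1,2,21,29,10,13,26,7,17,
 22,10,14,18,25],[25,26,8,24,12,18,10,11,8,8,6,7,34,42,39,41,31,36,37,43,40,41,32,33,8,16,22,4,5,
 2,2,0,1,23,27,9,17,28,9,14,20,8,13,19,24],[33,36,41,30,32,31,7,6,9,9,11,10,19,0,21,9,23,27,13,1,
 15,9,17,28,41,37,34,43,42,44,3,5,4,18,26,8,12,25,8,15,21,9,16,22,29],[34,38,39,32,31,30,8,10,6,
 11,10,9,25,27,0,29,10,21,38,40,33,44,42,43,14,2,16,10,17,22,5,4,3,20,24,7,16,27,10,12,19,7,15,23,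
 28],[35,37,40,31,30,32,11,8,7,10,9,11,35,39,36,44,43,42,26,28,1,29,11,15,20,22,2,23,11,16,4,3,5,
 22,28,11,14,24,6,13,18,6,17,21,27],[12,19,25,7,8,6,12,21,27,1,2,0,12,15,16,13,14,12,30,36,44,33,
 41,32,31,39,43,34,38,32,18,24,12,3,4,0,9,17,28,10,17,22,6,26,20],[18,6,19,13,20,25,30,36,42,33,
 37,39,15,13,17,12,13,14,9,13,29,1,3,5,43,41,38,37,31,35,21,28,16,0,3,4,7,13,26,11,16,23,8,24,19],
 [24,25,6,26,14,19,31,42,39,40,34,36,16,17,14,14,12,13,44,38,41,40,30,35,10,14,23,2,4,5,22,27,15,
 4,0,3,11,15,29,8,14,20,7,25,18],[30,33,35,36,40,34,18,0,21,15,22,27,13,12,15,15,17,16,3,7,9,15,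
 29,11,38,40,31,44,43,42,19,26,14,1,5,2,6,14,24,9,15,21,10,28,23],[31,35,34,37,39,33,24,27,0,28,
 16,21,14,16,12,17,16,15,41,37,30,43,44,42,4,8,10,16,23,11,20,25,13,5,2,1,10,16,27,6,13,18,9,29,
 22],[32,34,33,38,41,35,32,39,36,43,44,42,17,14,13,16,15,17,29,26,3,28,9,17,23,20,4,22,10,17,23,
 29,17,2,1,5,8,12,25,7,12,19,11,27,21],[13,18,26,6,7,8,15,18,28,0,1,2,30,33,44,36,41,31,18,21,22,
 19,20,18,32,42,40,35,37,31,12,18,24,9,23,27,3,5,1,23,11,16,25,7,14],[7,12,13,19,26,14,33,30,43,
 36,40,34,9,19,29,0,3,4,21,19,23,18,19,20,42,35,41,32,34,38,15,22,27,6,19,25,1,3,5,22,10,17,24,8,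
 13],[26,24,7,25,13,20,43,32,40,39,33,37,44,35,41,39,30,38,22,23,20,20,18,19,11,17,20,5,2,4,16,21,
 28,10,21,29,5,1,3,20,8,14,26,6,12],[36,30,38,33,37,39,1,12,15,21,28,16,3,6,9,21,29,10,19,18,21,
 21,23,22,35,32,39,42,44,43,13,20,25,7,20,24,0,4,2,21,9,15,27,11,17],[38,32,37,34,36,40,28,24,1,
 27,15,22,41,34,30,42,44,43,20,22,18,23,22,21,5,11,8,17,22,10,14,19,26,11,22,28,4,2,0,19,7,12,29,
 9,16],[37,31,36,35,38,41,40,31,33,42,43,44,29,25,3,27,9,23,23,20,19,22,21,23,17,5,14,11,16,23,17,
 23,29,8,18,26,2,0,4,18,6,13,28,10,15],[14,20,24,8,6,7,16,22,24,2,0,1,31,43,34,38,39,30,32,42,37,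
 35,40,30,24,27,28,25,26,24,24,12,18,29,10,21,29,11,15,4,5,2,19,13,8],[8,14,12,20,25,13,34,44,31,
 37,39,33,10,23,25,4,0,3,42,35,38,32,33,41,27,25,29,24,25,26,28,16,21,25,6,19,28,9,17,2,4,5,18,14,
 7],[20,8,18,14,19,26,44,37,32,34,36,40,43,38,35,31,36,41,11,17,26,5,1,3,28,29,26,26,24,25,27,15,
 22,27,9,23,26,7,13,5,2,4,20,12,6],[39,41,31,40,34,36,2,16,12,22,27,15,4,10,6,23,27,9,35,32,36,42,
 43,44,25,24,27,27,29,28,26,14,19,26,8,18,27,10,16,0,3,1,21,17,11],[41,40,32,39,33,37,22,2,18,16,
 21,28,38,31,33,43,42,44,5,11,7,17,28,9,26,28,24,29,28,27,25,13,20,28,11,22,25,8,12,3,1,0,23,15,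
 10],[40,39,30,41,35,38,37,34,30,44,42,43,23,4,19,10,21,29,17,5,13,11,15,29,29,26,25,28,27,29,29,
 17,23,24,7,20,24,6,14,1,0,3,22,16,9],[15,21,29,9,11,10,13,19,29,3,5,4,18,1,22,7,20,24,12,0,16,6,
 14,24,30,36,33,33,36,30,30,32,31,30,38,39,30,35,40,43,42,44,34,37,41],[16,23,27,11,10,9,14,23,25,
 5,4,3,24,28,2,26,8,18,31,39,34,34,39,31,12,0,15,6,13,18,32,31,30,41,31,36,44,42,43,31,35,37,33,
 38,40],[17,22,28,10,9,11,17,20,26,4,3,5,32,40,37,37,40,32,24,27,2,25,8,12,18,21,1,19,7,12,31,30,
 32,44,43,42,41,32,33,38,32,34,35,36,39],[9,15,17,21,28,16,19,3,23,13,20,25,7,18,28,1,5,2,0,6,10,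
 12,25,8,36,33,30,30,33,36,33,37,39,33,35,34,33,41,32,44,43,42,31,40,38],[10,17,16,22,27,15,25,29,
 4,26,14,19,8,22,24,5,2,1,39,34,31,31,34,39,0,6,9,12,19,7,40,34,36,35,34,33,43,44,42,34,38,32,30,
 41,37],[11,16,15,23,29,17,35,41,38,38,41,35,11,20,26,2,1,5,27,25,4,24,6,14,21,19,3,18,6,13,43,44,
 42,34,33,35,40,30,35,37,31,35,32,39,36],[21,9,23,15,22,27,3,13,17,19,26,14,1,7,11,18,26,8,6,12,
 27,0,4,2,33,30,36,36,30,33,36,40,34,36,41,31,36,38,37,42,44,43,39,32,35],[23,11,22,16,21,28,29,
 26,5,25,13,20,40,37,32,32,37,40,8,16,24,4,2,0,1,9,7,13,18,6,39,33,37,42,44,43,38,37,36,35,37,31,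
 41,30,34],[22,10,21,17,23,29,41,38,35,35,38,41,28,26,5,24,7,20,10,14,25,2,0,4,15,3,13,7,12,19,42,
 43,44,39,30,38,37,36,38,32,34,38,40,31,33],[27,29,10,28,16,21,4,17,14,20,25,13,2,11,8,20,24,7,34,
 31,39,39,31,34,6,12,21,0,3,1,37,39,33,38,39,30,42,43,44,39,41,40,36,35,32],[29,28,11,27,15,22,23,
 5,20,14,19,26,37,32,40,40,32,37,2,10,8,14,24,6,7,15,18,3,1,0,34,36,40,43,42,44,35,40,30,41,40,39,
 38,33,31],[28,27,9,29,17,23,38,35,41,41,35,38,22,5,20,8,18,26,16,4,14,8,12,25,9,13,19,1,0,3,44,
 42,43,31,36,41,32,33,41,40,39,41,37,34,30],[42,44,43,43,44,42,5,14,13,23,29,17,5,8,7,22,28,11,25,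
 24,0,27,10,16,19,18,0,21,9,15,38,41,35,37,40,32,39,31,34,36,30,33,42,42,42],[44,43,42,42,43,44,
 20,4,19,17,23,29,26,24,1,28,11,22,4,8,6,16,27,10,13,1,12,9,15,21,35,38,41,40,32,37,34,39,31,30,
 33,36,43,43,43],[43,42,44,44,42,43,26,25,3,29,17,23,20,2,18,11,22,28,14,2,12,10,16,27,3,7,6,15,
 21,9,41,35,38,32,37,40,31,34,39,33,36,30,44,44,44]]"

definition cj :: "nat \<Rightarrow> nat \<Rightarrow> nat" where
  "cj x y = cj_table ! x ! y"

definition alpha_table :: "nat list" where
  "alpha_table = [
 0,1,2,3,4,5,12,18,24,30,31,32,6,19,25,33,34,35,7,13,26,36,37,38,8,14,20,39,40,41,9,10,11,15,16,
 17,21,22,23,27,28,29,42,43,44]"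

definition epsilon_table :: "nat list" where
  "epsilon_table = [
 0,22,41,38,28,12,42,19,8,24,13,43,5,10,33,30,16,20,34,7,17,29,1,39,9,25,32,37,4,21,15,31,26,14,
 18,44,40,27,3,23,36,2,6,11,35]"

definition alpha :: "nat \<Rightarrow> nat" where "alpha x = alpha_table ! x"

definition epsilon :: "nat \<Rightarrow> nat" where "epsilon x = epsilon_table ! x"

lemma map_nth_upt45: "length xs = 45 \<Longrightarrow> map (\<lambda>i. xs ! i) [0..<45] = xs"
  using map_nth[of xs] by simp

lemma idx45: "[0..<45] = [0, 1, 2, 3, 4, 5, 6, 7, 8, 9, 10, 11, 12, 13, 14, 15, 16, 17, 18, 19, 20, 21, 22,
    23, 24, 25, 26, 27, 28, 29, 30, 31, 32, 33, 34, 35, 36, 37, 38, 39, 40, 41, 42, 43, 44::nat]"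
  by code_simp

lemma ball45: "(\<forall>x<45. P x) \<longleftrightarrow> list_all P [0..<45]"
  by (auto simp: list_all_iff)

lemma cj_table_rows: "length cj_table = 45" "list_all (\<lambda>r. length r = 45) cj_table"
  by (simp_all add: cj_table_def)

lemma cj_map: "map (\<lambda>x. map (cj x) [0..<45]) [0..<45] = cj_table"
proof (rule nth_equalityI)
  fix i assume "i < length (map (\<lambda>x. map (cj x) [0..<45]) [0..<45])"
  then have i: "i < 45" by simp
  then have "length (cj_table ! i) = 45"
    using cj_table_rows by (simp add: list_all_length)
  then show "map (\<lambda>x. map (cj x) [0..<45]) [0..<45] ! i = cj_table ! i"
    using i map_nth_upt45[of "cj_table ! i"] by (simp add: cj_def[abs_def])
qed (simp add: cj_table_rows)

lemma alpha_map: "map alpha [0..<45] = alpha_table"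
  using map_nth_upt45[of alpha_table] by (simp add: alpha_def alpha_table_def cong: map_cong)

lemma epsilon_map: "map epsilon [0..<45] = epsilon_table"
  using map_nth_upt45[of epsilon_table] by (simp add: epsilon_def epsilon_table_def cong: map_cong)

lemma length_pts: "length pts = 45"
  by (simp add: pts_def)

lemma pts_map: "map (\<lambda>i. pt i) [0..<45] = pts"
  unfolding pt_def by (rule map_nth_upt45[OF length_pts])

text \<open>Unconditional equations between numerals, one for each pair of indices:
  \<open>simp\<close> evaluates \<open>cj\<close> by a single rewrite step instead of walking
  through the table.\<close>

lemmas cj_eqs = cj_map[unfolded idx45 list.map cj_table_def list.inject simp_thms]
lemmas alpha_eqs = alpha_map[unfolded idx45 list.map alpha_table_def list.inject simp_thms]
lemmas epsilon_eqs = epsilon_map[unfolded idx45 list.map epsilon_table_def list.inject simp_thms]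
lemmas pts_eqs = pts_map[unfolded idx45 list.map pts_def list.inject simp_thms]

lemma cj_lt: "x < 45 \<Longrightarrow> y < 45 \<Longrightarrow> cj x y < 45"
proof -
  have "\<forall>x<45. \<forall>y<45. cj x y < 45"
    unfolding ball45 idx45 list.pred_inject by (simp add: cj_eqs)
  then show "x < 45 \<Longrightarrow> y < 45 \<Longrightarrow> cj x y < 45" by blast
qed

lemma enc_map: "map (\<lambda>i. map (enc i) [1, 2, 3, 4, 5, 6]) [0..<45] = [
    [2, 1, 4, 3, 5, 6], [2, 1, 5, 4, 3, 6], [2, 1, 6, 4, 5, 3], [2, 1, 3, 5, 4, 6], [2, 1, 3, 6,
    5, 4], [2, 1, 3, 4, 6, 5], [3, 4, 1, 2, 5, 6], [3, 5, 1, 4, 2, 6], [3, 6, 1, 4, 5, 2], [3,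
    2, 1, 5, 4, 6], [3, 2, 1, 6, 5, 4], [3, 2, 1, 4, 6, 5], [4, 3, 2, 1, 5, 6], [4, 5, 3, 1, 2,
    6], [4, 6, 3, 1, 5, 2], [4, 2, 5, 1, 3, 6], [4, 2, 6, 1, 5, 3], [4, 2, 3, 1, 6, 5], [5, 3,
    2, 4, 1, 6], [5, 4, 3, 2, 1, 6], [5, 6, 3, 4, 1, 2], [5, 2, 4, 3, 1, 6], [5, 2, 6, 4, 1, 3],
    [5, 2, 3, 6, 1, 4], [6, 3, 2, 4, 5, 1], [6, 4, 3, 2, 5, 1], [6, 5, 3, 4, 2, 1], [6, 2, 4, 3,
    5, 1], [6, 2, 5, 4, 3, 1], [6, 2, 3, 5, 4, 1], [1, 3, 2, 5, 4, 6], [1, 3, 2, 6, 5, 4], [1,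
    3, 2, 4, 6, 5], [1, 4, 5, 2, 3, 6], [1, 4, 6, 2, 5, 3], [1, 4, 3, 2, 6, 5], [1, 5, 4, 3, 2,
    6], [1, 5, 6, 4, 2, 3], [1, 5, 3, 6, 2, 4], [1, 6, 4, 3, 5, 2], [1, 6, 5, 4, 3, 2], [1, 6,
    3, 5, 4, 2], [1, 2, 4, 3, 6, 5], [1, 2, 5, 6, 3, 4], [1, 2, 6, 5, 4, 3]]"
  unfolding idx45 by (simp add: enc_def pts_eqs transpose_def)

lemmas enc_eqs = enc_map[unfolded idx45 list.map list.inject simp_thms]

lemma less45E:
  assumes "i < (45::nat)" "list_all P [0..<45]" shows "P i"
  using assms by (simp add: list_all_iff)

lemma enc_permutes: "i < 45 \<Longrightarrow> enc i permutes {1..6}"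
proof (erule less45E)
  have "list_all (\<lambda>(a, b, c, d). {a, b, c, d} \<subseteq> {1..6}) pts"
    by (simp add: pts_def)
  then have "list_all (\<lambda>i. case pt i of (a, b, c, d) \<Rightarrow> {a, b, c, d} \<subseteq> {1..6}) [0..<45]"
    by (auto simp: list_all_length pt_def length_pts)
  then show "list_all (\<lambda>i. enc i permutes {1..6}) [0..<45]"
    by (auto simp: list_all_iff enc_def split: prod.splits intro!: permutes_compose permutes_swap_id)
qed

lemma permutes6_eqI:
  fixes f g :: "nat \<Rightarrow> nat"
  assumes "f permutes {1..6}" "g permutes {1..6}" "list_all (\<lambda>p. f p = g p) [1, 2, 3, 4, 5, 6]"
  shows "f = g"
proof
  fix p :: nat
  show "f p = g p"
    using assms unfolding permutes_def ivl6 by (cases "p \<in> {1, 2, 3, 4, 5, 6}") auto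
qed

text \<open>The table is validated here against the actual permutations. Both sides permute six
  points, so finitely many values decide; \<open>enc y\<close> is an involution, so no inverse is
  written.\<close>

lemma enc_cj:
  assumes "x < 45" "y < 45" shows "enc (cj x y) = enc y \<circ> enc x \<circ> enc y"
proof (rule permutes6_eqI)
  have "\<forall>x<45. \<forall>y<45. list_all (\<lambda>p. enc (cj x y) p = (enc y \<circ> enc x \<circ> enc y) p) [1, 2, 3, 4, 5, 6]"
    unfolding ball45 idx45 list.pred_inject comp_apply by (simp add: cj_eqs enc_eqs)
  then show "list_all (\<lambda>p. enc (cj x y) p = (enc y \<circ> enc x \<circ> enc y) p) [1, 2, 3, 4, 5, 6]"
    using assms by blast
qed (use assms in \<open>simp_all add: enc_permutes cj_lt permutes_compose\<close>)

lemma enc_inj: "inj_on enc {..<45}"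
proof (rule inj_onI)
  fix x y assume xy: "x \<in> {..<45}" "y \<in> {..<45}" "enc x = enc y"
  have "distinct (map (\<lambda>i. map (enc i) [1, 2, 3, 4, 5, 6]) [0..<45])"
    unfolding enc_map by simp
  then have "inj_on (\<lambda>i. map (enc i) [1, 2, 3, 4, 5, 6]) {..<45}"
    by (simp add: distinct_map atLeast0LessThan)
  then show "x = y" by (rule inj_onD) (use xy in simp_all)
qed

lemma enc_enc: "i < 45 \<Longrightarrow> enc i \<circ> enc i = id"
proof (erule less45E)
  have "list_all (\<lambda>i. list_all (\<lambda>p. enc i (enc i p) = p) [1, 2, 3, 4, 5, 6]) [0..<45]"
    unfolding idx45 list.pred_inject by (simp add: enc_eqs)
  then show "list_all (\<lambda>i. enc i \<circ> enc i = id) [0..<45]"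
    by (auto simp: list_all_iff intro!: permutes6_eqI permutes_compose enc_permutes permutes_id)
qed

lemma enc_enc_apply: "i < 45 \<Longrightarrow> enc i (enc i p) = p"
  using enc_enc by (metis comp_apply id_apply)

lemma C22_enc: "C22 = enc ` {..<45}"
proof
  have mem: "(a, b, c, d) \<in> set pts"
    if "{a, b, c, d} \<subseteq> {1..6}" "distinct [a, b, c, d]" "a < b" "c < d" "a < c" for a b c d
  proof -
    have "\<forall>a\<in>set [1, 2, 3, 4, 5, 6]. \<forall>b\<in>set [1, 2, 3, 4, 5, 6]. \<forall>c\<in>set [1, 2, 3, 4, 5, 6]. \<forall>d\<in>set [1, 2, 3, 4, 5, 6].
        a < b \<longrightarrow> c < d \<longrightarrow> a < c \<longrightarrow> b \<noteq> c \<longrightarrow> b \<noteq> d \<longrightarrow> (a, b, c, d) \<in> set pts"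
      by (simp add: pts_def)
    moreover have "a \<in> set [1, 2, 3, 4, 5, 6]" "b \<in> set [1, 2, 3, 4, 5, 6]"
      "c \<in> set [1, 2, 3, 4, 5, 6]" "d \<in> set [1, 2, 3, 4, 5, 6]"
      using that(1) unfolding ivl6 by auto
    ultimately have "a < b \<longrightarrow> c < d \<longrightarrow> a < c \<longrightarrow> b \<noteq> c \<longrightarrow> b \<noteq> d \<longrightarrow> (a, b, c, d) \<in> set pts"
      by blast
    then show ?thesis using that(2-) by simp
  qed
  have set_pts: "transpose a b \<circ> transpose c d \<in> enc ` {..<45}" if ptm: "(a, b, c, d) \<in> set pts" for a b c d
  proof -
    obtain i where "i < 45" "pt i = (a, b, c, d)"
      using ptm unfolding in_set_conv_nth length_pts pt_def by blast
    then show ?thesis by (auto simp: enc_def intro!: image_eqI[of _ _ i])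
  qed
  have comm: "transpose a b \<circ> transpose c d = transpose c d \<circ> transpose a b"
    if "distinct [a, b, c, d]" for a b c d :: nat
    using that by (auto simp: fun_eq_iff transpose_def)
  show "C22 \<subseteq> enc ` {..<45}"
  proof
    fix g assume "g \<in> C22"
    then obtain a b c d where g: "g = transpose a b \<circ> transpose c d"
      and abcd: "{a, b, c, d} \<subseteq> {1..6}" "distinct [a, b, c, d]"
      unfolding C22_def by auto
    \<comment> \<open>Ordering each transposition, and then the two disjoint and hence commuting
      transpositions, gives a quadruple of \<open>pts\<close>.\<close>
    define a' b' c' d' where "a' = min a b" and "b' = max a b" and "c' = min c d" and "d' = max c d"
    have g': "g = transpose a' b' \<circ> transpose c' d'"
      unfolding g a'_def b'_def c'_def d'_def
      by (simp add: min_def max_def transpose_commute)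
    have p: "{a', b', c', d'} \<subseteq> {1..6}" "distinct [a', b', c', d']" "a' < b'" "c' < d'"
      using abcd unfolding a'_def b'_def c'_def d'_def by (auto simp: min_def max_def)
    have "a' < c' \<or> c' < a'" using p by auto
    then show "g \<in> enc ` {..<45}"
    proof
      assume ac: "a' < c'"
      then show ?thesis using set_pts[OF mem[OF p ac]] g' by simp
    next
      assume "c' < a'"
      moreover have "g = transpose c' d' \<circ> transpose a' b'" using g' comm[OF p(2)] by simp
      ultimately show ?thesis using set_pts[OF mem[of c' d' a' b']] p by auto
    qed
  qed
  show "enc ` {..<45} \<subseteq> C22"
  proof
    fix g assume "g \<in> enc ` {..<45}"
    then obtain i where i: "i < 45" "g = enc i" by auto
    obtain a b c d where q: "pt i = (a, b, c, d)" by (metis prod_cases4)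
    have "(a, b, c, d) \<in> set pts" using i q nth_mem[of i pts] by (simp add: pt_def length_pts)
    moreover have "list_all (\<lambda>(a, b, c, d). {a, b, c, d} \<subseteq> {1..6} \<and> distinct [a, b, c, d]) pts"
      by (simp add: pts_def)
    ultimately have "{a, b, c, d} \<subseteq> {1..6} \<and> distinct [a, b, c, d]"
      unfolding list_all_iff by auto
    then show "g \<in> C22" unfolding C22_def i(2) enc_def q by fastforce
  qed
qed

section \<open>Braid moves and automorphisms on index lists\<close>

lemma cj_eqI:
  assumes "x < 45" "y < 45" "enc x = enc y" shows "x = y"
  using inj_onD[OF enc_inj] assms by simp

text \<open>The laws of an involutory rack are pulled back from composition of permutations along
  the injective \<open>enc\<close>, with no further inspection of the table.\<close>

lemma cj_cj: "x < 45 \<Longrightarrow> y < 45 \<Longrightarrow> cj (cj x y) y = x"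
  by (rule cj_eqI) (auto simp: cj_lt enc_cj enc_enc_apply fun_eq_iff)

lemma cj_distrib: "x < 45 \<Longrightarrow> y < 45 \<Longrightarrow> z < 45 \<Longrightarrow> cj (cj x y) z = cj (cj x z) (cj y z)"
  by (rule cj_eqI) (auto simp: cj_lt enc_cj enc_enc_apply fun_eq_iff)

lemma cj_cj_right: "x < 45 \<Longrightarrow> y < 45 \<Longrightarrow> z < 45 \<Longrightarrow> cj x (cj y z) = cj (cj (cj x z) y) z"
  by (rule cj_eqI) (auto simp: cj_lt enc_cj enc_enc_apply fun_eq_iff)

text \<open>Involutivity is built in so that \<open>map f\<close> undoes itself; this makes
  \<open>heq\<close> symmetric although it has no rule for inverse automorphisms.\<close>

definition rack_aut :: "(nat \<Rightarrow> nat) \<Rightarrow> bool" where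
  "rack_aut f \<longleftrightarrow> (\<forall>x<45. f x < 45 \<and> f (f x) = x \<and> (\<forall>y<45. f (cj x y) = cj (f x) (f y)))"

lemma rack_autD:
  assumes "rack_aut f"
  shows "x < 45 \<Longrightarrow> f x < 45" "x < 45 \<Longrightarrow> f (f x) = x"
    "x < 45 \<Longrightarrow> y < 45 \<Longrightarrow> f (cj x y) = cj (f x) (f y)"
  using assms by (auto simp: rack_aut_def)

lemma rack_aut_alpha: "rack_aut alpha"
  unfolding rack_aut_def ball45 idx45 list.pred_inject by (simp add: cj_eqs alpha_eqs)

lemma rack_aut_epsilon: "rack_aut epsilon"
  unfolding rack_aut_def ball45 idx45 list.pred_inject by (simp add: cj_eqs epsilon_eqs)

lemma rack_aut_cj: "c < 45 \<Longrightarrow> rack_aut (\<lambda>x. cj x c)"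
  unfolding rack_aut_def using cj_lt cj_cj cj_distrib by blast

text \<open>Conjugations by the 45 involutions only. These generate A_6 and \<open>heq\<close>
  composes them, so all inner automorphisms are reached.\<close>

definition inners :: "(nat \<Rightarrow> nat) set" where
  "inners = {\<lambda>x. cj x c | c. c < 45}"

definition auts :: "(nat \<Rightarrow> nat) set" where
  "auts = insert alpha (insert epsilon inners)"

lemma rack_aut_inners: "f \<in> inners \<Longrightarrow> rack_aut f"
  using rack_aut_cj by (auto simp: inners_def)

lemma rack_aut_auts: "f \<in> auts \<Longrightarrow> rack_aut f"
  using rack_aut_inners rack_aut_alpha rack_aut_epsilon by (auto simp: auts_def)

text \<open>The last equation makes the move trivial when the index is out of range, so that words
  of moves apply to tuples of any length. The inverse move is \<open>bi\<close>.\<close>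

fun bm :: "nat \<Rightarrow> nat list \<Rightarrow> nat list" where
  "bm 0 (x # y # t) = y # cj x y # t"
| "bm (Suc i) (x # t) = x # bm i t"
| "bm _ t = t"

fun bi :: "nat \<Rightarrow> nat list \<Rightarrow> nat list" where
  "bi 0 (x # y # t) = cj y x # x # t"
| "bi (Suc i) (x # t) = x # bi i t"
| "bi _ t = t"

definition tup :: "nat list \<Rightarrow> bool" where
  "tup t \<longleftrightarrow> set t \<subseteq> {..<45}"

lemma tup_simps [simp]:
  "tup []" "tup (x # t) \<longleftrightarrow> x < 45 \<and> tup t" "tup (s @ t) \<longleftrightarrow> tup s \<and> tup t"
  by (auto simp: tup_def)

lemma tup_map: "rack_aut f \<Longrightarrow> tup t \<Longrightarrow> tup (map f t)"
  by (induction t) (auto dest: rack_autD)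

lemma map_map_aut: "rack_aut f \<Longrightarrow> tup t \<Longrightarrow> map f (map f t) = t"
  by (induction t) (auto dest: rack_autD)

lemma length_bm [simp]: "length (bm i t) = length t"
  by (induction i t rule: bm.induct) auto

lemma length_bi [simp]: "length (bi i t) = length t"
  by (induction i t rule: bi.induct) auto

lemma tup_bm: "tup t \<Longrightarrow> tup (bm i t)"
  by (induction i t rule: bm.induct) (auto simp: cj_lt)

lemma tup_bi: "tup t \<Longrightarrow> tup (bi i t)"
  by (induction i t rule: bi.induct) (auto simp: cj_lt)

lemma bm_bi: "tup t \<Longrightarrow> bm i (bi i t) = t"
  by (induction i t rule: bi.induct) (auto simp: cj_cj)

lemma bi_bm: "tup t \<Longrightarrow> bi i (bm i t) = t"
  by (induction i t rule: bm.induct) (auto simp: cj_cj)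

lemma bm_map: "rack_aut f \<Longrightarrow> tup t \<Longrightarrow> bm i (map f t) = map f (bm i t)"
  by (induction i t rule: bm.induct) (auto simp: rack_autD)

lemma bi_map: "rack_aut f \<Longrightarrow> tup t \<Longrightarrow> bi i (map f t) = map f (bi i t)"
  by (induction i t rule: bi.induct) (auto simp: rack_autD)

lemma bm_outside: "length t \<le> Suc i \<Longrightarrow> bm i t = t"
  by (induction i t rule: bm.induct) auto

lemma bi_outside: "length t \<le> Suc i \<Longrightarrow> bi i t = t"
  by (induction i t rule: bi.induct) auto

lemma bm_append: "Suc i < length t \<Longrightarrow> bm i (t @ q) = bm i t @ q"
  by (induction i t rule: bm.induct) auto

lemma bi_append: "Suc i < length t \<Longrightarrow> bi i (t @ q) = bi i t @ q"
  by (induction i t rule: bi.induct) auto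

lemma bm_prepend: "bm (length p + i) (p @ t) = p @ bm i t"
  by (induction p) auto

lemma bi_prepend: "bi (length p + i) (p @ t) = p @ bi i t"
  by (induction p) auto

inductive heq :: "(nat \<Rightarrow> nat) set \<Rightarrow> nat list \<Rightarrow> nat list \<Rightarrow> bool" for F where
  heq_refl: "tup t \<Longrightarrow> heq F t t"
| heq_bm: "heq F t u \<Longrightarrow> heq F t (bm i u)"
| heq_bi: "heq F t u \<Longrightarrow> heq F t (bi i u)"
| heq_map: "heq F t u \<Longrightarrow> f \<in> F \<Longrightarrow> heq F t (map f u)"

text \<open>\<open>seq\<close> is Hurwitz equivalence up to inner automorphisms, \<open>weq\<close> the same up to \<open>Aut(A_6)\<close>.\<close>

abbreviation seq :: "nat list \<Rightarrow> nat list \<Rightarrow> bool" where "seq \<equiv> heq inners"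
abbreviation weq :: "nat list \<Rightarrow> nat list \<Rightarrow> bool" where "weq \<equiv> heq auts"

lemma heq_length: "heq F t u \<Longrightarrow> length u = length t"
  by (induction rule: heq.induct) auto

lemma heq_trans: "heq F t u \<Longrightarrow> heq F s t \<Longrightarrow> heq F s u"
  by (induction rule: heq.induct) (auto intro: heq.intros)

lemma heq_mono: "heq F t u \<Longrightarrow> F \<subseteq> G \<Longrightarrow> heq G t u"
  by (induction rule: heq.induct) (auto intro: heq.intros)

lemma seq_weq: "seq t u \<Longrightarrow> weq t u"
  by (erule heq_mono) (auto simp: auts_def)

text \<open>Abstracts over the automorphisms allowed, so that symmetry, changes of context and the
  moves of doubled entries are proved once for both \<open>seq\<close> and
  \<open>weq\<close>.\<close>

locale rack_auts =
  fixes F :: "(nat \<Rightarrow> nat) set"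
  assumes F: "f \<in> F \<Longrightarrow> rack_aut f"
begin

lemma heq_tup: "heq F t u \<Longrightarrow> tup t \<and> tup u"
  by (induction rule: heq.induct) (auto intro: tup_bm tup_bi tup_map F)

lemma heq_sym: "heq F t u \<Longrightarrow> heq F u t"
proof (induction rule: heq.induct)
  case (heq_bm t u i)
  then have u: "tup u" using heq_tup by blast
  then have "heq F (bm i u) (bi i (bm i u))"
    by (intro heq.heq_bi heq.heq_refl tup_bm)
  then have "heq F (bm i u) u" by (simp only: bi_bm u)
  then show ?case by (rule heq_trans[OF heq_bm.IH])
next
  case (heq_bi t u i)
  then have u: "tup u" using heq_tup by blast
  then have "heq F (bi i u) (bm i (bi i u))"
    by (intro heq.heq_bm heq.heq_refl tup_bi)
  then have "heq F (bi i u) u" by (simp only: bm_bi u)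
  then show ?case by (rule heq_trans[OF heq_bi.IH])
next
  case (heq_map t u f)
  then have u: "tup u" using heq_tup by blast
  then have "heq F (map f u) (map f (map f u))"
    by (intro heq.heq_map heq.heq_refl tup_map F heq_map.hyps)
  then have "heq F (map f u) u" by (simp only: map_map_aut[OF F[OF heq_map.hyps(2)] u])
  then show ?case by (rule heq_trans[OF heq_map.IH])
qed (rule heq.heq_refl)

text \<open>Rack automorphisms commute with braid moves. The last premise says that \<open>g\<close>
  normalizes \<open>F\<close>; for \<open>F = inners\<close> it holds because \<open>g\<close>
  carries conjugation by \<open>c\<close> to conjugation by \<open>g c\<close>.\<close>

lemma heq_aut: "heq F t u \<Longrightarrow> rack_aut g \<Longrightarrow> (\<And>f. f \<in> F \<Longrightarrow> \<exists>f'\<in>F. \<forall>x<45. g (f x) = f' (g x)) \<Longrightarrow> heq F (map g t) (map g u)"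
proof (induction rule: heq.induct)
  case (heq_refl t)
  then show ?case by (auto intro: heq.heq_refl tup_map)
next
  case (heq_bm t u i)
  then show ?case using heq.heq_bm[of F "map g t" "map g u" i] heq_tup bm_map by metis
next
  case (heq_bi t u i)
  then show ?case using heq.heq_bi[of F "map g t" "map g u" i] heq_tup bi_map by metis
next
  case (heq_map t u f)
  then obtain f' where f': "f' \<in> F" "\<forall>x<45. g (f x) = f' (g x)" by blast
  have "map g (map f u) = map f' (map g u)"
    using f'(2) heq_tup[OF heq_map.hyps(1)] by (auto simp: tup_def)
  moreover have "heq F (map g t) (map f' (map g u))"
    using heq.heq_map[OF _ f'(1)] heq_map by blast
  ultimately show ?case by metis
qed

text \<open>Braid moves can be shifted into the middle segment, but an automorphism acts on the
  whole tuple. Hence the context is altered by some composite \<open>f\<close>, of which only the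
  fact that it maps indices to indices is kept.\<close>

lemma heq_context:
  assumes "heq F t u" "tup p" "tup q"
  shows "\<exists>f. (\<forall>x<45. f x < 45) \<and> heq F (p @ t @ q) (map f p @ u @ map f q)"
  using assms
proof (induction rule: heq.induct)
  case (heq_refl t)
  then show ?case by (intro exI[of _ id]) (auto intro: heq.heq_refl)
next
  case (heq_bm t u i)
  then obtain f where f: "\<forall>x<45. f x < 45" "heq F (p @ t @ q) (map f p @ u @ map f q)" by blast
  show ?case
  proof (cases "Suc i < length u")
    case True
    then have "bm (length p + i) (map f p @ u @ map f q) = map f p @ bm i u @ map f q"
      using bm_prepend[of "map f p" i] by (simp add: bm_append)
    then show ?thesis using f heq.heq_bm[OF f(2)] by metis
  next
    case False
    then show ?thesis using f bm_outside[of u i] by auto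
  qed
next
  case (heq_bi t u i)
  then obtain f where f: "\<forall>x<45. f x < 45" "heq F (p @ t @ q) (map f p @ u @ map f q)" by blast
  show ?case
  proof (cases "Suc i < length u")
    case True
    then have "bi (length p + i) (map f p @ u @ map f q) = map f p @ bi i u @ map f q"
      using bi_prepend[of "map f p" i] by (simp add: bi_append)
    then show ?thesis using f heq.heq_bi[OF f(2)] by metis
  next
    case False
    then show ?thesis using f bi_outside[of u i] by auto
  qed
next
  case (heq_map t u g)
  then obtain f where f: "\<forall>x<45. f x < 45" "heq F (p @ t @ q) (map f p @ u @ map f q)" by blast
  have "heq F (p @ t @ q) (map (g \<circ> f) p @ map g u @ map (g \<circ> f) q)"
    using heq.heq_map[OF f(2) heq_map.hyps(2)] by simp
  moreover have "\<forall>x<45. (g \<circ> f) x < 45"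
    using f(1) rack_autD(1)[OF F[OF heq_map.hyps(2)]] by simp
  ultimately show ?case by blast
qed

end

interpretation I: rack_auts inners by standard (rule rack_aut_inners)
interpretation W: rack_auts auts by standard (rule rack_aut_auts)

lemma seq_aut:
  assumes "seq t u" "rack_aut g" shows "seq (map g t) (map g u)"
proof (rule I.heq_aut[OF assms])
  fix f assume "f \<in> inners"
  then obtain c where "c < 45" "f = (\<lambda>x. cj x c)" by (auto simp: inners_def)
  then show "\<exists>f'\<in>inners. \<forall>x<45. g (f x) = f' (g x)"
    using assms(2) by (intro bexI[of _ "\<lambda>x. cj x (g c)"]) (auto simp: rack_autD inners_def)
qed

text \<open>Certificates are words in the letters: \<open>0..7\<close> a braid move, \<open>8\<close> and \<open>9\<close> the outer
  automorphisms, \<open>10..19\<close> an inverse braid move, \<open>20 + c\<close> conjugation by \<open>c\<close>.\<close>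

definition letter :: "nat \<Rightarrow> nat list \<Rightarrow> nat list" where
  "letter l t = (if l < 8 then bm l t else if l = 8 then map alpha t else if l = 9 then map epsilon t
     else if l < 20 then bi (l - 10) t else if l < 65 then map (\<lambda>x. cj x (l - 20)) t else t)"

lemma heq_letter:
  assumes "heq F t u" "inners \<subseteq> F" "l = 8 \<longrightarrow> alpha \<in> F" "l = 9 \<longrightarrow> epsilon \<in> F"
  shows "heq F t (letter l u)"
proof -
  have "(\<lambda>x. cj x (l - 20)) \<in> F" if "l < 65"
  proof -
    have "l - 20 < 45" using that by simp
    then show ?thesis using assms(2) unfolding inners_def by blast
  qed
  then show ?thesis unfolding letter_def using assms by (auto intro: heq.intros)
qed

lemma weq_letters: "weq t u \<Longrightarrow> weq t (fold letter w u)"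
  by (induction w arbitrary: u) (auto intro!: heq_letter simp: auts_def)

lemma seq_letters: "seq t u \<Longrightarrow> list_all (\<lambda>l. l \<noteq> 8 \<and> l \<noteq> 9) w \<Longrightarrow> seq t (fold letter w u)"
  by (induction w arbitrary: u) (auto intro!: heq_letter)

lemma bm_numeral [simp]:
  "bm 1 (a # x # y # t) = a # y # cj x y # t"
  "bm 2 (a # b # x # y # t) = a # b # y # cj x y # t"
  "bm 3 (a # b # c # x # y # t) = a # b # c # y # cj x y # t"
  "bm 4 (a # b # c # d # x # y # t) = a # b # c # d # y # cj x y # t"
  "bm 5 (a # b # c # d # e # x # y # t) = a # b # c # d # e # y # cj x y # t"
  "bm 6 (a # b # c # d # e # f # x # y # t) = a # b # c # d # e # f # y # cj x y # t"
  by (simp_all add: eval_nat_numeral One_nat_def)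

lemma bi_numeral [simp]:
  "bi 1 (a # x # y # t) = a # cj y x # x # t"
  "bi 2 (a # b # x # y # t) = a # b # cj y x # x # t"
  "bi 3 (a # b # c # x # y # t) = a # b # c # cj y x # x # t"
  "bi 4 (a # b # c # d # x # y # t) = a # b # c # d # cj y x # x # t"
  "bi 5 (a # b # c # d # e # x # y # t) = a # b # c # d # e # cj y x # x # t"
  "bi 6 (a # b # c # d # e # f # x # y # t) = a # b # c # d # e # f # cj y x # x # t"
  by (simp_all add: eval_nat_numeral One_nat_def)

section \<open>Certificates for the representatives\<close>

text \<open>Recursive on the lists so that rewriting decides it; the meaning is given by
  \<open>lower_extension_iff\<close>.\<close>

fun lower_extension :: "nat list \<Rightarrow> nat \<Rightarrow> nat list \<Rightarrow> bool" where
  "lower_extension [] g [x] \<longleftrightarrow> x < g"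
| "lower_extension (a # r) g (b # u) \<longleftrightarrow> a = b \<and> lower_extension r g u"
| "lower_extension _ _ _ \<longleftrightarrow> False"

lemma lower_extension_iff: "lower_extension r g u \<longleftrightarrow> (\<exists>g'<g. u = r @ [g'])"
  by (induction r g u rule: lower_extension.induct) auto

definition accepted :: "(nat list \<Rightarrow> bool) \<Rightarrow> nat list \<Rightarrow> nat \<Rightarrow> nat list \<Rightarrow> bool" where
  "accepted P r g u \<longleftrightarrow> P u \<or> lower_extension r g u"

text \<open>The words take \<open>r @ [g]\<close>, \<open>r @ [g + 1]\<close>, \<dots> each to a tuple satisfying \<open>P\<close>, or to an
  extension of \<open>r\<close> by a smaller last entry, which has been dealt with before.\<close>

fun check_from :: "(nat list \<Rightarrow> bool) \<Rightarrow> nat list \<Rightarrow> nat \<Rightarrow> nat list list \<Rightarrow> bool" where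
  "check_from P r g [] \<longleftrightarrow> 45 \<le> g"
| "check_from P r g (w # ws) \<longleftrightarrow> accepted P r g (fold letter w (r @ [g])) \<and> check_from P r (g + 1) ws"

lemma check_from_nth:
  "check_from P r g0 ws \<Longrightarrow> g0 \<le> g \<Longrightarrow> g < 45 \<Longrightarrow> \<exists>w. accepted P r g (fold letter w (r @ [g]))"
proof (induction ws arbitrary: g0)
  case (Cons w ws)
  then show ?case by (cases "g = g0") auto
qed simp

text \<open>A word that misses \<open>P\<close> ends at \<open>r\<close> followed by a smaller last
  entry, so following the words strictly decreases this entry and must stop at a tuple satisfying
  \<open>P\<close>.\<close>

lemma check_from_sound:
  assumes "check_from P r 0 ws" "tup r" "g < 45"
  shows "\<exists>u. P u \<and> weq (r @ [g]) u"
  using assms(3)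
proof (induction g rule: less_induct)
  case (less g)
  obtain w where w: "accepted P r g (fold letter w (r @ [g]))"
    using check_from_nth[OF assms(1) _ less.prems] by auto
  have "weq (r @ [g]) (r @ [g])" using assms(2) less.prems by (intro heq_refl) simp
  then have h: "weq (r @ [g]) (fold letter w (r @ [g]))" by (rule weq_letters)
  show ?case
  proof (cases "P (fold letter w (r @ [g]))")
    case False
    then obtain g' where "g' < g" "fold letter w (r @ [g]) = r @ [g']"
      using w by (auto simp: accepted_def lower_extension_iff)
    then show ?thesis using less.IH[of g'] less.prems h heq_trans by fastforce
  qed (use h in blast)
qed

fun pair_tail :: "nat list list \<Rightarrow> nat list \<Rightarrow> bool" where
  "pair_tail ts (a # b # u) \<longleftrightarrow> a = b \<and> u \<in> set ts"
| "pair_tail ts _ \<longleftrightarrow> False"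

fun check_all :: "(nat list \<Rightarrow> bool) \<Rightarrow> nat list list \<Rightarrow> nat list list list \<Rightarrow> bool" where
  "check_all P [] [] \<longleftrightarrow> True"
| "check_all P (r # rs) (ws # wss) \<longleftrightarrow> check_from P r 0 ws \<and> check_all P rs wss"
| "check_all P _ _ \<longleftrightarrow> False"

lemma check_all_sound:
  assumes "check_all P rs wss" "r \<in> set rs" "tup r" "g < 45"
  shows "\<exists>u. P u \<and> weq (r @ [g]) u"
  using assms by (induction P rs wss rule: check_all.induct) (auto dest: check_from_sound)

text \<open>\<open>gens4\<close> lists the generating members of \<open>reps4\<close>; the generating 5-tuples are represented by
  \<open>reps5e\<close>, of the form \<open>a, a, T\<close> with \<open>T\<close> generating, and \<open>reps5\<close>. Only the generating tuples not
  equivalent to one of that form are represented by \<open>reps6\<close> and \<open>reps7\<close>.\<close>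

definition reps2 :: "nat list list" where
  "reps2 =
 [[0,0],[0,1],[0,5],[0,7],[0,11]]"

definition reps3 :: "nat list list" where
  "reps3 =
 [[0,0,0],[0,0,1],[0,0,5],[0,0,7],[0,0,11],[0,1,2],[0,1,6],[0,1,8],[0,1,9],[0,1,10],[0,1,27],[0,1,
 42],[0,5,6],[0,5,42]]"

definition reps4 :: "nat list list" where
  "reps4 =
 [[0,0,0,0],[0,0,0,1],[0,0,0,5],[0,0,0,7],[0,0,0,11],[0,0,1,1],[0,0,1,2],[0,0,1,4],[0,0,1,6],[0,0,
 1,7],[0,0,1,8],[0,0,1,10],[0,0,1,15],[0,0,1,16],[0,0,1,27],[0,0,1,42],[0,0,1,43],[0,0,5,5],[0,0,
 5,6],[0,0,5,11],[0,0,5,20],[0,0,5,42],[0,0,7,7],[0,0,11,11],[0,0,11,35],[0,1,2,6],[0,1,2,9],[0,1,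
 8,9],[0,1,27,29]]"

definition gens4 :: "nat list list" where
  "gens4 =
 [[0,0,1,8],[0,0,1,10],[0,0,1,16],[0,1,2,6],[0,1,2,9],[0,1,8,9]]"

definition reps5e :: "nat list list" where
  "reps5e =
 [[0,0,0,1,8],[0,0,0,1,10]]"

definition reps5 :: "nat list list" where
  "reps5 =
 [[0,1,8,9,40],[0,0,1,1,8],[0,0,3,4,9],[0,3,8,3,8],[0,0,1,4,7],[0,1,10,1,10]]"

definition reps6 :: "nat list list" where
  "reps6 =
 [[0,0,1,1,8,8],[0,1,8,9,14,15],[5,42,0,1,1,8]]"

definition reps7 :: "nat list list" where
  "reps7 =
 [[0,5,42,1,1,8,8]]"

lemmas check_from_simps = letter_def accepted_def reps2_def reps3_def reps4_def gens4_def reps5e_def reps5_def reps6_def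
  reps7_def cj_eqs alpha_eqs epsilon_eqs One_nat_def[symmetric]

text \<open>Base of the classification: conjugation carries every single involution to index 0,
  possibly through smaller indices.\<close>

lemma cert1: "check_all (\<lambda>u. u = [0]) [[]] [
 [[],[23],[24],[21],[22],[63],[37],[50],[51],[33],[34],[40],[31],[53],[54],[27],[28],[54],[29],
 [35],[57],[56],[58],[57],[30],[36],[42],[59],[61],[60],[39],[45],[46],[38],[44],[36],[41],[43],
 [42],[47],[49],[48],[40],[34],[33]]]"
  by (simp add: check_from_simps)

lemma cert2: "check_all (\<lambda>u. u \<in> set reps2) [[0]] [
 [[],[],[25],[20],[62],[],[8,9],[],[8,25],[26],[26],[],[9],[62],[62],[62],[62],[62],[8],[9],[9],
 [26],[9],[9,32],[25],[20],[8],[26],[9],[9],[8],[25],[8],[32],[32],[20],[32],[8],[9],[32],[25],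
 [9],[26],[9],[32]]]"
  by (simp add: check_from_simps)

lemma cert3: "check_all (\<lambda>u. u \<in> set reps3) reps2 [
 [[],[],[25],[20],[62],[],[8,9],[],[8,25],[26],[26],[],[9],[62],[62],[62],[62],[62],[8],[9],[9],
 [26],[9],[9,32],[25],[20],[8],[26],[9],[9],[8],[25],[8],[32],[32],[20],[32],[8],[9],[32],[25],
 [9],[26],[9],[32]],[[1,20],[0,20,21],[],[11],[10,20,23],[11,25],[],[0,8,20,21],[],[],[],[10,1,8,
 9,42],[8],[10,20,23],[10,20,23],[10,20,23],[10,20,23],[10,20,23],[8],[8],[0,20,21],[0,20,21],[0,
 20,21],[0,20,21],[8],[8],[8],[],[0,20,21],[0,20,21],[8],[8],[8],[8],[8],[8],[8],[8],[8],[8],[8],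
 [8],[],[0,20,21],[0,20,21]],[[1],[1],[25],[20],[62],[0,63],[],[11,11,9],[8,25],[10,11,8,9,27,56],
 [8,25],[10,11,32,40],[8],[62],[62],[62],[62],[62],[8],[20],[0,63],[0,63],[0,63],[8,20],[25],[20],
 [8],[62],[62],[62],[8],[25],[8],[20],[20],[20],[8],[8],[20],[25],[25],[25],[],[11,11,9,20],[20]],
 [[1,9],[11,0,8,20,21],[11,8,9,32],[1,8,20],[10,10,9,27],[11,9,32],[0,20,35],[0,9,35],[0,20,35],
 [1,26],[0,20,35],[0,20,35],[9,20],[10,9,50],[9,20],[11],[11,8,25,26],[10,9,50],[9,20],[10,9,50],
 [0,9,35],[0,9,35],[9,20],[0,9,35],[1,25],[9,20],[9,20],[9,20],[9,20],[0,9,35],[11,9],[9,20],[9,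
 20],[9,20],[9,20],[0,9,35],[9,20],[0,9,35],[9,20],[9,20],[9,20],[9,20],[9,20],[9,20],[9,20]],[[1,
 20],[1,0,8,20,21],[8,25],[0,9,44,53],[8,25],[0,1,30,33],[11,10,8,9,64],[0,1,8,21,58],[8,25],[26],
 [26],[0,9,22,40],[11],[0,9,44,53],[8,25],[0,9,22,40],[8,25],[1,8,32],[26],[10,1,30,48],[0,9,44,
 53],[26],[0,9,22,40],[0,9,44,53],[26],[8,25],[8,25],[26],[26],[8,25],[26],[26],[26],[26],[26],[0,
 9,22,40],[26],[26],[1,9,20],[26],[26],[26],[26],[26],[26]]]"
  by (simp add: check_from_simps)

lemma cert4: "check_all (\<lambda>u. u \<in> set reps4) reps3 [
 [[],[],[25],[20],[62],[],[8,9],[],[8,25],[26],[26],[],[9],[62],[62],[62],[62],[62],[8],[9],[9],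
 [26],[9],[9,32],[25],[20],[8],[26],[9],[9],[8],[25],[8],[32],[32],[20],[32],[8],[9],[32],[25],
 [9],[26],[9],[32]],[[2,20],[],[],[12],[],[12,25],[],[],[],[2,11,11,0,11,2,20,29],[],[2,2,1,1,10,
 1,12,32,36],[8],[12,12,26],[2,1,1,10,1,12,9,23,37],[],[],[11,0,11,8,21],[8],[8],[12,12,8,9],[2,8,
 32],[2,9,8],[2,8,9,20],[8],[8],[8],[],[2,8,9,32],[12,25,26],[8],[8],[8],[8],[8],[8],[8],[8],[8],
 [8],[8],[8],[],[],[12,12,62]],[[2],[2],[25],[20],[62],[],[],[2,11,0,11,11,2,9,32,38],[8,25],[2,
 11,0,11,11,12,9,50,58],[8,25],[],[8],[62],[62],[62],[62],[62],[8],[20],[],[12,25,26],[12,8,9,62],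
 [8,20],[25],[20],[8],[62],[62],[62],[8],[25],[8],[20],[20],[20],[8],[8],[20],[25],[25],[25],[],
 [12,12,9,20],[20]],[[2,9],[2],[12,8,9,32],[2,8,20],[11,0,11,11,12,9,50,62],[11,11,0,11,2,9,26,
 29],[11,11,0,11,12,39],[],[11,11,0,11,12,8,9,22,30],[2,26],[1,1,10,1,8,9,30,62],[12,8,25],[9,20],
 [12,8,26],[9,20],[12],[12,8,25,26],[12,25,26],[9,20],[12,8,26],[11,0,11,11,12,9,29,37],[12,12,
 32],[9,20],[12,25,26],[2,25],[9,20],[9,20],[9,20],[9,20],[2,9,26],[12,9],[9,20],[9,20],[9,20],[9,
 20],[2,2,9,8,20],[9,20],[1,0,0,1,27],[9,20],[9,20],[9,20],[9,20],[9,20],[9,20],[9,20]],[[2,20],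
 [12,11,0,11,11,12,26,45],[8,25],[2,20],[8,25],[2,8],[2,9,26],[2,1,1,10,1,2,9,27],[8,25],[26],
 [26],[],[12],[1,0,0,1,55],[8,25],[2,2,9,32],[8,25],[12,26],[26],[2,11,0,11,11,12,50,62],[2,2,8],
 [26],[2,9],[2,9,25,26],[26],[8,25],[8,25],[26],[26],[8,25],[26],[26],[26],[26],[26],[],[26],[26],
 [2,9,20],[26],[26],[26],[26],[26],[26]],[[2,1,20],[2,10,11,20,23],[1,0,21,64],[12,11],[12,1,20],
 [0,12,1,23],[],[12,1,0,12,1,12,11,8,21,51],[1,0,21,64],[],[10,1,12,1,12,10,9,44,53],[12,1,12,12,
 10,1,12,9,8,41],[8],[10,11,21,62],[1,0,21,64],[10,11,8,21,62],[10,11,8,21,62],[10,11,8,21,62],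
 [8],[8],[0,11,10,63],[0,1,10,63],[0,11,10,63],[0,1,10,63],[8],[8],[8],[0,1,10,63],[0,1,10,63],[0,
 1,10,63],[8],[8],[8],[8],[8],[8],[8],[8],[8],[8],[8],[8],[12,12,11],[12,12,11],[1,0,21,64]],[[12,
 1,20],[2,10,11,20,23],[12,12,1,12,10,1,12,20,45],[2,11,8],[2,11,10,8,23,24],[2,11,25],[1,1,12,12,
 10,11,23,27],[1,12,11,32],[2,0,1,12,1,0,12,8,40,51],[11,0,11,10,23,41],[12,1,1,0,12,11,8,9,34,
 52],[1,12,10,1,8,9,20,64],[1,1,10,23,27],[1,12,11,26],[11,0,11,10,23,41],[0,12,20,21],[11,0,11,
 10,23,41],[11,0,11,10,23,41],[12,12,11],[2,10,8,20,23],[0,11,11,23,32],[0,11,11,23,32],[0,11,11,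
 23,32],[0,11,11,23,32],[1,1,10,23,27],[0,1,10,1,23,53],[0,11,11,23,32],[12],[0,11,11,23,32],[0,
 11,11,23,32],[10,12,20,23],[1,1,10,23,27],[0,11,11,23,32],[10,12,8,20,23],[1,1,10,23,27],[0,11,
 11,23,32],[12,11],[0,11,11,23,32],[0,11,11,23,32],[0,11,11,23,32],[0,11,11,23,32],[0,11,11,23,
 32],[2,2,8],[0,11,11,23,32],[0,11,11,23,32]],[[2,1,20],[12,1,0,12,1,9,23],[12,1,0,21,64],[2,11,
 8],[1,2,0,11,12,12,11,8,23,51],[2,0,20,21],[1,12,11,10,9,8,23],[11,0,11,11,12,12,10,9,46],[0,1,1,
 10,1,8,9,52],[],[1,1,0,8,9,34,52],[10,11,11,8,9,20,58],[1,1,0,8,9,34,52],[2,11,11,2,11,25,32],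
 [10,11,11,8,9,20,58],[2,1,10,12,11,9,24,49],[10,12,12,8,20,23],[0,11,10,10,11,29,34],[10,11,11,8,
 9,20,58],[1,1,0,8,9,34,52],[2,11,11,8,9],[10,11,11,8,9,20,58],[0,12,1,8,23],[10,11,11,8,9,20,58],
 [10,11,11,8,9,20,58],[12,12,1,20],[1,12,11,9],[1,0,12,11,20,36],[1,1,0,8,9,34,52],[12,12,8],[10,
 11,11,8,9,20,58],[2,2,1,8,20],[0,12,8,20,21],[1,1,0,8,9,34,52],[12,11,10,23,24],[1,2,11,2,9,8,
 20],[2,1,10,1,12,8,41],[10,11,11,8,9,20,58],[1,1,0,8,9,34,52],[10,12,20,23],[0,12,20,21],[1,1,0,
 8,9,34,52],[2,1,1,2,62],[12,11,11,12,32],[12,11]],[[10,1,12,12,10,11,20,27],[2,10,11,8,20,23],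
 [10,1,12,1,12,11,8,9,46,53],[10,1,8,21,26],[1,1,12,11,0,8,9,34,52],[2,11,25],[11,2,2,11,8,26],
 [11,0,11,0,26,39],[2],[10,1,8,21,26],[1,10,12,11,9,22,52],[1,0,12,12,11,11,12,9,8,51],[10,1,2,21,
 32],[11,12,12,11,32],[12,1,12,12,9,32],[11,0,8,21,39],[0,1,2,11,2,8,37,44],[10,1,12,8,21,26],[12,
 1,8,20],[10,1,8,21,26],[10,1,8,21,26],[11,2,11,32],[10,1,8,21,26],[10,1,8,21,26],[12],[0,12,1,12,
 1,12,9,8,43],[10,1,8,21,26],[11,0,8,21,39],[10,1,8,21,26],[10,1,8,21,26],[2,8],[11,0,8,21,39],
 [10,1,8,21,26],[12,12,1,8,20],[11,0,8,21,39],[10,1,8,21,26],[2,1,32],[10,1,8,21,26],[10,1,8,21,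
 26],[10,1,8,21,26],[10,1,8,21,26],[10,1,8,21,26],[10,1,8,21,26],[10,1,8,21,26],[10,1,8,21,26]],
 [[2,1,20],[2,10,11,8,20,23],[2,1,0,21,64],[10,11,11,2,0,11,11,12,8,22,31],[2,11,10,8,23,24],[0,
 11,0,12,1,12,9,24,35],[1,1,0,0,11,31,36],[11,0,11,0,31,49],[1,0,0,12,11,20,54],[1,12,1,10,1,10,9,
 45,50],[11,2,2,9,20],[1,2,0,11,9,21,37],[12,1,12,25],[1,2,11,8,9,8],[10,12,11,0,9,21,52],[1,12,1,
 10,23],[10,1,10,1,31,63],[2,10,20,23],[10,1,2,9,20,58],[11,0,11,0,31,49],[2,11,2,11,8,26],[10,1,
 12,8,9,46,53],[2,1,10,1,42],[11,0,11,0,31,49],[12,1,8,20],[2,2,8],[11,2,10,9,23],[1,1,0,0,11,31,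
 36],[12,1,12,8,32],[0,2,2,20,21],[12,11,8,25],[2,8],[12,11],[10,1,10,1,31,63],[12,12,1,8,20],[2,
 10,8,20,23],[11,0,11,0,31,49],[10,1,12,1,21],[2,1,9,20],[11,0,2,9,8,21],[10,1,10,1,31,63],[10,12,
 8,20,23],[0,12,12,20,21],[12,1,8,9,20],[10,12,20,23]],[[2,1,20],[0,11,37,44],[0,1,0,12,12,8,9,51,
 57],[2,11,2,9,32],[10,1,12,12,10,1,12,9,31,54],[2,0,8,20,21],[12,1,12,10,1,12,20,45],[0,11,37,
 44],[0,11,0,11,49],[11,0,8,9,21,39],[10,1,8,9,26,48],[10,11,2,9,26,48],[2,2,11,10,23,24],[0,11,
 37,44],[12,1,12,25],[0,11,37,44],[0,11,0,11,49],[11,2,11,11,8,62],[0,11,37,44],[0,11,37,44],[0,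
 11,37,44],[0,11,37,44],[0,11,37,44],[0,11,37,44],[10,1,8,9,26,48],[1,10,37,50],[0,11,37,44],[1,
 10,37,50],[0,11,37,44],[],[0,11,37,44],[12,12],[0,11,37,44],[0,11,37,44],[1,10,37,50],[0,11,37,
 44],[0,11,37,44],[0,11,37,44],[0,11,37,44],[2,8],[12,11],[0,11,37,44],[0,11,37,44],[0,11,37,44],
 [0,11,37,44]],[[12,1,20],[2,10,11,20,23],[12,11],[2,11],[12,10,11,20,23],[11,2,11,12,25],[12,12,
 11,25],[0,1,1,23,25],[0,1,1,23,25],[2,10,1,12,8,21,26],[1,1,10,23,24],[0,1,1,23,25],[8],[11,11,
 12,12,11,8,62],[1,1,10,8,23,24],[2,0,1,12,8,23,26],[2,2,11,2,9,32],[1,12,1,12,12,11,9,25],[8],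
 [8],[0,1,1,23,25],[0,1,1,23,25],[0,1,1,23,25],[0,1,1,23,25],[8],[8],[8],[0,1,1,23,25],[0,1,1,23,
 25],[0,1,1,23,25],[8],[8],[8],[8],[8],[8],[8],[8],[8],[8],[8],[8],[1,2,10,11,26,63],[0,1,1,23,
 25],[2,10,20,23]],[[12,11],[2,1,10,11,8,21,62],[8,25],[20],[20],[2,10,11,64],[1,8,9],[2,11,11,12,
 9],[8,25],[11,9,25],[8,25],[11,11,12,12,11,32],[11,9,8],[1,8,9],[8,25],[1,9,26],[8,25],[12,12,11,
 8],[20],[20],[1,9,32],[12,1],[1,9,26],[1,9,32],[20],[20],[20],[8,25],[8,25],[8,25],[20],[20],
 [20],[20],[20],[20],[20],[20],[20],[20],[20],[20],[1,8,9],[1,8,9],[20]],[[12,11],[12,1,12,12,11,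
 62],[25],[20],[62],[0,63],[12,12,10,11,64],[11,2,2,11,2,11,9,8,20],[8,25],[1,26],[8,25],[0,1,26,
 40],[8],[62],[62],[62],[62],[62],[8],[20],[0,63],[0,63],[0,63],[8,20],[25],[20],[8],[62],[62],
 [62],[8],[25],[8],[20],[20],[20],[8],[8],[20],[25],[25],[25],[1,26],[1,26],[20]]]"
  by (simp add: check_from_simps)

text \<open>Extending \<open>gens4\<close> alone suffices, since a generating 5-tuple can be brought
  to a form whose first four entries generate (\<open>gen_butlast\<close>).\<close>

lemma cert5: "check_all (\<lambda>u. u \<in> set reps5e \<or> u \<in> set reps5) gens4 [
 [[3,2,20],[3,11,0,11,21],[3,2,13,2,1,10,1,13,12,1,10,8,9,51],[3,12,8],[1,2,11,0,11,11,9,23,34],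
 [3,12,3,25],[12,3,3,12,3,25,26],[1,2,13,12,10,1,10,1,8,31,63],[12,1,0,0,1,2,2,9,52],[2,1,0,0,1,
 12,1,0,12,9,23,44],[1,10,1,12,12,9,42],[12,3,12,1,10,1,21,22],[1,10,1,12,12,9,42],[2,1,0,0,1,12,
 9,28],[3,2,1,0,0,1,2,13,13,2,8,20,28],[1,10,1,12,12,9,42],[1,0,12,13,12,1,23],[2,2,11,12,10,9,20,
 21],[2,2,1,10,1,9,21],[12,3,12,13,9,25],[3,12,12,8,9],[3,3,12,3,25,32],[13],[2,1,0,0,1,12,9,28],
 [1,0,12,23],[2,2,1,10,1,9,21],[2,13,12,9],[1,10,1,12,12,9,42],[2,2,1,10,1,9,21],[1,10,1,12,12,9,
 42],[1,10,1,12,12,9,42],[3,3,2,8,20],[13,12,12,9],[3,12,3,12,25,32],[3,3,12,13,8,9,26],[3,2,13,2,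
 8,9,20],[1,10,1,12,12,9,42],[1,0,12,3,12,1,23],[3,2,13,13,9,8,20],[1,10,1,12,12,9,42],[13,12,12,
 8,9],[3,2,13,13,9,25],[3,2,2,3,62],[13,12,12,13,32],[13,12]],[[3,2,20],[2,1,1,10,1,2,13,11,2,11,
 9,31,36],[2,13,2,1,10,1,13,2,13,2,13,8,29,48],[1,10,1,2,9,20,58],[2,1,10,1,13,12,1,13,10,11,23,
 46],[2,2,1,0,0,1,12,9,20,30],[11,0,11,2,13,13,2,9,8,57],[2,11,0,11,11,12,13,12,9,21,29],[12,3,3,
 12,13,13,8,25,32],[2,1,0,3,3,12,12,1,12,13,22,47],[12,3,3,9,20],[3,2,2,11,11,0,11,12,3,12,8,26,
 54],[13,2,13,25],[2,3,12,8,9,8],[1,10,1,2,9,20,58],[3,3,2,13,2,8,26],[2,2,1,0,0,1,12,9,20,30],[3,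
 12,3,3,12,20],[1,3,3,10,1,21],[1,10,1,2,9,20,58],[3,12,3,12,8,26],[3,2,1,10,1,2,3,41],[1,10,1,2,
 9,20,58],[1,10,1,2,9,20,58],[12,1,10,1,9,20,21],[1,10,1,2,9,20,58],[1,10,1,2,9,20,58],[1,10,1,2,
 9,20,58],[1,10,1,2,9,20,58],[3,3,2,13,9,8],[12,1,10,1,9,20,21],[3,8],[13,12],[2,13,2,13,9,25,26],
 [13,13,2,8,20],[12,13,9,8,20],[12,3,12,3,8,9],[13,12,12,13,26],[3,2,9,20],[1,10,1,2,9,20,58],[13,
 12,12,13,32],[3,12,3,8,25,26],[3,2,2,3,62],[13,2,8,9,20],[13,13,2,13,8,32]],[[3,11,0,11,12,3,8,9,
 20,58],[1,12,1,13,2,0,13,13,11,8,9,20,21],[3,2,11,0,11,22,62],[3,2,11,0,11,12,8,20,21],[1,2,10,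
 11,13,13,2,11,0,11,0,9,22,45],[3,12,13,8,25],[13,2,1,10,1,2,13,24],[11,2,10,11,2,13,11,10,8,9,21,
 30],[3,3,2,20],[1,0,2,1,3,12,1,9,29,59],[1,2,11,0,11,2,11,0,13,9,29,59],[2,11,12,13,10,11,8,9,50,
 55],[3,2,2,3,32],[3,12,12,13,26],[12,1,10,10,1,12,3,12,3,8,9,20,46],[13,12,1,0,0,1,12,8,36],[2,1,
 0,0,1,2,3,36],[1,3,10,1,8,21],[1,3,2,13,2,1,1,2,13,2,1,9,20],[13,2,13,20],[12,3,11,12,11,10,9,21,
 39],[3,2,1,10,1,2,3,41],[1,10,1,12,3,12,3,8,9,30,42],[3,2,1,10,1,2,3,43],[12,1,0,0,1,3,2,31],[13,
 2,8,20],[12,1,0,0,1,2,13,12,12,13,9,64],[3,2,1,10,1,2,3,47],[1,10,1,13,2,13,2,9,26,48],[3,2,1,10,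
 1,2,3,49],[3,12,13,26],[1,0,13,13,12,1,12,8,23],[13,12,1,10,1,12,13,48],[13,12,62],[3,8],[1,3,10,
 1,21],[2,13,13,12,9],[1,0,12,8,20,21],[11,2,10,13,2,11,23],[3,2,1,10,1,2,3,59],[13,12,1,10,1,12,
 13,42],[3,12,3,8,25,26],[3,2,2,3,62],[13,2,13,2,8,62],[2,3,12,9]],[[12,1,3,2,10,10,11,2,13,2,44],
 [12,3,12,12,1,10,1,9,8,30],[1,0,12,11,11,12,37,38],[1,3,3,2,2,11,11,0,11,8,23,37],[3,1,2,11,25],
 [0,1,3,12,11,13,8,23],[12,1,10,1,12,3,12,3,11,9,22,48],[2,1,1,2,13,13,8,32],[1,0,12,11,11,12,37,
 38],[0,12,1,10,1,13,2,13,13,11,2,13,8,50,58],[2,3,11,2,11,12,12,3,1,12,25,26],[0,1,0,2,2,1,3,3,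
 12,3,0,1,12,9,20,60],[12,13,13,12,11,0,12,8,20,23],[3,12,11,11,12,8,26],[1,0,12,11,11,12,37,38],
 [1,0,13,2,11,2,13,13,11,2,13,9,48],[1,0,13,8,21,64],[13,13,2,0,11,12,8,23,25],[13,13,12,11,8,20],
 [3,10,11,21,62],[0,3,12,3,12,11,22,63],[13,2,10,11,8,20,23],[1,0,12,11,11,12,37,38],[3,11,2,3,11,
 12,9,25],[1,0,12,11,11,12,37,38],[1,0,12,11,11,12,37,38],[1,0,12,11,11,12,37,38],[1,12,13,12,25],
 [1,0,12,11,11,12,37,38],[1,0,12,11,11,12,37,38],[10,11,13,8,21,62],[1,0,12,11,11,12,37,38],[1,0,
 12,11,11,12,37,38],[10,11,13,21,62],[1,0,12,11,11,12,37,38],[1,0,12,11,11,12,37,38],[1,12,3,12,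
 25],[1,0,12,11,11,12,37,38],[2,1,1,2,13,12,1,32],[1,0,13,13,8,21,64],[1,0,12,11,11,12,37,38],[1,
 0,12,11,11,12,37,38],[3,3,8],[0,1,10,13,63],[0,1,10,13,8,63]],[[10,11,13,2,11,2,13,11,2,2,13,21,
 62],[0,1,2,13,11,2,10,1,1,10,8,32,63],[3,1,2,10,11,12,22],[3,2,1,12,13,8,20],[1,2,10,11,13,11,2,
 10,1,10,9,8,36],[2,3,11,0,11,0,12,26,39],[11,12,13,13,11,2,11,0,11,9,8,36],[2,10,11,2,11,2,3,12,
 3,10,11,2,8,22,39],[1,12,11,0,11,0,12,22,31],[0,2,11,0,0,2,11,2,13,13,12,11,9,8,46],[0,2,11,0,13,
 2,13,2,1,12,13,12,8,22,48],[0,12,1,3,12,1,0,8,9,50,55],[0,13,12,1,10,12,13,24],[2,10,1,10,1,2,11,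
 22,60],[1,12,11,0,11,0,12,22,31],[2,3,11,12,3,12,3,8,26],[0,13,2,1,13,2,8,37,44],[2,3,10,1,12,8,
 21,26],[13,2,1],[3,3,2,10,11,20,23],[13,2,1,10,1,2,59],[3,12,1,12,1,12,8,9,62],[2,13,2,11,25],[0,
 3,12,3,3,12,8,20,21],[1,12,13,12,25],[1,12,11,0,11,0,12,22,31],[0,12,3,11,0,11,2,60],[0,1,10,13,
 63],[1,12,11,0,11,0,12,22,31],[1,12,11,0,11,0,12,22,31],[3,8],[0,13,2,13,8,20,21],[10,13,2,13,8,
 20,23],[2,13,2,1,13,12,32],[0,12,3,11,2,8,9,26,61],[3,10,11,21,62],[13,12,11,11,12,13,26],[0,1,3,
 10,8,63],[12,1,3,2,10,8,9,23,27],[1,0,3,21,64],[1,10,1,2,13,2,22],[1,12,11,0,11,0,12,22,31],[12,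
 3,11,0,2,34,52],[10,11,13,8,21,62],[2,3,11,0,12,8,21,39]],[[1,3,12,10,1,13,13,10,11,8,9,20,58],
 [11,0,2,0,1,13,2,1,10,24,28],[0,11,0,11,13,2,0,13,13,11,2,9,20,35],[3,2,1,12,13,8,20],[0,1,10,13,
 2,13,2,11,2,13,8,9,27,47],[2,1,10,12,11,8,9,30,64],[1,10,10,1,10,1,35],[11,13,12,1,12,3,0,12,1,
 12,13,9,34],[1,0,2,11,2,8,9,20,38],[2,10,11,12,12,11,34,57],[1,1,2,1,1,0,34,52],[10,11,2,2,10,11,
 8,9,39,59],[2,1,10,12,11,8,9,30,64],[1,10,10,1,10,1,35],[1,2,2,10,1,13,2,1,13,52,56],[1,1,2,3,9,
 8],[1,1,2,1,1,0,34,52],[2,3,11,12,3,3,32],[1,0,2,11,2,8,9,20,38],[1,10,10,1,10,1,35],[2,1,10,12,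
 11,8,9,30,64],[3,2,1,10,1,2,41],[2,1,10,12,11,8,9,30,64],[13,12,11,11,12,13,26],[11,13,2,1,13,
 25],[1,10,10,1,10,1,35],[1,0,2,11,2,8,9,20,38],[0,11,12,13,12,11,23],[10,13,12,12,13,8,20,23],
 [13,2,2,13,8],[1,10,10,1,10,1,35],[1,10,10,1,10,1,35],[3,2,2,3,10,11,21],[1,10,10,1,10,1,35],[1,
 10,10,1,10,1,35],[1,10,10,1,10,1,35],[1,10,10,1,10,1,35],[13,12,12,1,13,12,25],[1,10,10,1,10,1,
 35],[1,10,10,1,10,1,35],[],[1,10,10,1,10,1,35],[1,10,10,1,10,1,35],[1,10,10,1,10,1,35],[1,10,10,
 1,10,1,35]]]"
  by (simp add: check_from_simps)

text \<open>Extensions of \<open>reps5e\<close> are left out because an entry appended to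
  \<open>a, a, T\<close> simply joins the generating \<open>T\<close>.\<close>

lemma cert6: "check_all (\<lambda>u. pair_tail gens4 u \<or> u \<in> set reps6) reps5 [
 [[4,3,2,1,4,3,14,12,40,54],[0,3,12,3,20,21],[14,14,13,2,1,14,12,12,3,12,8,9,29,59],[0,3,12,3,20,
 21],[10,13,2,13,20,23],[0,3,12,3,20,21],[3,12,11,11,8,9],[1,0,12,12,11,13,20,36],[11,0,14,3,2,11,
 14,40],[1,1,2,13,9,8],[1,1,0,3,8,9,34,52],[10,11,11,13,8,9,20,58],[1,1,2,13,9,8],[3,12,11,11,8,
 9],[10,13,2,13,20,23],[1,1,2,13,9,8],[10,13,2,13,20,23],[10,13,2,13,20,23],[0,3,12,3,20,21],[0,3,
 12,3,20,21],[0,3,12,3,20,21],[0,3,12,3,20,21],[0,3,12,3,20,21],[0,3,12,3,20,21],[3,12,11,11,8,9],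
 [1,1,2,13,9,8],[0,3,12,3,20,21],[1,1,2,13,9,8],[0,3,12,3,20,21],[0,3,12,3,20,21],[3,12,11,11,8,
 9],[1,1,2,13,9,8],[1,1,2,13,9,8],[1,1,2,13,9,8],[1,1,2,13,9,8],[3,12,11,11,8,9],[0,3,12,3,20,21],
 [0,3,12,3,20,21],[0,3,12,3,20,21],[1,1,2,13,9,8],[0,3,12,3,20,21],[0,3,12,3,20,21],[1,1,2,13,9,
 8],[0,3,12,3,20,21],[0,3,12,3,20,21]],[[14,8,9,58],[1,12,1,4,21],[1,4,3,2,13,14,14,13,11,2,11,
 64],[13,2,13,13,14,9,45,56],[1,12,1,4,8,21,62],[1,12,1,4,21,25],[13,13,2,13,14,8,9,23,40],[1,0,2,
 1,8,23],[],[13,2,1,1,2,14,14,13,13,14,14,12,10,32,46],[14,3,2,2,3,14,26],[1,0,2,1,8,23],[3,2,2,3,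
 9],[3,2,2,3,9],[14,9,50,54],[14,14,8,9,25,49],[14,8,23],[1,12,1,14,13,2,13,13,14,8,31,36],[1,0,2,
 1,8,23],[3,2,2,3,9],[3,2,2,3,9],[14,8,23,26],[3,2,2,3,9],[14,23,26],[3,2,2,3,9],[13,2,13,13,14,9,
 22,61],[1,0,2,1,8,23],[14,3,2,2,3,14,32],[3,2,2,3,9],[14,14,8,23,25],[14,8,9,26,61],[1,12,1,14,
 20],[1,10,1,14,21],[3,2,2,3,9],[3,2,2,3,9],[13,2,13,13,14,23,54],[1,0,2,1,8,23],[3,2,2,3,9],[3,2,
 2,3,9],[3,2,2,3,9],[3,2,2,3,9],[3,2,2,3,9],[3,2,2,3,9],[3,2,2,3,9],[4,4,8]],[[2,3,2,14,14,9,22,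
 30],[12,3,14,14,12,3,14,8,9,26,39],[4,2,22],[1,4,3,12,1,22,63],[2,1,0,4,3,2,1,13,2,13,8,20,21],
 [1,2,3,14,3,2,2,11,12,13,4,2,13,4,13,9,20,47],[4,12,13,13,8,9,20,31],[3,14,14,3,2,14,13,9,22,32],
 [3,4,4,12,13,4,13,8,9,51,55],[1,3,2,4,3,3,2,11,12,13,14,9,21,56],[1,13,4,13,12,1,13,2,13,13,14,9,
 23,32],[3,11,12,3,0,1,14,12,23,26],[12,14,3,2,14,20],[14,3,14,12,3,14,8,31,54],[4,13,12,12,13,14,
 14,13,8,27,47],[13,4,2,13,13,14,14,23,34],[12,13,4,8,9,31],[2,14,14,3,2,14,13,9,37,44],[14,3,2],
 [4,4,13,12,8,20],[3,2,14,14,3,14,32,35],[2,3,4,12,8,9,22,46],[13,4,13,13,21],[3,4,12,13,13,14,14,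
 8,9,51,55],[4,13,13,14,14,8,9,25,60],[2,13,4,4,13,12,8,26,49],[12,3,4,2,8,9,23,41],[14,14,12,3,
 14,26,46],[2,3,4,13,13,22,32],[3,4,21,32],[4,8],[1,0,14,13,2,1,62],[2,13,14,13,25],[14,14,8,21,
 62],[3,14,14,12,8,20,38],[3,4,2,13,13,8,9,27],[14,13,2,13,14,14,13,8,52,61],[2,13,14,14,12,3,14,
 21,42],[12,3,14,14,9,31],[14,12,3,3,14,14,13,26,46],[13,4,12,8,9,20,28],[13,2,14,14,9,31,49],[4,
 3,2,2,3,4,62],[2,13,4,2,25,33],[2,3,14,14,3,14,8,9,20,48]],[[11,0,11,12,3,14,12,13,11,12,11,9,51,
 62],[0,2,1,4,4,12,12,13,13,4,13,8,9,20,28],[4,3,11,0,11,2,13,4,1,13,12,9,51],[0,2,4,11,12,13,14,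
 8,21],[1,1,4,3,2,2,13,4,1,13,12,10,9,32,46],[1,3,3,4,10,1,8,9,24,61],[1,0,3,2,1,2,13,13,14,14,13,
 8,21,62],[0,2,1,4,12,3,14,8,9,21,54],[1,0,3,2,1,14,14,12,13,23],[0,2,1,13,4,2,13,4,13,8,9,27,37],
 [1,0,3,2,1,4,12,13,4,13,9,8,43],[0,2,1,2,13,14,24,37],[2,3,12,8],[0,2,1,2,3,4,3,8,9,51],[1,0,13,
 12,1,12,12,13,14,14,13,8,20,64],[0,2,1,12,12,3,14,12,20,37],[14,13,2,11,3,14,8,9,25,60],[0,2,1,4,
 13,14,14,12,8,9,23],[2,3,12,8],[2,3,12,8],[0,2,1,4,2,13,4,4,9,27,37],[0,2,1,13,14,13,12,9,8,23],
 [0,2,1,14,13,8,9],[0,2,1,4,3,12,8,9,23],[2,3,12,8],[2,3,12,8],[2,3,12,8],[1,0,3,2,1,2,14,3,2,14,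
 13,9,23,40],[0,2,1,4,4,13,13,4,2,13,8,9,22],[0,2,1,2,13,4,13,26,28],[2,3,12,8],[2,3,12,8],[2,3,
 12,8],[2,3,12,8],[2,3,12,8],[2,3,12,8],[2,3,12,8],[2,3,12,8],[2,3,12,8],[2,3,12,8],[2,3,12,8],[2,
 3,12,8],[0,2,1,12,3,14,12,3,14,3,8,9,29,36],[0,2,1,12,12,3,14,3,14,3,9,20,29],[0,2,1,2,2,14,14,
 13,13,14,8,9,28]],[[4,3,12,13,21,25],[1,4,3,12,1,14,13,2,13,13,14,9,8,46],[4,3,12,13,8,20,63],[1,
 10,1,21],[11,2,14,3,11,12,11,20,63],[1,10,1,21],[4,13,13,14,8,9,58],[1,2,1,13,13,2,11,0,2,13,4,
 13,4,1,12,34,52],[4,13,13,14,9,32,48],[13,4,13,13,14,8,23,32],[1,3,14,3,3,12,1,13,2,13,8,9,31,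
 49],[13,4,13,13,14,37,44],[14,14,3,20,21],[1,10,1,21],[1,0,14,3,3,2,1,14,13,2,13,13,14,51],[14,3,
 8,23],[3,14,3,8,9,26,61],[4,13,14,8,9,25,49],[11,13,2,11,13,4,4,12,12,3,12,3,14,10,9,26,46],[14,
 14,3,23],[14,14,3,8,23,25],[3,14,14,3,9,25,49],[2,1,10,1,2,8,24],[14,13,2,11,2,13,2,11,14,12,3,
 14,3,9,20,47],[1,10,1,21],[1,10,1,21],[1,10,1,21],[3,14,3,9,20,42],[14,3,23,25],[4,13,14,9,29,
 59],[1,10,1,21],[1,10,1,21],[1,10,1,21],[1,10,1,21],[1,10,1,21],[1,10,1,21],[1,10,1,21],[1,10,1,
 21],[1,10,1,21],[1,10,1,21],[14,3,22,63],[1,10,1,21],[2,14,62],[4,4,8],[2,14,8,62]],[[2,4,4,13,4,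
 4,12,13,11,12,63],[0,2,1,2,13,13,4,2,13,4,13,8,32,58],[0,2,1,2,14,9,21],[0,2,1,2,14,3,3,2,14,13,
 8,52,61],[0,2,1,12,13,13,4,13,12,8,9,20,49],[1,0,3,2,1,14,14,3,12,3,14,3,20,43],[0,2,1,14,3,12,3,
 14,3,8,20,30],[0,1,2,4,3,14,11,12,3,14,11,10,9,32,51],[0,2,1,4,13,2,13,4,51,64],[0,2,1,13,4,12,
 13,4,13,8,26,30],[1,0,3,2,1,14,14,12,13,8,20,23],[0,2,1,12,13,13,4,13,9,37,44],[2,2,1,13,9,20],
 [0,2,1,13,12,12,13,14,14,13,8,9,22,31],[2,2,1,13,9,20],[2,14,14,3,2,14,14,3,1,2,20,63],[0,2,1,13,
 2,14,3,14,3,8,9,20,28],[0,2,1,2,13,13,4,2,13,14,8,25,57],[2,2,1,13,9,20],[4,3,2,11,2,13,13,4,12,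
 8,9,64],[0,2,1,4,13,4,13,4,2,13,8,31,54],[0,2,1,2,13,2,13,14,14,13,8,9,37],[2,2,1,13,9,20],[0,2,
 1,13,4,2,13,4,13,14,14,8,9,25,33],[14,3,2,1,3,4,8,9,46,53],[2,2,1,13,9,20],[2,2,1,13,9,20],[2,2,
 1,13,9,20],[2,2,1,13,9,20],[1,0,3,2,1,2,3,3,14,14,13,8,23,26],[12,1,14,13,2,11,2,13,14,8,9,20,
 64],[2,2,1,13,9,20],[2,2,1,13,9,20],[2,2,1,13,9,20],[2,2,1,13,9,20],[0,2,1,2,14,13,8,9,22,34],[2,
 2,1,13,9,20],[0,2,1,4,13,4,12,8,23,27],[2,2,1,13,9,20],[2,2,1,13,9,20],[2,2,1,13,9,20],[2,2,1,13,
 9,20],[2,2,1,13,9,20],[2,2,1,13,9,20],[2,2,1,13,9,20]]]"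
  by (simp add: check_from_simps)

lemma cert7: "check_all (\<lambda>u. pair_tail (reps5e @ reps5) u \<or> u \<in> set reps7) reps6 [
 [[15,4,4,13,12,12,13,4,15,8,9,32,51],[1,0,2,1,8,23],[1,13,2,2,14,13,2,11,4,15,12,12,13,4,15,15,
 50],[3,3,2,4,15,15,13,4,13,2,15,13,25,47],[1,12,1,5,14,13,12,12,13,4,15,8,9,20,35],[1,0,2,1,8,
 23],[5,4,13,4,5,13,14,5,14,13,9,32,48],[1,0,2,1,8,23],[1,3,3,14,3,12,1,15,4,13,2,15,15,13],[1,3,
 14,3,3,12,1,15,13,12,12,13,4,15,15,21,37],[3,5,14,14,3,15,4,4,12,3,15,9,51,57],[1,0,2,1,8,23],[3,
 2,2,3,9],[3,2,2,3,9],[3,4,4,3,15,15,4,13,2,15,13,8,20],[3,2,5,14,14,5,3,2,14,15,13,50,63],[15,4,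
 4,13,12,12,13,4,15,8,23,46],[1,12,1,3,4,15,14,13,13,14,5,14,13,21,32],[1,0,2,1,8,23],[3,2,2,3,9],
 [3,2,2,3,9],[1,0,2,1,8,23],[3,2,2,3,9],[1,0,2,1,8,23],[3,2,2,3,9],[15,15,4,13,2,15,13,8,20,23],
 [1,0,2,1,8,23],[1,12,1,15,13,12,12,13,4,15,15,8,9,44,56],[3,2,2,3,9],[3,2,2,3,9],[3,2,2,3,9],[15,
 15,4,13,2,15,13,8,9,21,30],[3,2,2,3,9],[3,2,2,3,9],[3,2,2,3,9],[3,3,2,4,15,15,13,4,13,2,15,13,9,
 20,39],[1,0,2,1,8,23],[3,2,2,3,9],[3,2,2,3,9],[3,2,2,3,9],[3,2,2,3,9],[3,2,2,3,9],[3,2,2,3,9],[3,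
 2,2,3,9],[3,2,2,3,9]],[[5,4,3,2,1,14,3,14,5,2,13,2,14,3,24,46],[0,13,4,12,13,20,21],[5,14,3,2,2,
 1,14,12,12,3,14,5,20,50],[0,13,4,12,13,20,21],[3,2,4,3,10,20,23],[0,13,4,12,13,20,21],[13,4,12,
 11,11,8,9],[15,4,13,2,11,2,15,13,4,15,14,12,3,27,28],[0,1,1,10,1,13,8,9,52],[1,1,2,4,3,9,8],[1,1,
 0,13,8,9,34,52],[3,10,11,11,8,9,20,58],[1,1,2,4,3,9,8],[3,2,4,3,10,20,23],[3,2,4,3,10,20,23],[1,
 1,2,4,3,9,8],[3,2,4,3,10,20,23],[3,2,4,3,10,20,23],[0,13,4,12,13,20,21],[0,13,4,12,13,20,21],[0,
 13,4,12,13,20,21],[0,13,4,12,13,20,21],[0,13,4,12,13,20,21],[0,13,4,12,13,20,21],[13,4,12,11,11,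
 8,9],[1,1,2,4,3,9,8],[0,13,4,12,13,20,21],[1,1,2,4,3,9,8],[0,13,4,12,13,20,21],[0,13,4,12,13,20,
 21],[13,4,12,11,11,8,9],[1,1,2,4,3,9,8],[1,1,2,4,3,9,8],[1,1,2,4,3,9,8],[1,1,2,4,3,9,8],[3,2,4,3,
 10,20,23],[1,1,2,4,3,9,8],[0,13,4,12,13,20,21],[0,13,4,12,13,20,21],[1,1,2,4,3,9,8],[0,13,4,12,
 13,20,21],[0,13,4,12,13,20,21],[1,1,2,4,3,9,8],[0,13,4,12,13,20,21],[0,13,4,12,13,20,21]],[[2,11,
 2,11,3,14,3,14,5,3,14,3,12,8,62],[2,3,11,0,11,2,8,23],[2,11,2,11,4,15,14,3,14,14,15,13,8,22],[2,
 11,2,11,5,4,13,4,15,15,13,8,21,22],[2,1,13,12,1,15,15,14,3,14,5,3,14,3,12,8,25,38],[2,11,2,11,3,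
 2,14,3,14,5,3,14,3,12,63],[2,11,2,11,14,13,2,13,4,15,4,2,3,15,12,32,36],[2,11,2,11,2,4,15,13,13,
 4,2,2,13,2,8,20,53],[11,10],[0,4,13,2,2,1,4,5,4,13,14,14,5,3,9,23,50],[2,11,2,11,4,3,12,3,4,15,4,
 3,12,13,8,22,59],[2,11,2,11,14,13,2,15,13,4,2,13,2,8,31,64],[2,1,13,12,1,5,4,3,12,3,14,5,14,3,12,
 31,35],[2,11,2,11,2,4,15,4,15,15,13,4,13,12,8,9,23,31],[2,11,2,11,3,4,13,4,15,13,4,2,3,15,12,8,
 20,47],[2,11,2,11,4,4,13,4,15,13,9,25,43],[2,13,2,15,15,20],[2,1,13,12,1,4,15,4,15,4,13,4,13,12,
 9,49],[2,11,2,11,4,15,14,3,2,14,13,2,13,8,9,27,56],[0,14,3,2,2,1,15,13,4,12,3,14,12,13,8,9,21,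
 42],[2,11,2,11,2,4,4,15,13,4,12,3,12,13,29,47],[2,11,2,11,4,4,13,4,5,13,8,9,26,58],[1,4,4,13,4,5,
 46],[2,11,2,11,2,4,4,13,4,5,2,3,14,3,12,9,47],[2,11,2,11,2,4,13,2,15,15,14,14,15,15,13,9,32,46],
 [2,11,2,11,15,4,13,4,15,4,3,12,13,9,30,37],[2,1,13,12,1,5,4,3,12,3,14,5,14,3,12,8,43],[2,1,13,12,
 1,15,15,4,13,4,15,4,3,12,13,9,20,64],[1,4,4,13,4,5,8,40],[2,11,2,11,15,4,4,12,13,4,5,13,8,9,52,
 63],[2,11,2,11,5,4,4,12,13,4,15,13,9,52,64],[2,13,2,15,20],[1,4,5,13,13,4,46],[2,11,2,11,3,14,3,
 14,5,14,12,12,3,12,9,24,54],[2,1,13,12,1,3,15,15,14,3,14,5,3,14,3,12,8,21,22],[2,11,2,11,4,3,12,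
 3,3,4,15,13,8,9,26,63],[2,1,13,12,1,4,15,4,15,4,13,4,13,12,8,9,24,40],[15,4,13,4,15,25],[2,11,2,
 11,4,3,12,3,3,4,5,13,9,20,64],[2,13,2,15,8,20],[2,11,2,11,14,14,5,3,2,14,13,2,13,22,50],[0,4,13,
 2,2,1,5,13,13,14,12,3,14,5,3,9,8,22],[0,1,0,15,8,63],[0,1,0,15,63],[5,5,8]]]"
  by (simp add: check_from_simps)

text \<open>No exception is left: every extension of the one tuple in \<open>reps7\<close> is
  carried to a doubled entry followed by a listed generating 6-tuple. This starts the induction of
  \<open>class8\<close>.\<close>

lemma cert8: "check_all (\<lambda>u. pair_tail reps6 u) reps7 [
 [[2,2,1,1,4,3,3,2,13,4,16,15,15,16,13,8,51,61],[2,11,13,2,11,4,13,16,15,14,14,15,6,15,14,12,8,9,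
 32,35],[2,2,1,1,4,4,5,6,13,12,14,3,14,5,5,6,13,23,50],[2,2,1,1,4,5,13,2,16,5,4,16,5,3,16,14,9,20,
 46],[0,2,3,3,2,8,64],[0,2,3,3,2,8,64],[2,2,1,1,3,4,4,15,4,16,15,15,16,13,12,23,25],[2,2,1,1,4,13,
 2,13,2,15,4,16,15,15,16,13,12,31],[4,5,3,4,2,3,1,2,0,1,12,13],[4,13,2,2,1,3,2,15,4,3,3,4,16,15,
 15,16,9,8,28],[2,2,1,1,4,13,2,13,2,15,4,16,15,15,16,13,8,21,53],[2,2,1,1,2,4,5,5,4,16,15,15,16,
 13,12,22,40],[2,11,13,2,11,16,16,5,16,13,8,21,62],[2,2,1,1,6,5,14,5,6,14,15,6,15,14,12,22,63],[0,
 2,3,3,2,8,64],[2,2,1,1,4,13,12,15,14,16,13,13,14,15,15,16,12,31,54],[2,2,1,1,16,15,15,16,12,13,8,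
 23,46],[2,1,13,12,1,4,5,16,15,14,14,15,6,15,14,8,38,54],[2,2,1,1,3,2,6,6,15,6,14,13,2,13,14,21,
 25],[4,13,2,2,1,2,5,16,14,15,15,16,13,12,9,31],[0,2,3,3,2,8,64],[2,2,1,1,3,2,4,5,5,4,16,15,15,16,
 13,30,57],[2,1,13,12,1,6,15,4,13,2,13,4,15,15,6,46],[2,2,1,1,2,4,16,15,4,3,15,16,14,15,15,16,14,
 12,9,32,50],[2,2,1,1,4,15,4,4,16,15,15,16,13,12,8,22],[0,2,3,3,2,8,64],[0,2,3,3,2,8,64],[2,11,13,
 2,11,16,16,5,16,8,29,60],[2,2,1,1,4,6,13,2,13,14,14,5,5,6,13,12,8,22,27],[2,2,1,1,2,3,14,5,16,14,
 15,15,16,8,28,35],[0,2,3,3,2,8,64],[0,2,3,3,2,8,64],[0,2,3,3,2,8,64],[0,2,3,3,2,8,64],[0,2,3,3,2,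
 8,64],[0,2,3,3,2,8,64],[0,2,3,3,2,8,64],[0,2,3,3,2,8,64],[0,2,3,3,2,8,64],[0,2,3,3,2,8,64],[0,2,
 3,3,2,8,64],[0,2,3,3,2,8,64],[2,2,1,1,2,4,13,2,15,4,15,16,13,14,15,15,16,12,32,48],[4,13,2,2,1,2,
 3,4,12,3,15,4,16,15,15,16,13,8,9,27,28],[2,2,1,1,4,13,2,4,13,15,13,4,16,15,15,16,12,8,38,59]]]"
  by (simp add: check_from_simps)

section \<open>Generating tuples\<close>

definition closed_rack :: "nat set \<Rightarrow> bool" where
  "closed_rack X \<longleftrightarrow> X \<subseteq> {..<45} \<and> (\<forall>x\<in>X. \<forall>y\<in>X. cj x y \<in> X)"

text \<open>Generation as a rack, which can be tested on the \<open>cj\<close> table. For nonempty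
  tuples it is equivalent to generating A_6 as a group, by \<open>gen_generate\<close> and
  \<open>generate_gen\<close>.\<close>

definition gen :: "nat list \<Rightarrow> bool" where
  "gen t \<longleftrightarrow> (\<forall>X. closed_rack X \<longrightarrow> set t \<subseteq> X \<longrightarrow> X = {..<45})"

definition redundant :: "nat \<Rightarrow> nat list \<Rightarrow> bool" where
  "redundant a t \<longleftrightarrow> (\<forall>X. closed_rack X \<longrightarrow> set t \<subseteq> X \<longrightarrow> a \<in> X)"

lemma gen_mono: "gen t \<Longrightarrow> set t \<subseteq> set u \<Longrightarrow> gen u"
  unfolding gen_def by (meson subset_trans)

lemma gen_drop: "gen (a # t @ q) \<Longrightarrow> redundant a t \<Longrightarrow> gen (t @ q)"
  unfolding gen_def redundant_def by auto

lemma set_bm_subset: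
  assumes "closed_rack X" "tup t" shows "set (bm i t) \<subseteq> X \<longleftrightarrow> set t \<subseteq> X"
  using assms
proof (induction i t rule: bm.induct)
  case (1 x y t)
  have "x \<in> X" if "y \<in> X" "cj x y \<in> X"
    using that 1 cj_cj[of x y] unfolding closed_rack_def by (metis tup_simps(2))
  then show ?case using 1 by (auto simp: closed_rack_def)
qed auto

lemma gen_bm: "tup t \<Longrightarrow> gen (bm i t) \<longleftrightarrow> gen t"
  unfolding gen_def using set_bm_subset by blast

lemma gen_bi: "tup t \<Longrightarrow> gen (bi i t) \<longleftrightarrow> gen t"
  using gen_bm[OF tup_bi, of t i i] by (simp add: bm_bi)

lemma gen_map1:
  assumes "rack_aut f" "tup t" "gen t" shows "gen (map f t)"
  unfolding gen_def
proof (intro allI impI)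
  fix X assume X: "closed_rack X" "set (map f t) \<subseteq> X"
  define Y where "Y = {x. x < 45 \<and> f x \<in> X}"
  have "closed_rack Y"
    using X(1) by (auto simp: closed_rack_def Y_def cj_lt rack_autD[OF assms(1)])
  moreover have "set t \<subseteq> Y"
    using X(2) assms(2) by (auto simp: Y_def tup_def)
  ultimately have "Y = {..<45}" using assms(3) by (simp add: gen_def)
  then have "f (f x) \<in> X" if "x < 45" for x
    using that rack_autD(1)[OF assms(1) that] unfolding Y_def by blast
  then have "{..<45} \<subseteq> X" using rack_autD(2)[OF assms(1)] by fastforce
  then show "X = {..<45}" using X(1) by (auto simp: closed_rack_def)
qed

lemma gen_map: "rack_aut f \<Longrightarrow> tup t \<Longrightarrow> gen (map f t) \<longleftrightarrow> gen t"
  using gen_map1 tup_map map_map_aut by metis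

lemma gen_weq: "weq t u \<Longrightarrow> gen u \<longleftrightarrow> gen t"
proof (induction rule: heq.induct)
  case (heq_bm t u i)
  then show ?case using gen_bm W.heq_tup by blast
next
  case (heq_bi t u i)
  then show ?case using gen_bi W.heq_tup by blast
next
  case (heq_map t u f)
  then show ?case using gen_map rack_aut_auts W.heq_tup by blast
qed simp

section \<open>Certificates for generation and for proper subracks\<close>

fun mem :: "nat \<Rightarrow> nat list \<Rightarrow> bool" where
  "mem x [] \<longleftrightarrow> False"
| "mem x (y # ys) \<longleftrightarrow> x = y \<or> mem x ys"

lemma mem_iff: "mem x xs \<longleftrightarrow> x \<in> set xs"
  by (induction xs) auto

fun mems :: "nat list \<Rightarrow> nat list \<Rightarrow> bool" where
  "mems [] ys \<longleftrightarrow> True"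
| "mems (x # xs) ys \<longleftrightarrow> mem x ys \<and> mems xs ys"

lemma mems_iff: "mems xs ys \<longleftrightarrow> set xs \<subseteq> set ys"
  by (induction xs) (auto simp: mem_iff)

text \<open>A straight-line certificate for membership in the generated subrack: each pair names two
  elements obtained so far, and their conjugate is added to them.\<close>

fun derivable :: "nat list \<Rightarrow> nat list \<Rightarrow> (nat \<times> nat) list \<Rightarrow> bool" where
  "derivable xs s [] \<longleftrightarrow> mems s xs"
| "derivable xs s ((i, j) # ps) \<longleftrightarrow> mem i xs \<and> mem j xs \<and> derivable (cj i j # xs) s ps"

lemma derivable_closed: "derivable t s ps \<Longrightarrow> closed_rack X \<Longrightarrow> set t \<subseteq> X \<Longrightarrow> set s \<subseteq> X"
proof (induction t s ps rule: derivable.induct)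
  case (1 xs s)
  then show ?case by (auto simp: mems_iff)
next
  case (2 xs s i j ps)
  then have "i \<in> X" "j \<in> X" by (auto simp: mem_iff)
  then have "cj i j \<in> X" using "2.prems"(2) by (simp add: closed_rack_def)
  then show ?case using 2 by simp
qed

lemma gen_018: "gen [0, 1, 8]"
  unfolding gen_def
proof (intro allI impI)
  fix X assume X: "closed_rack X" "set [0, 1, 8] \<subseteq> X"
  \<comment> \<open>The 42 pairs produce the 42 remaining indices one at a time.\<close>
  have "derivable [0, 1, 8] [0..<45] [
    (0, 1), (8, 1), (0, 26), (3, 42), (1, 42), (3, 4), (1, 8), (8, 22), (0, 32), (0, 8), (8, 16),
    (1, 31), (1, 16), (8, 35), (8, 6), (8, 7), (0, 35), (8, 42), (3, 35), (0, 9), (3, 18), (8, 3),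
    (0, 24), (1, 34), (8, 0), (1, 25), (8, 43), (0, 22), (3, 38), (1, 6), (1, 24), (8, 37), (16, 28),
    (8, 34), (8, 21), (3, 41), (3, 9), (3, 7), (1, 12), (3, 28), (3, 27), (3, 8)]"
    unfolding idx45 by (simp add: cj_eqs)
  from derivable_closed[OF this X] have "{..<45} \<subseteq> X"
    by (simp add: atLeast0LessThan del: upt_conv_Cons)
  then show "X = {..<45}" using X(1) by (auto simp: closed_rack_def)
qed

text \<open>From here on generation is certified by deriving 0, 1 and 8 only, which keeps the
  certificates for the representatives short.\<close>

lemma gen_if_018: "derivable t [0, 1, 8] ps \<Longrightarrow> gen t"
  using gen_018 derivable_closed unfolding gen_def by blast

lemma redundant_derivable: "derivable t [a] ps \<Longrightarrow> redundant a t"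
  unfolding redundant_def using derivable_closed by fastforce

lemma gen_gens4: "r \<in> set gens4 \<Longrightarrow> gen r"
proof -
  have "gen [0, 0, 1, 8]" by (rule gen_if_018[of _ "[]"]) simp
  moreover have "gen [0, 0, 1, 10]"
    by (rule gen_if_018[of _ "[(0, 1), (10, 3), (1, 32)]"]) (simp add: cj_eqs)
  moreover have "gen [0, 0, 1, 16]"
    by (rule gen_if_018[of _ "[(0, 16), (16, 25)]"]) (simp add: cj_eqs)
  moreover have "gen [0, 1, 2, 6]"
    by (rule gen_if_018[of _ "[(2, 6), (6, 27), (0, 31)]"]) (simp add: cj_eqs)
  moreover have "gen [0, 1, 2, 9]"
    by (rule gen_if_018[of _ "[(1, 2), (9, 5), (0, 31)]"]) (simp add: cj_eqs)
  moreover have "gen [0, 1, 8, 9]" by (rule gen_if_018[of _ "[]"]) simp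
  ultimately show "r \<in> set gens4 \<Longrightarrow> gen r" by (auto simp: gens4_def)
qed

lemma gen_reps5e: "r \<in> set reps5e \<Longrightarrow> \<exists>T. r = 0 # 0 # T \<and> gen T"
proof -
  have "gen [0, 1, 8]" by (rule gen_018)
  moreover have "gen [0, 1, 10]"
    by (rule gen_if_018[of _ "[(0, 1), (10, 3), (1, 32)]"]) (simp add: cj_eqs)
  moreover note gen_mono[of _ "0 # _"]
  ultimately show "r \<in> set reps5e \<Longrightarrow> \<exists>T. r = 0 # 0 # T \<and> gen T"
    by (auto simp: reps5e_def intro: gen_mono)
qed

lemma gen_reps5: "r \<in> set reps5 \<Longrightarrow> gen r"
proof -
  have "gen [0, 1, 8, 9, 40]" "gen [0, 0, 1, 1, 8]" by (rule gen_if_018[of _ "[]"], simp)+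
  moreover have "gen [0, 0, 3, 4, 9]"
    by (rule gen_if_018[of _ "[(0, 3), (3, 4), (9, 5), (0, 31)]"]) (simp add: cj_eqs)
  moreover have "gen [0, 3, 8, 3, 8]"
    by (rule gen_if_018[of _ "[(0, 3)]"]) (simp add: cj_eqs)
  moreover have "gen [0, 0, 1, 4, 7]"
    by (rule gen_if_018[of _ "[(0, 4), (7, 2), (1, 20), (7, 11)]"]) (simp add: cj_eqs)
  moreover have "gen [0, 1, 10, 1, 10]"
    by (rule gen_if_018[of _ "[(0, 1), (10, 3), (1, 32)]"]) (simp add: cj_eqs)
  ultimately show "r \<in> set reps5 \<Longrightarrow> gen r" by (auto simp: reps5_def)
qed

lemma gen_reps6: "r \<in> set reps6 \<Longrightarrow> gen r"
  by (rule gen_if_018[of _ "[]"]) (auto simp: reps6_def)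

lemma tup_reps:
  "\<forall>r\<in>set reps2. tup r" "\<forall>r\<in>set reps3. tup r" "\<forall>r\<in>set reps4. tup r" "\<forall>r\<in>set gens4. tup r"
  "\<forall>r\<in>set reps5e. tup r" "\<forall>r\<in>set reps5. tup r" "\<forall>r\<in>set reps6. tup r" "\<forall>r\<in>set reps7. tup r"
  by (simp_all add: reps2_def reps3_def reps4_def gens4_def reps5e_def reps5_def reps6_def reps7_def)

definition closed_list :: "nat list \<Rightarrow> bool" where
  "closed_list xs \<longleftrightarrow> tup xs \<and> length xs < 45 \<and> mems (concat (map (\<lambda>x. map (cj x) xs) xs)) xs"

lemma not_genI:
  assumes "closed_list xs" "mems t xs" shows "\<not> gen t"
proof
  assume "gen t"
  moreover have "closed_rack (set xs)"
    using assms(1) by (auto simp: closed_list_def mems_iff closed_rack_def tup_def)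
  ultimately have "set xs = {..<45}"
    using assms(2) unfolding gen_def mems_iff by blast
  then show False using card_length[of xs] assms(1) by (simp add: closed_list_def)
qed

text \<open>The involutions of five proper subgroups: the stabilizers of {1,2} and of {5,6} (both
  isomorphic to S_4), the A_5 fixing 6, the even part of Sym{1,2,6} x Sym{3,4,5} (order 18), and a
  Sylow 2-subgroup.\<close>

lemma closed_lists:
  "closed_list [0, 1, 2, 3, 4, 5, 42, 43, 44]"
  "closed_list [0, 5, 6, 11, 12, 17, 32, 35, 42]"
  "closed_list [0, 1, 3, 6, 7, 9, 12, 13, 15, 18, 19, 21, 30, 33, 36]"
  "closed_list [0, 1, 3, 27, 28, 29, 39, 40, 41]"
  "closed_list [0, 5, 20, 26, 42]"
  by (simp_all add: closed_list_def cj_eqs)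

fun double :: "nat list \<Rightarrow> bool" where
  "double (a # b # t) \<longleftrightarrow> a = b"
| "double _ \<longleftrightarrow> False"

text \<open>A nongenerating representative has a redundant first entry: it begins with a doubled
  entry, or it is \<open>[0, 1, 27, 29]\<close>, where conjugating 1 by 29 and then 27 by the result
  gives 0. The redundancy is what \<open>gen_butlast\<close> exploits.\<close>

lemma reps4_cases:
  assumes "r \<in> set reps4"
  shows "r \<in> set gens4 \<or> \<not> gen r \<and> (\<exists>a S. r = a # S \<and> redundant a S)"
proof -
  have "list_all (\<lambda>r. r \<in> set gens4 \<or> double r \<or> r = [0, 1, 27, 29]) reps4"
    by (simp add: reps4_def gens4_def)
  then have "r \<in> set gens4 \<or> double r \<or> r = [0, 1, 27, 29]"
    using assms by (auto simp: list_all_iff)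
  moreover have "redundant 0 [1, 27, 29]"
    by (rule redundant_derivable[of _ _ "[(1, 29), (27, 39)]"]) (simp add: cj_eqs)
  moreover have "\<exists>a S. r = a # S \<and> redundant a S" if "double r"
    using that by (cases r rule: double.cases) (auto simp: redundant_def)
  ultimately have red: "r \<in> set gens4 \<or> (\<exists>a S. r = a # S \<and> redundant a S)" by blast
  have "list_all (\<lambda>r. r \<in> set gens4 \<or>
      mems r [0, 1, 2, 3, 4, 5, 42, 43, 44] \<or> mems r [0, 5, 6, 11, 12, 17, 32, 35, 42] \<or>
      mems r [0, 1, 3, 6, 7, 9, 12, 13, 15, 18, 19, 21, 30, 33, 36] \<or>
      mems r [0, 1, 3, 27, 28, 29, 39, 40, 41] \<or> mems r [0, 5, 20, 26, 42]) reps4"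
    by (simp add: reps4_def gens4_def)
  then have "r \<in> set gens4 \<or>
      mems r [0, 1, 2, 3, 4, 5, 42, 43, 44] \<or> mems r [0, 5, 6, 11, 12, 17, 32, 35, 42] \<or>
      mems r [0, 1, 3, 6, 7, 9, 12, 13, 15, 18, 19, 21, 30, 33, 36] \<or>
      mems r [0, 1, 3, 27, 28, 29, 39, 40, 41] \<or> mems r [0, 5, 20, 26, 42]"
    using assms unfolding list_all_iff by blast
  then have "r \<in> set gens4 \<or> \<not> gen r"
    using closed_lists[THEN not_genI] by blast
  then show ?thesis using red by blast
qed

section \<open>Moving single and doubled entries through a tuple\<close>

lemma (in rack_auts) move_last:
  "heq F t (p @ a # T) \<Longrightarrow> \<exists>b<45. heq F t (p @ T @ [b])"
proof (induction T arbitrary: p a)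
  case Nil
  then show ?case using heq_tup by fastforce
next
  case (Cons y T)
  have "heq F t (bm (length p + 0) (p @ a # y # T))" by (rule heq_bm[OF Cons.prems])
  then have "heq F t ((p @ [y]) @ cj a y # T)" unfolding bm_prepend by simp
  from Cons.IH[OF this] show ?case by simp
qed

text \<open>The product of \<open>b, b\<close> is 1, so each entry that passes the pair is
  conjugated twice by \<open>b\<close> and returns to itself.\<close>

lemma (in rack_auts) pair_right:
  assumes "heq F t (u @ b # b # p @ q)" shows "heq F t (u @ p @ b # b # q)"
  using assms
proof (induction p arbitrary: u)
  case (Cons y p)
  then have lt: "b < 45" "y < 45" using heq_tup by fastforce+
  have "heq F t (bi (length u + 0) (bi (length u + 1) (u @ b # b # y # p @ q)))"
    using Cons.prems by (intro heq_bi) simp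
  then have "heq F t ((u @ [y]) @ b # b # p @ q)"
    unfolding bi_prepend using lt by (simp add: cj_cj)
  from Cons.IH[OF this] show ?case by simp
qed simp

text \<open>With the opposite braiding it is the pair that gets conjugated while \<open>y\<close>
  stays the same. Combined with \<open>pair_right\<close> this conjugates a doubled entry by any
  entry of the rest.\<close>

lemma (in rack_auts) pair_conj:
  assumes "heq F t (u @ b # b # y # q)" shows "heq F t (u @ y # cj b y # cj b y # q)"
proof -
  have "heq F t (bm (length u + 0) (bm (length u + 1) (u @ b # b # y # q)))"
    using assms by (intro heq_bm)
  then show ?thesis unfolding bm_prepend by simp
qed

text \<open>Entry \<open>i\<close> holds two indices whose successive conjugations take 0 to
  \<open>i\<close>; two steps suffice inside the single conjugacy class.\<close>

definition paths :: "(nat \<times> nat) list" where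
  "paths = [(0, 0), (0, 3), (0, 4), (0, 1), (0, 2), (0, 43), (0, 17),
      (0, 30), (0, 31), (0, 13), (0, 14), (1, 31), (0, 11), (0, 33), (0, 34), (0, 7), (0, 8), (1, 20),
      (0, 9), (0, 15), (1, 38), (0, 36), (0, 38), (0, 37), (0, 10), (0, 16), (1, 23), (0, 39), (0, 41),
      (0, 40), (0, 19), (0, 25), (1, 10), (0, 18), (0, 24), (1, 26), (0, 21), (0, 23), (0, 22), (0, 27),
      (0, 29), (0, 28), (0, 20), (2, 7), (1, 8)]"

lemma path_ex:
  assumes "i < 45" shows "\<exists>u<45. \<exists>v<45. i = cj (cj 0 u) v"
proof -
  have len: "length paths = 45" by (simp add: paths_def)
  have "map (\<lambda>p. cj (cj 0 (fst p)) (snd p)) paths = [0..<45]"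
    unfolding idx45 by (simp add: paths_def cj_eqs)
  then have "map (\<lambda>p. cj (cj 0 (fst p)) (snd p)) paths ! i = [0..<45] ! i" by (rule arg_cong)
  then have "cj (cj 0 (fst (paths ! i))) (snd (paths ! i)) = [0..<45] ! i"
    by (subst (asm) nth_map) (use assms len in simp_all)
  moreover have "[0..<45] ! i = i" using assms nth_upt[of 0 i 45] by (simp only: add_0)
  moreover have "list_all (\<lambda>p. fst p < 45 \<and> snd p < 45) paths" by (simp add: paths_def)
  then have "fst (paths ! i) < 45 \<and> snd (paths ! i) < 45" using assms len by (simp add: list_all_length)
  ultimately show ?thesis by metis
qed

section \<open>Reduction of generating tuples\<close>

lemma rack_connected:
  assumes "a \<in> X" "X \<subseteq> {..<45}" "\<And>x y. x \<in> X \<Longrightarrow> y < 45 \<Longrightarrow> cj x y \<in> X"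
  shows "X = {..<45}"
proof -
  obtain u v where uv: "u < 45" "v < 45" "a = cj (cj 0 u) v"
    using path_ex[OF subsetD[OF assms(2,1), unfolded lessThan_iff]] by auto
  have "cj (cj a v) u = 0" unfolding uv(3) using uv(1,2) by (simp add: cj_cj cj_lt)
  then have X0: "0 \<in> X" using assms(3)[OF assms(3)[OF assms(1) uv(2)] uv(1)] by simp
  have "i \<in> X" if i: "i < 45" for i
  proof -
    obtain u v where uv: "u < 45" "v < 45" "i = cj (cj 0 u) v" using path_ex[OF i] by auto
    show ?thesis unfolding uv(3) by (rule assms(3)[OF assms(3)[OF X0 uv(1)] uv(2)])
  qed
  then show ?thesis using assms(2) by blast
qed

text \<open>\<open>X\<close> collects the elements into which \<open>a\<close> can be changed,
  \<open>Y\<close> the indices whose conjugation preserves \<open>X\<close>. By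
  \<open>cj_cj_right\<close> the set \<open>Y\<close> is a subrack, and it contains the entries of
  \<open>T\<close>. As \<open>T\<close> generates, \<open>Y\<close> is everything, so
  \<open>X\<close> is the whole conjugacy class.\<close>

lemma (in rack_auts) pair_all:
  assumes "tup T" "gen T" "a < 45" "b < 45"
  shows "heq F (a # a # T) (b # b # T)"
proof -
  define X where "X = {x. x < 45 \<and> heq F (a # a # T) (x # x # T)}"
  define Y where "Y = {y. y < 45 \<and> (\<forall>x\<in>X. cj x y \<in> X)}"
  have "heq F (a # a # T) (a # a # T)" using assms by (intro heq_refl) simp
  then have a: "a \<in> X" using assms(3) by (simp add: X_def)
  have X45: "x < 45" if "x \<in> X" for x using that by (simp add: X_def)
  have "cj x y \<in> Y" if xy: "x \<in> Y" "y \<in> Y" for x y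
  proof -
    have lt: "x < 45" "y < 45" using xy by (simp_all add: Y_def)
    have "cj z (cj x y) \<in> X" if z: "z \<in> X" for z
      unfolding cj_cj_right[OF X45[OF z] lt] using xy z by (simp add: Y_def)
    then show ?thesis using lt by (simp add: Y_def cj_lt)
  qed
  moreover have "Y \<subseteq> {..<45}" by (auto simp: Y_def)
  ultimately have "closed_rack Y" unfolding closed_rack_def by blast
  moreover have "set T \<subseteq> Y"
  proof
    fix y assume "y \<in> set T"
    then obtain p q where T: "T = p @ y # q" by (meson split_list)
    have y: "y < 45" using assms(1) T by simp
    have "cj x y \<in> X" if x: "x \<in> X" for x
    proof -
      \<comment> \<open>The pair passes \<open>p\<close>, is conjugated while crossing
        \<open>y\<close>, and returns to the front by \<open>pair_right\<close> read
        backwards.\<close>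
      have "heq F (a # a # T) ([] @ x # x # p @ y # q)" using x T by (simp add: X_def)
      from pair_conj[OF pair_right[OF this, unfolded append_Nil]]
      have h: "heq F (a # a # T) (p @ y # cj x y # cj x y # q)" .
      have lt: "cj x y < 45" using X45[OF x] y by (rule cj_lt)
      have "heq F ([] @ cj x y # cj x y # (p @ [y]) @ q) ([] @ (p @ [y]) @ cj x y # cj x y # q)"
        by (rule pair_right, rule heq_refl) (use lt assms(1) T in simp)
      from heq_sym[OF this] have "heq F (p @ y # cj x y # cj x y # q) (cj x y # cj x y # T)"
        unfolding T by simp
      then have "heq F (a # a # T) (cj x y # cj x y # T)" using h by (rule heq_trans)
      then show ?thesis using lt by (simp add: X_def)
    qed
    then show "y \<in> Y" using y by (simp add: Y_def)
  qed
  ultimately have "Y = {..<45}" using assms(2) by (simp add: gen_def)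
  then have "cj x y \<in> X" if "x \<in> X" "y < 45" for x y
    using that unfolding Y_def by blast
  moreover have "X \<subseteq> {..<45}" by (auto simp: X_def)
  ultimately have "X = {..<45}" using rack_connected[OF a] by blast
  then have "b \<in> X" using assms(4) by simp
  then show ?thesis by (simp add: X_def)
qed

text \<open>Bringing \<open>t\<close> to \<open>r\<close> changes the appended entry by an
  uncontrolled \<open>f\<close>; this is why the certificates treat every possible last
  entry.\<close>

lemma class_step:
  assumes "check_all P rs wss" "\<forall>r\<in>set rs. tup r"
    and "\<exists>r\<in>set rs. weq t r" "tup (t @ [g])"
  shows "\<exists>u. P u \<and> weq (t @ [g]) u"
proof -
  obtain r where r: "r \<in> set rs" "weq t r" using assms(3) by blast
  obtain f where f: "\<forall>x<45. f x < 45" "weq ([] @ t @ [g]) (map f [] @ r @ map f [g])"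
    using W.heq_context[OF r(2), of "[]" "[g]"] assms(4) by auto
  have "\<exists>u. P u \<and> weq (r @ [f g]) u"
    by (rule check_all_sound[OF assms(1) r(1)]) (use assms(2,4) r f in auto)
  then show ?thesis using f(2) heq_trans by fastforce
qed

lemma class_append:
  assumes "\<And>t. tup t \<Longrightarrow> length t = n \<Longrightarrow> \<exists>r\<in>set rs. weq t r"
    and "check_all (\<lambda>u. u \<in> set rs') rs wss" "\<forall>r\<in>set rs. tup r" "tup t" "length t = Suc n"
  shows "\<exists>r\<in>set rs'. weq t r"
proof -
  obtain s g where t: "t = s @ [g]" using assms(5) by (cases t rule: rev_cases) auto
  have "\<exists>r\<in>set rs. weq s r" using assms(1)[of s] assms(4,5) t by simp
  from class_step[OF assms(2,3) this] assms(4) show ?thesis unfolding t by blast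
qed

lemma class4: "tup t \<Longrightarrow> length t = 4 \<Longrightarrow> \<exists>r\<in>set reps4. weq t r"
proof -
  have c0: "\<exists>r\<in>set [[]]. weq t r" if "tup t" "length t = 0" for t
    using that by (auto intro: heq_refl)
  have 1: "check_all (\<lambda>u. u \<in> set [[0]]) [[]] wss" if "check_all (\<lambda>u. u = [0]) [[]] wss" for wss
    using that by simp
  note c1 = class_append[OF c0 1[OF cert1]]
  note c2 = class_append[OF c1 cert2]
  note c3 = class_append[OF c2 cert3]
  note c4 = class_append[OF c3 cert4]
  show "tup t \<Longrightarrow> length t = 4 \<Longrightarrow> \<exists>r\<in>set reps4. weq t r"
    by (rule c4) (use tup_reps in simp_all)
qed

lemma class4_gen:
  assumes "tup t" "length t = 4" "gen t" shows "\<exists>r\<in>set gens4. weq t r"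
proof -
  obtain r where r: "r \<in> set reps4" "weq t r" using class4 assms by blast
  then show ?thesis using reps4_cases[OF r(1)] gen_weq[OF r(2)] assms(3) by blast
qed

text \<open>The representative of the first four entries decides. If it generates, the last entry
  can go, as there are at least five. Otherwise its first entry is redundant and is passed to the
  far end; it is conjugated on the way but leaves the other entries unchanged.\<close>

lemma gen_butlast:
  assumes "tup t" "5 \<le> length t" "gen t"
  shows "\<exists>s g. weq t (s @ [g]) \<and> gen s"
proof -
  define p q where "p = take 4 t" and "q = drop 4 t"
  have t: "t = p @ q" "length p = 4" "q \<noteq> []" using assms(2) by (auto simp: p_def q_def)
  obtain r where r: "r \<in> set reps4" "weq p r" using class4[of p] assms(1) t by auto
  obtain f where f: "weq ([] @ p @ q) (map f [] @ r @ map f q)"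
    using W.heq_context[OF r(2), of "[]" q] assms(1) t by auto
  then have w: "weq t (r @ map f q)" using t by simp
  consider "gen r" | a S where "r = a # S" "redundant a S"
    using reps4_cases[OF r(1)] gen_gens4 by blast
  then show ?thesis
  proof cases
    case 1
    obtain q' g where "map f q = q' @ [g]" using t(3) by (cases "map f q" rule: rev_cases) auto
    then show ?thesis using w gen_mono[OF 1, of "r @ q'"] by (intro exI[of _ "r @ q'"] exI[of _ g]) simp
  next
    case 2
    have "gen (r @ map f q)" using gen_weq[OF w] assms(3) by simp
    then have "gen (S @ map f q)" using gen_drop 2 by simp
    moreover obtain b where "weq t ([] @ (S @ map f q) @ [b])"
      using W.move_last[of t "[]" a "S @ map f q"] w 2(1) by auto
    ultimately show ?thesis by (metis append_Nil)
  qed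
qed

lemma class5:
  assumes "tup t" "length t = 5" "gen t" shows "\<exists>r. (r \<in> set reps5e \<or> r \<in> set reps5) \<and> weq t r"
proof -
  obtain s g where s: "weq t (s @ [g])" "gen s" using gen_butlast assms by fastforce
  have "tup (s @ [g])" using W.heq_tup[OF s(1)] by blast
  moreover have "length s = 4" using heq_length[OF s(1)] assms(2) by simp
  ultimately have "\<exists>r. (r \<in> set reps5e \<or> r \<in> set reps5) \<and> weq (s @ [g]) r"
    using class_step[OF cert5 tup_reps(4) class4_gen] s(2) by simp
  then show ?thesis using heq_trans s(1) by blast
qed

text \<open>The way back from \<open>Aut(A_6)\<close>: by the first two premises the
  \<open>seq\<close>-classes meeting \<open>X\<close> are mapped among themselves by the outer
  generators, so each outer step of a \<open>weq\<close>-derivation can be absorbed.\<close>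

lemma seq_into:
  assumes "\<And>x. x \<in> X \<Longrightarrow> \<exists>y\<in>X. seq (map alpha x) y" "\<And>x. x \<in> X \<Longrightarrow> \<exists>y\<in>X. seq (map epsilon x) y"
    and "weq t u" "x \<in> X" "seq u x"
  shows "\<exists>x\<in>X. seq t x"
  using assms(3,4,5)
proof (induction arbitrary: x rule: heq.induct)
  case (heq_bm t u i)
  have "seq u (bm i u)" using W.heq_tup[OF heq_bm.hyps] by (intro heq.heq_bm heq_refl) blast
  then show ?case using heq_bm heq_trans by blast
next
  case (heq_bi t u i)
  have "seq u (bi i u)" using W.heq_tup[OF heq_bi.hyps] by (intro heq.heq_bi heq_refl) blast
  then show ?case using heq_bi heq_trans by blast
next
  case (heq_map t u f)
  have u: "tup u" using W.heq_tup[OF heq_map.hyps(1)] by blast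
  show ?case
  proof (cases "f \<in> inners")
    case True
    then have "seq u (map f u)" using u by (intro heq.heq_map heq_refl)
    then show ?thesis using heq_map heq_trans by blast
  next
    case False
    then have f: "f = alpha \<or> f = epsilon" using heq_map.hyps(2) by (auto simp: auts_def)
    have "seq (map f (map f u)) (map f x)"
      using heq_map.prems(2) rack_aut_auts[OF heq_map.hyps(2)] by (rule seq_aut)
    then have "seq u (map f x)"
      by (simp only: map_map_aut[OF rack_aut_auts[OF heq_map.hyps(2)] u])
    moreover obtain y where "y \<in> X" "seq (map f x) y" using f assms(1,2) heq_map.prems(1) by blast
    ultimately show ?thesis using heq_map.IH heq_trans by blast
  qed
qed blast

text \<open>The case \<open>p = q\<close> covers a class fixed by both outer generators. The images
  are separate parameters so that they enter already evaluated.\<close>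

lemma seq_into_pair:
  assumes "weq t p" "map alpha p = p1" "map alpha q = q1" "map epsilon p = p2" "map epsilon q = q2"
    and "seq p1 p \<or> seq p1 q" "seq q1 p \<or> seq q1 q" "seq p2 p \<or> seq p2 q" "seq q2 p \<or> seq q2 q"
  shows "seq t p \<or> seq t q"
proof -
  have "seq p p" using W.heq_tup[OF assms(1)] by (intro heq_refl) blast
  have "\<exists>x\<in>{p, q}. seq t x"
  proof (rule seq_into[OF _ _ assms(1) insertI1 \<open>seq p p\<close>])
    fix x assume "x \<in> {p, q}"
    then show "\<exists>y\<in>{p, q}. seq (map alpha x) y" "\<exists>y\<in>{p, q}. seq (map epsilon x) y"
      using assms by auto
  qed
  then show ?thesis by blast
qed

section \<open>Splitting off a doubled entry\<close>

definition split_pair :: "nat list \<Rightarrow> bool" where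
  "split_pair t \<longleftrightarrow> (\<exists>a T. gen T \<and> seq t (a # a # T))"

text \<open>The shape \<open>a, a, T\<close> with \<open>T\<close> generating is preserved by every
  rack automorphism, so \<open>seq_into\<close> applies although the definition admits only inner
  automorphisms.\<close>

lemma split_pair_weq:
  assumes "weq t u" "split_pair u" shows "split_pair t"
proof -
  define X where "X = {a # a # T | a T. a < 45 \<and> tup T \<and> gen T}"
  obtain a T where u: "gen T" "seq u (a # a # T)" using assms(2) by (auto simp: split_pair_def)
  have X: "\<exists>y\<in>X. seq (map f x) y" if f: "rack_aut f" and x: "x \<in> X" for f x
  proof -
    obtain a T where x: "x = a # a # T" "a < 45" "tup T" "gen T" using x by (auto simp: X_def)
    have m: "f a < 45" "tup (map f T)" "gen (map f T)"
      using x gen_map[OF f] tup_map[OF f] rack_autD[OF f] by auto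
    then have "map f x \<in> X" unfolding X_def x(1) by auto
    moreover have "seq (map f x) (map f x)" using m by (intro heq_refl) (simp add: x(1))
    ultimately show ?thesis by blast
  qed
  have "a # a # T \<in> X" using u I.heq_tup[OF u(2)] by (auto simp: X_def)
  from seq_into[OF X[OF rack_aut_alpha] X[OF rack_aut_epsilon] assms(1) this u(2)]
  show ?thesis by (auto simp: X_def split_pair_def)
qed

lemma split_pair_append:
  assumes "split_pair s" "g < 45" shows "split_pair (s @ [g])"
proof -
  obtain a T where s: "gen T" "seq s (a # a # T)" using assms(1) by (auto simp: split_pair_def)
  obtain f where "seq ([] @ s @ [g]) (map f [] @ (a # a # T) @ map f [g])"
    using I.heq_context[OF s(2), of "[]" "[g]"] assms(2) by auto
  moreover have "gen (T @ map f [g])" using s(1) by (rule gen_mono) auto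
  ultimately show ?thesis by (auto simp: split_pair_def)
qed

lemma split_pair_if_tail:
  assumes "pair_tail rs u" "tup u" "\<And>r. r \<in> set rs \<Longrightarrow> gen r" shows "split_pair u"
proof -
  obtain a T where u: "u = a # a # T" "T \<in> set rs"
    using assms(1) by (cases "(rs, u)" rule: pair_tail.cases) auto
  have "seq u (a # a # T)" using heq_refl[OF assms(2)] u(1) by simp
  then show ?thesis using assms(3)[OF u(2)] unfolding split_pair_def by blast
qed

lemma gen_reps5_all: "r \<in> set (reps5e @ reps5) \<Longrightarrow> gen r"
  using gen_reps5 gen_reps5e gen_mono[of _ "0 # 0 # _"] by fastforce

text \<open>After \<open>gen_butlast\<close> the shorter tuple either splits, and the last entry
  joins the tail, or it is a listed exception, and the certificate takes over.\<close>

lemma class_gen_step: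
  assumes "check_all (\<lambda>u. pair_tail rs u \<or> u \<in> set rs') rs0 wss" "\<forall>r\<in>set rs0. tup r" "\<And>r. r \<in> set rs \<Longrightarrow> gen r"
    and "\<And>s. tup s \<Longrightarrow> length s = n \<Longrightarrow> gen s \<Longrightarrow> split_pair s \<or> (\<exists>r\<in>set rs0. weq s r)"
    and "tup t" "length t = Suc n" "4 \<le> n" "gen t"
  shows "split_pair t \<or> (\<exists>r\<in>set rs'. weq t r)"
proof -
  obtain s g where s: "weq t (s @ [g])" "gen s" using gen_butlast assms(5-8) by fastforce
  have tup: "tup s" "g < 45" using W.heq_tup[OF s(1)] by auto
  have "length s = n" using heq_length[OF s(1)] assms(6) by simp
  then consider "split_pair s" | r where "r \<in> set rs0" "weq s r" using assms(4) tup s(2) by blast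
  then show ?thesis
  proof cases
    case 1
    then show ?thesis using split_pair_append split_pair_weq tup s(1) by blast
  next
    case 2
    then obtain u where u: "pair_tail rs u \<or> u \<in> set rs'" "weq (s @ [g]) u"
      using class_step[OF assms(1,2), of s g] tup by auto
    then have w: "weq t u" using heq_trans s(1) by blast
    have "tup u" using W.heq_tup[OF w] by blast
    then show ?thesis using u(1) w split_pair_if_tail[OF _ _ assms(3)] split_pair_weq by blast
  qed
qed

lemma class6:
  assumes "tup t" "length t = 6" "gen t" shows "split_pair t \<or> (\<exists>r\<in>set reps6. weq t r)"
proof (rule class_gen_step[OF cert6 tup_reps(6) gen_gens4])
  fix s assume s: "tup s" "length s = 5" "gen s"
  then obtain r where r: "r \<in> set reps5e \<or> r \<in> set reps5" "weq s r" using class5 by blast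
  have "split_pair s" if r5: "r \<in> set reps5e"
  proof -
    obtain T where "r = 0 # 0 # T" "gen T" using gen_reps5e[OF r5] by blast
    moreover have "seq r r" using W.heq_tup[OF r(2)] by (intro heq_refl) blast
    ultimately have "split_pair r" unfolding split_pair_def by blast
    then show ?thesis using split_pair_weq r(2) by blast
  qed
  then show "split_pair s \<or> (\<exists>r\<in>set reps5. weq s r)" using r by blast
qed (use assms in simp_all)

lemma class7:
  assumes "tup t" "length t = 7" "gen t" shows "split_pair t \<or> (\<exists>r\<in>set reps7. weq t r)"
proof -
  have n: "length t = Suc 6" "4 \<le> (6::nat)" using assms(2) by simp_all
  show ?thesis
    by (rule class_gen_step[OF cert7 tup_reps(7) gen_reps5_all class6 assms(1) n assms(3)])
qed

lemma class8:
  assumes "tup t" "8 \<le> length t" "gen t" shows "split_pair t"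
  using assms
proof (induction "length t" arbitrary: t rule: less_induct)
  case less
  \<comment> \<open>The certificate is read as one with an empty list of exceptions. It serves for
    length 8; for longer tuples the shorter tuple splits by induction.\<close>
  have c8: "check_all (\<lambda>u. pair_tail reps6 u \<or> u \<in> set []) reps7 wss" if "check_all (\<lambda>u. pair_tail reps6 u) reps7 wss" for wss
    using that by simp
  obtain n where n: "length t = Suc n" "7 \<le> n" using less.prems(2) by (cases "length t") auto
  have "split_pair t \<or> (\<exists>r\<in>set []. weq t r)"
  proof (rule class_gen_step[OF c8[OF cert8] tup_reps(8) gen_reps6])
    fix s assume s: "tup s" "length s = n" "gen s"
    show "split_pair s \<or> (\<exists>r\<in>set reps7. weq s r)"
    proof (cases "n = 7")
      case True
      then show ?thesis using class7 s by simp
    next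
      case False
      then show ?thesis using less.hyps[of s] s n by simp
    qed
  qed (use less.prems n in simp_all)
  then show ?case by simp
qed

text \<open>This amounts to a trivial product, since \<open>A_6\<close> has no centre; unlike the product, it is visibly
  invariant under \<open>Aut(A_6)\<close>.\<close>

definition product_one :: "nat list \<Rightarrow> bool" where
  "product_one t \<longleftrightarrow> (\<forall>b<45. foldl cj b t = b)"

lemma foldl_cj_lt: "tup t \<Longrightarrow> b < 45 \<Longrightarrow> foldl cj b t < 45"
  by (induction t arbitrary: b) (auto simp: cj_lt)

lemma foldl_cj_bm: "tup t \<Longrightarrow> b < 45 \<Longrightarrow> foldl cj b (bm i t) = foldl cj b t"
proof (induction i t arbitrary: b rule: bm.induct)
  case (1 x y t)
  then have "cj (cj b y) (cj x y) = cj (cj b x) y"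
    by (simp add: cj_cj_right cj_lt cj_cj)
  then show ?case by simp
qed (auto simp: cj_lt)

lemma foldl_cj_bi: "tup t \<Longrightarrow> b < 45 \<Longrightarrow> foldl cj b (bi i t) = foldl cj b t"
  using foldl_cj_bm[OF tup_bi, of t b i i] by (simp add: bm_bi)

lemma foldl_cj_map:
  "rack_aut f \<Longrightarrow> tup t \<Longrightarrow> b < 45 \<Longrightarrow> foldl cj (f b) (map f t) = f (foldl cj b t)"
  by (induction t arbitrary: b) (auto simp: cj_lt rack_autD(3)[symmetric])

lemma product_one_map1:
  assumes f: "rack_aut f" and t: "tup t" "product_one t" shows "product_one (map f t)"
  unfolding product_one_def
proof (intro allI impI)
  fix b :: nat assume b: "b < 45"
  have "foldl cj (f (f b)) (map f t) = f (foldl cj (f b) t)"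
    using foldl_cj_map[OF f t(1)] rack_autD(1)[OF f b] by blast
  also have "\<dots> = f (f b)" using t(2) rack_autD(1)[OF f b] by (simp add: product_one_def)
  finally show "foldl cj b (map f t) = b" using rack_autD(2)[OF f b] by simp
qed

lemma product_one_map: "rack_aut f \<Longrightarrow> tup t \<Longrightarrow> product_one (map f t) \<longleftrightarrow> product_one t"
  using product_one_map1 tup_map map_map_aut by metis

lemma product_one_weq: "weq t u \<Longrightarrow> product_one u \<longleftrightarrow> product_one t"
proof (induction rule: heq.induct)
  case (heq_bm t u i)
  then show ?case using foldl_cj_bm W.heq_tup by (auto simp: product_one_def)
next
  case (heq_bi t u i)
  then show ?case using foldl_cj_bi W.heq_tup by (auto simp: product_one_def)
next
  case (heq_map t u f)
  then show ?case using product_one_map rack_aut_auts W.heq_tup by blast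
qed simp

lemma product_one_pair: "a < 45 \<Longrightarrow> tup T \<Longrightarrow> product_one (a # a # T) \<longleftrightarrow> product_one T"
  by (simp add: product_one_def cj_cj)

lemma not_product_one: "foldl cj 0 t \<noteq> 0 \<Longrightarrow> \<not> product_one t"
  using zero_less_numeral unfolding product_one_def by metis

text \<open>Following index 0 alone through the conjugations refutes a trivial product for all
  representatives but the named ones.\<close>

lemma reps_product:
  "list_all (\<lambda>r. foldl cj 0 r \<noteq> 0) gens4" "list_all (\<lambda>r. foldl cj 0 r \<noteq> 0) reps5e"
  "list_all (\<lambda>r. foldl cj 0 r \<noteq> 0 \<or> r = [0, 1, 8, 9, 40]) reps5"
  "list_all (\<lambda>r. foldl cj 0 r \<noteq> 0 \<or> r = [0, 0, 1, 1, 8, 8] \<or> r = [0, 1, 8, 9, 14, 15]) reps6"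
  by (simp_all add: gens4_def reps5e_def reps5_def reps6_def cj_eqs)

lemma gens4_product: "r \<in> set gens4 \<Longrightarrow> \<not> product_one r"
  using reps_product(1) not_product_one unfolding list_all_iff by blast

lemma reps5_product: "r \<in> set reps5e \<or> r \<in> set reps5 \<Longrightarrow> product_one r \<Longrightarrow> r = [0, 1, 8, 9, 40]"
  using reps_product(2,3) not_product_one unfolding list_all_iff by blast

lemma reps6_product:
  "r \<in> set reps6 \<Longrightarrow> product_one r \<Longrightarrow> r = [0, 0, 1, 1, 8, 8] \<or> r = [0, 1, 8, 9, 14, 15]"
  using reps_product(4) not_product_one unfolding list_all_iff by blast

lemma gens_product5:
  assumes "tup t" "length t = 5" "gen t" "product_one t" shows "weq t [0, 1, 8, 9, 40]"
proof -
  obtain r where r: "r \<in> set reps5e \<or> r \<in> set reps5" "weq t r" using class5 assms by blast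
  have "r = [0, 1, 8, 9, 40]" using reps5_product r product_one_weq[OF r(2)] assms(4) by blast
  then show ?thesis using r(2) by simp
qed

lemma seq_by_letters:
  assumes "fold letter w t = u" "list_all (\<lambda>l. l \<noteq> 8 \<and> l \<noteq> 9) w" "tup t" shows "seq t u"
  using seq_letters[OF heq_refl[OF assms(3)] assms(2)] assms(1) by simp

text \<open>The single class under \<open>Aut(A_6)\<close> breaks up into at most two:
  \<open>alpha\<close> and, after braiding, also \<open>epsilon\<close> interchange the two
  tuples.\<close>

lemma product5:
  assumes "tup t" "length t = 5" "gen t" "product_one t"
  shows "seq t [0, 1, 8, 9, 40] \<or> seq t [0, 1, 24, 30, 28]"
proof -
  have c: "seq [0, 22, 8, 24, 36] [0, 1, 24, 30, 28]"
    by (rule seq_by_letters[of "[3, 12, 11, 11, 25, 32]"]) (simp_all add: letter_def cj_eqs)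
  have d: "seq [0, 22, 9, 15, 4] [0, 1, 8, 9, 40]"
    by (rule seq_by_letters[of "[3, 12, 11, 11]"]) (simp_all add: letter_def cj_eqs)
  have m: "map alpha [0, 1, 8, 9, 40] = [0, 1, 24, 30, 28]" "map alpha [0, 1, 24, 30, 28] = [0, 1, 8, 9, 40]"
    "map epsilon [0, 1, 8, 9, 40] = [0, 22, 8, 24, 36]" "map epsilon [0, 1, 24, 30, 28] = [0, 22, 9, 15, 4]"
    by (simp_all add: alpha_eqs epsilon_eqs)
  have r: "seq [0, 1, 8, 9, 40] [0, 1, 8, 9, 40]" "seq [0, 1, 24, 30, 28] [0, 1, 24, 30, 28]"
    by (rule heq_refl, simp)+
  show ?thesis
    by (rule seq_into_pair[OF gens_product5[OF assms] m]) (use c d r in blast)+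
qed

text \<open>Up to \<open>seq\<close>, both outer generators fix the class of
  \<open>[0, 0, 1, 1, 8, 8]\<close> and interchange the other two tuples.\<close>

lemma product6:
  assumes "tup t" "length t = 6" "gen t" "product_one t"
  shows "seq t [0, 0, 1, 1, 8, 8] \<or> seq t [0, 1, 8, 9, 14, 15] \<or> seq t [0, 1, 24, 30, 25, 33]"
proof -
  have c: "seq [0, 22, 8, 24, 33, 30] [0, 1, 24, 30, 25, 33]"
    by (rule seq_by_letters[of "[3, 10, 11, 11, 46, 53]"]) (simp_all add: letter_def cj_eqs)
  have d: "seq [0, 22, 9, 15, 25, 14] [0, 1, 8, 9, 14, 15]"
    by (rule seq_by_letters[of "[3, 10, 11, 11, 20, 58]"]) (simp_all add: letter_def cj_eqs)
  have e: "seq [0, 0, 1, 1, 24, 24] [0, 0, 1, 1, 8, 8]"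
    by (rule seq_by_letters[of "[11, 10, 12, 11, 23]"]) (simp_all add: letter_def cj_eqs)
  have f: "seq [0, 0, 22, 22, 8, 8] [0, 0, 1, 1, 8, 8]"
    by (rule seq_by_letters[of "[13, 12, 12, 13]"]) (simp_all add: letter_def cj_eqs)
  have m: "map alpha [0, 1, 8, 9, 14, 15] = [0, 1, 24, 30, 25, 33]" "map alpha [0, 1, 24, 30, 25, 33] = [0, 1, 8, 9, 14, 15]"
    "map epsilon [0, 1, 8, 9, 14, 15] = [0, 22, 8, 24, 33, 30]" "map epsilon [0, 1, 24, 30, 25, 33] = [0, 22, 9, 15, 25, 14]"
    "map alpha [0, 0, 1, 1, 8, 8] = [0, 0, 1, 1, 24, 24]" "map epsilon [0, 0, 1, 1, 8, 8] = [0, 0, 22, 22, 8, 8]"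
    by (simp_all add: alpha_eqs epsilon_eqs)
  have r: "seq [0, 1, 8, 9, 14, 15] [0, 1, 8, 9, 14, 15]" "seq [0, 1, 24, 30, 25, 33] [0, 1, 24, 30, 25, 33]"
    by (rule heq_refl, simp)+
  \<comment> \<open>Otherwise the tail would be a generating 4-tuple with trivial product, which
    \<open>gens4_product\<close> excludes.\<close>
  have "\<not> split_pair t"
  proof
    assume "split_pair t"
    then obtain a T where T: "gen T" "seq t (a # a # T)" by (auto simp: split_pair_def)
    have tup: "a < 45" "tup T" and len: "length T = 4"
      using I.heq_tup[OF T(2)] heq_length[OF T(2)] assms(2) by auto
    have "product_one T"
      using product_one_weq[OF seq_weq[OF T(2)]] assms(4) product_one_pair[OF tup] by simp
    moreover obtain r where r: "r \<in> set gens4" "weq T r" using class4_gen[OF tup(2) len T(1)] by blast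
    ultimately show False using gens4_product[OF r(1)] product_one_weq[OF r(2)] by simp
  qed
  then obtain r where r6: "r \<in> set reps6" "weq t r" using class6 assms by blast
  then consider "weq t [0, 0, 1, 1, 8, 8]" | "weq t [0, 1, 8, 9, 14, 15]"
    using reps6_product product_one_weq[OF r6(2)] assms(4) by blast
  then show ?thesis
  proof cases
    case 1
    show ?thesis
      using seq_into_pair[OF 1 m(5,5,6,6)] e f by blast
  next
    case 2
    show ?thesis
      using seq_into_pair[OF 2 m(1-4)] c d r by blast
  qed
qed

lemma product7:
  assumes "tup t" "length t = 7" "gen t"
  shows "split_pair t \<or> seq t [0, 5, 42, 1, 1, 8, 8]"
proof (cases "split_pair t")
  case False
  then have w: "weq t [0, 5, 42, 1, 1, 8, 8]" using class7[OF assms] by (auto simp: reps7_def)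
  have c: "seq [0, 5, 42, 1, 1, 24, 24] [0, 5, 42, 1, 1, 8, 8]"
    by (rule seq_by_letters[of "[0, 2, 3, 3, 2, 64]"]) (simp_all add: letter_def cj_eqs)
  have d: "seq [0, 12, 6, 22, 22, 8, 8] [0, 5, 42, 1, 1, 8, 8]"
    by (rule seq_by_letters[of "[2, 2, 14, 3, 12, 3, 11, 12, 3, 14, 12, 12]"]) (simp_all add: letter_def cj_eqs)
  have m: "map alpha [0, 5, 42, 1, 1, 8, 8] = [0, 5, 42, 1, 1, 24, 24]"
    "map epsilon [0, 5, 42, 1, 1, 8, 8] = [0, 12, 6, 22, 22, 8, 8]"
    by (simp_all add: alpha_eqs epsilon_eqs)
  show ?thesis
    using seq_into_pair[OF w m(1,1,2,2)] c d by blast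
qed blast

section \<open>The kernel of the Valentiner group\<close>

lemma v_map:
  "map v1 [1, 2, 3, 4, 5, 6, 7, 8, 9, 10, 11, 12, 13, 14, 15, 16, 17, 18] = [1, 6, 3, 11, 5, 2, 9, 13, 7, 14, 4, 16, 8, 10, 15, 12, 17, 18]"
  "map v2 [1, 2, 3, 4, 5, 6, 7, 8, 9, 10, 11, 12, 13, 14, 15, 16, 17, 18] = [2, 7, 8, 1, 9, 10, 4, 6, 13, 3, 15, 5, 12, 17, 11, 18, 14, 16]"
  by (simp_all add: v1_def v2_def transpose_def)

lemma s_map:
  "map s1 [1, 2, 3, 4, 5, 6] = [2, 1, 4, 3, 5, 6]"
  "map s2 [1, 2, 3, 4, 5, 6] = [2, 4, 6, 5, 1, 3]"
  by (simp_all add: s1_def s2_def transpose_def)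

lemma block_map:
  "map val_block [1, 2, 3, 4, 5, 6, 7, 8, 9, 10, 11, 12, 13, 14, 15, 16, 17, 18] = [5, 1, 5, 4, 5, 2, 2, 1, 1, 4, 3, 4, 2, 3, 6, 3, 6, 6]"
  by (simp add: val_block_def)

lemmas v_eqs = v_map[unfolded list.map list.inject simp_thms]
lemmas s_eqs = s_map[unfolded list.map list.inject simp_thms]
lemmas block_eqs = block_map[unfolded list.map list.inject simp_thms]

text \<open>The supports of the weight 4 words of the hexacode, whose monomial automorphism group is
  \<open>3.A_6\<close>; every word is listed along increasing blocks.\<close>

definition hexacode :: "nat list list" where
  "hexacode =
 [[2,6,5,17],[2,6,16,12],[2,7,4,1],[2,7,11,18],[2,11,10,5],[2,12,3,18],[2,13,10,15],[2,13,14,3],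
 [2,14,4,17],[2,16,1,15],[6,11,10,17],[6,12,1,15],[6,14,4,5],[6,16,3,18],[7,10,5,18],[7,11,12,3],
 [7,14,1,17],[7,16,4,15],[8,4,5,15],[8,6,10,3],[8,6,14,15],[8,7,12,17],[8,7,16,5],[8,11,3,17],[8,
 13,1,18],[8,13,11,4],[8,14,12,1],[8,16,10,18],[9,6,4,18],[9,6,11,1],[9,7,3,15],[9,7,14,10],[9,10,
 1,17],[9,11,12,15],[9,13,12,5],[9,13,16,17],[9,14,5,18],[9,16,4,3],[11,4,1,18],[13,4,3,17],[13,
 11,5,15],[13,14,12,18],[13,16,10,1],[14,10,3,15],[16,12,5,17]]"

lemma hexacode_blocks:
  "list_all (\<lambda>S. mems S [1, 2, 3, 4, 5, 6, 7, 8, 9, 10, 11, 12, 13, 14, 15, 16, 17, 18] \<and>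
     sorted (map val_block S) \<and> distinct (map val_block S)) hexacode"
  by (simp add: hexacode_def block_eqs)

fun no_common :: "nat list \<Rightarrow> nat list \<Rightarrow> bool" where
  "no_common [] T \<longleftrightarrow> True"
| "no_common (x # S) T \<longleftrightarrow> \<not> mem x T \<and> no_common S T"

lemma no_common_iff: "no_common S T \<longleftrightarrow> set S \<inter> set T = {}"
  by (induction S) (auto simp: mem_iff)

fun apart :: "nat list \<Rightarrow> nat list \<Rightarrow> (nat list \<times> nat list) list \<Rightarrow> bool" where
  "apart b S [] \<longleftrightarrow> True"
| "apart b S ((b', S') # H) \<longleftrightarrow> (if b = b' then no_common S S' else True) \<and> apart b S H"

lemma apart_iff: "apart b S H \<longleftrightarrow> (\<forall>S'. (b, S') \<in> set H \<longrightarrow> set S \<inter> set S' = {})"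
  by (induction b S H rule: apart.induct) (auto simp: no_common_iff)

fun all_apart :: "(nat list \<times> nat list) list \<Rightarrow> bool" where
  "all_apart [] \<longleftrightarrow> True"
| "all_apart ((b, S) # H) \<longleftrightarrow> apart b S H \<and> all_apart H"

lemma all_apartD:
  "all_apart H \<Longrightarrow> (b, S) \<in> set H \<Longrightarrow> (b, S') \<in> set H \<Longrightarrow> S = S' \<or> set S \<inter> set S' = {}"
  by (induction H rule: all_apart.induct) (auto simp: apart_iff)

text \<open>Weight 4 words on the same four positions are scalar multiples of each other, and
  different multiples share no point.\<close>

lemma hexacode_disjoint: "all_apart (map (\<lambda>S. (map val_block S, S)) hexacode)"
  by (simp add: hexacode_def block_eqs)

text \<open>Images are sorted by block again so that they are found literally in the list.\<close>

lemma hexacode_v: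
  "list_all (\<lambda>S. sort_key val_block (map v1 S) \<in> set hexacode) hexacode"
  "list_all (\<lambda>S. sort_key val_block (map v2 S) \<in> set hexacode) hexacode"
  by (simp_all add: hexacode_def block_eqs v_eqs)

text \<open>The points 1, 3, 5 form block 5. Common words carry the property of being fixed from
  this block to all others and back.\<close>

lemma hexacode_pairs:
  "list_all (\<lambda>p. list_all (\<lambda>q. list_ex (\<lambda>S. mem p S \<and> mem q S) hexacode)
     [2, 4, 6, 7, 8, 9, 10, 11, 12, 13, 14, 15, 16, 17, 18]) [1, 3, 5]"
  by (simp add: hexacode_def)

text \<open>Letter 1 stands for \<open>v1\<close>, any other letter for \<open>v2\<close>. Positive
  words suffice since the second power of \<open>v1\<close> and the fourth power of
  \<open>v2\<close> are trivial.\<close>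

primrec v_word :: "nat list \<Rightarrow> nat \<Rightarrow> nat" where
  "v_word [] = id"
| "v_word (l # w) = (if l = 1 then v1 else v2) \<circ> v_word w"

primrec s_word :: "nat list \<Rightarrow> nat \<Rightarrow> nat" where
  "s_word [] = id"
| "s_word (l # w) = (if l = 1 then s1 else s2) \<circ> s_word w"

lemma v_word_append: "v_word (u @ w) = v_word u \<circ> v_word w"
  by (induction u) (auto simp: comp_assoc)

lemma permutes18_eqI:
  fixes f g :: "nat \<Rightarrow> nat"
  assumes "f permutes {1..18}" "g permutes {1..18}"
    "list_all (\<lambda>p. f p = g p) [1, 2, 3, 4, 5, 6, 7, 8, 9, 10, 11, 12, 13, 14, 15, 16, 17, 18]"
  shows "f = g"
proof
  fix p :: nat
  show "f p = g p"
    using assms unfolding permutes_def ivl18 by (cases "p \<in> {1, 2, 3, 4, 5, 6, 7, 8, 9, 10, 11, 12, 13, 14, 15, 16, 17, 18}") auto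
qed

lemma v_word_permutes: "v_word w permutes {1..18}"
proof (induction w)
  case Nil
  show ?case unfolding v_word.simps by (rule permutes_id)
next
  case (Cons l w)
  show ?case unfolding v_word.simps
    by (rule permutes_compose[OF Cons]) (use v1_permutes v2_permutes in simp)
qed

lemma s_word_permutes: "s_word w permutes {1..6}"
proof (induction w)
  case Nil
  show ?case unfolding s_word.simps by (rule permutes_id)
next
  case (Cons l w)
  show ?case unfolding s_word.simps
    by (rule permutes_compose[OF Cons]) (use s1_in s2_in in \<open>simp add: alt_group_carrier\<close>)
qed

lemma covers_word: "covers (v_word w) (s_word w)"
proof (induction w)
  case Nil
  show ?case unfolding v_word.simps s_word.simps by (rule covers_id)
next
  case (Cons l w)
  show ?case unfolding v_word.simps s_word.simps
    by (rule covers_comp[OF _ Cons]) (use covers_v1 covers_v2 in simp)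
qed

lemma v_relations: "v1 \<circ> v1 = id" "v2 \<circ> v_word [2, 2, 2] = id"
proof -
  have "v_word [1, 1] = id" "v_word [2, 2, 2, 2] = id"
    by (rule permutes18_eqI[OF v_word_permutes permutes_id], simp add: v_eqs)+
  then show "v1 \<circ> v1 = id" "v2 \<circ> v_word [2, 2, 2] = id" by simp_all
qed

lemma sym18_inv: "inv\<^bsub>sym_group 18\<^esub> v1 = v1" "inv\<^bsub>sym_group 18\<^esub> v2 = v_word [2, 2, 2]"
  using sym_group_inv[OF v1_permutes] sym_group_inv[OF v2_permutes] v_relations
    inv_unique_comp[of v1 v1] inv_unique_comp[of v2 "v_word [2, 2, 2]"]
  by (simp_all add: comp_assoc)

lemma v1_Valentiner: "v1 \<in> carrier Valentiner" and v2_Valentiner: "v2 \<in> carrier Valentiner"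
  by (auto simp: Valentiner_def intro: generate.incl)

lemma Valentiner_one: "\<one>\<^bsub>Valentiner\<^esub> = id"
  by (simp add: Valentiner_def sym_group_one)

interpretation V: group Valentiner by (rule group_Valentiner)

lemma comp_Valentiner: "v \<in> carrier Valentiner \<Longrightarrow> w \<in> carrier Valentiner \<Longrightarrow> v \<circ> w \<in> carrier Valentiner"
  using V.m_closed by (simp add: Valentiner_mult)

lemma id_Valentiner: "id \<in> carrier Valentiner"
  using V.one_closed by (simp add: Valentiner_one)

lemma Valentiner_words: "carrier Valentiner = range v_word"
proof
  show "range v_word \<subseteq> carrier Valentiner"
  proof safe
    fix w show "v_word w \<in> carrier Valentiner"
    proof (induction w)
      case Nil
      show ?case unfolding v_word.simps by (rule id_Valentiner)
    next
      case (Cons l w)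
      show ?case unfolding v_word.simps
        by (rule comp_Valentiner[OF _ Cons]) (use v1_Valentiner v2_Valentiner in simp)
    qed
  qed
  have "v \<in> range v_word" if "v \<in> generate (sym_group 18) {v1, v2}" for v
    using that
  proof (induction rule: generate.induct)
    case one
    then show ?case by (intro range_eqI[of _ _ "[]"]) (simp add: sym_group_one)
  next
    case (incl h)
    then have "h = v_word [1] \<or> h = v_word [2]" by auto
    then show ?case by blast
  next
    case (inv h)
    then have "inv\<^bsub>sym_group 18\<^esub> h = v_word [1] \<or> inv\<^bsub>sym_group 18\<^esub> h = v_word [2, 2, 2]"
      using sym18_inv by auto
    then show ?case by (metis rangeI)
  next
    case (eng h1 h2)
    then obtain u w where "h1 = v_word u" "h2 = v_word w" by blast
    then show ?case unfolding sym_group_mult by (metis v_word_append rangeI)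
  qed
  then show "carrier Valentiner \<subseteq> range v_word" by (auto simp: Valentiner_def)
qed

lemma Valentiner_permutes: "v \<in> carrier Valentiner \<Longrightarrow> v permutes {1..18}"
  using Valentiner_words v_word_permutes by auto

lemma val_proj_eq: "v \<in> carrier Valentiner \<Longrightarrow> covers v s \<Longrightarrow> val_proj v = s"
  using is_val_proj_covers[OF is_val_proj_val_proj] covers_unique by blast

lemma val_proj_covers: "v \<in> carrier Valentiner \<Longrightarrow> covers v (val_proj v)"
  using is_val_proj_covers[OF is_val_proj_val_proj] .

lemma Valentiner_inverse:
  assumes "v \<in> carrier Valentiner"
  shows "\<exists>w\<in>carrier Valentiner. v \<circ> w = id \<and> w \<circ> v = id"
  using V.inv_closed[OF assms] V.l_inv[OF assms] V.r_inv[OF assms]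
  by (auto simp: Valentiner_mult Valentiner_one)

text \<open>Stated through the action on blocks rather than \<open>val_proj\<close>, so that
  membership is verified without the definite description; \<open>kernel_eq\<close> identifies the
  two.\<close>

definition central_kernel :: "(nat \<Rightarrow> nat) set" where
  "central_kernel = {k \<in> carrier Valentiner. covers k id}"

lemma kernel_eq: "kernel Valentiner (alt_group 6) val_proj = central_kernel"
  using val_proj_eq val_proj_covers by (auto simp: kernel_def central_kernel_def alt_group_one) metis

lemma covers_comp_eq: "covers v s \<Longrightarrow> covers w t \<Longrightarrow> s \<circ> t = r \<Longrightarrow> covers (v \<circ> w) r"
  using covers_comp by blast

lemma hexacode_in: "S \<in> set hexacode \<Longrightarrow> x \<in> set S \<Longrightarrow> x \<in> {1..18}"
  using hexacode_blocks unfolding list_all_iff mems_iff ivl18 by auto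

lemma hexacode_word: "S \<in> set hexacode \<Longrightarrow> \<exists>S'\<in>set hexacode. set S' = v_word w ` set S"
proof (induction w)
  case Nil
  then show ?case unfolding v_word.simps by (intro bexI[of _ S]) simp_all
next
  case (Cons l w)
  then obtain S' where S': "S' \<in> set hexacode" "set S' = v_word w ` set S" by blast
  define f where "f = (if l = 1 then v1 else v2)"
  have "sort_key val_block (map v1 S') \<in> set hexacode" "sort_key val_block (map v2 S') \<in> set hexacode"
    using hexacode_v S'(1) unfolding list_all_iff by blast+
  then have "sort_key val_block (map f S') \<in> set hexacode" by (simp add: f_def)
  moreover have "set (sort_key val_block (map f S')) = v_word (l # w) ` set S"
    unfolding v_word.simps f_def[symmetric] set_sort list.set_map S'(2) image_comp ..
  ultimately show ?case by (rule bexI[rotated])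
qed

text \<open>A kernel element preserves blocks and permutes the words, so the image of
  \<open>S\<close> is a word on the same blocks. It shares \<open>p\<close> with \<open>S\<close>,
  hence equals \<open>S\<close> by disjointness; as \<open>S\<close> has one point in each of its
  blocks, every point of \<open>S\<close> is fixed.\<close>

lemma kernel_fixes_word:
  assumes k: "k \<in> central_kernel" "k p = p" and S: "S \<in> set hexacode" "p \<in> set S" "q \<in> set S"
  shows "k q = q"
proof -
  have cov: "val_block (k x) = val_block x" if "x \<in> set S" for x
    using k(1) hexacode_in[OF S(1) that] by (simp add: central_kernel_def covers_def)
  obtain w where "k = v_word w" using k(1) Valentiner_words by (auto simp: central_kernel_def)
  then obtain S' where S': "S' \<in> set hexacode" "set S' = k ` set S"
    using hexacode_word[OF S(1), of w] by blast
  have props: "sorted (map val_block T) \<and> distinct (map val_block T)" if "T \<in> set hexacode" for T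
    using hexacode_blocks that by (auto simp: list_all_iff)
  have "set (map val_block S') = set (map val_block S)"
    using S'(2) cov by (auto simp: image_image)
  then have eq: "map val_block S' = map val_block S"
    using props[OF S'(1)] props[OF S(1)] sorted_distinct_set_unique by blast
  have "S' = S \<or> set S' \<inter> set S = {}"
    by (rule all_apartD[OF hexacode_disjoint, of "map val_block S"])
       (use S'(1) S(1) eq in \<open>auto simp: image_iff\<close>)
  moreover have "p \<in> set S'" using S'(2) S(2) k(2) by force
  ultimately have "S' = S" using S(2) by blast
  then have "k q \<in> set S" using S'(2) S(3) by blast
  then show ?thesis
    using cov[OF S(3)] S(3) props[OF S(1)] by (auto simp: distinct_map dest: inj_onD)
qed

text \<open>The fixed point \<open>p\<close> of block 5 first forces all points outside this block
  to be fixed, and then the fixed point 2 does the same for block 5.\<close>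

lemma kernel_fixed_point:
  assumes k: "k \<in> central_kernel" "k p = p" and p: "p \<in> {1, 3, 5}" shows "k = id"
proof -
  have pairs: "\<exists>S\<in>set hexacode. p \<in> set S \<and> q \<in> set S"
    if "p \<in> {1, 3, 5}" "q \<in> {2, 4, 6, 7, 8, 9, 10, 11, 12, 13, 14, 15, 16, 17, 18}" for p q
    using that hexacode_pairs unfolding list_all_iff list_ex_iff mem_iff list.set by blast
  have out: "k q = q" if "q \<in> {2, 4, 6, 7, 8, 9, 10, 11, 12, 13, 14, 15, 16, 17, 18}" for q
    using pairs[OF p that] kernel_fixes_word[OF k] by blast
  have inn: "k q = q" if "q \<in> {1, 3, 5}" for q
    using pairs[OF that, of 2] kernel_fixes_word[OF k(1) out[of 2]] by blast
  show ?thesis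
  proof (rule permutes18_eqI)
    show "k permutes {1..18}" using k(1) Valentiner_permutes by (simp add: central_kernel_def)
    show "id permutes {1..18::nat}" by (rule permutes_id)
    show "list_all (\<lambda>p. k p = id p) [1, 2, 3, 4, 5, 6, 7, 8, 9, 10, 11, 12, 13, 14, 15, 16, 17, 18]"
      by (simp add: out inn)
  qed
qed

lemma kernel_135: "k \<in> central_kernel \<Longrightarrow> p \<in> {1, 3, 5} \<Longrightarrow> k p \<in> {1, 3, 5}"
proof -
  assume k: "k \<in> central_kernel" and p: "p \<in> {1, 3, 5}"
  have five: "list_all (\<lambda>x. val_block x = 5 \<longrightarrow> x = 1 \<or> x = 3 \<or> x = 5)
      [1, 2, 3, 4, 5, 6, 7, 8, 9, 10, 11, 12, 13, 14, 15, 16, 17, 18]"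
    by (simp add: block_eqs)
  have cov: "covers k id" and perm: "k permutes {1..18}"
    using k Valentiner_permutes by (auto simp: central_kernel_def)
  have p18: "p \<in> {1..18}" using p by auto
  have "val_block p = 5" using p by (auto simp: block_eqs)
  then have "val_block (k p) = 5" using cov p18 by (simp add: covers_def)
  moreover have "k p \<in> {1..18}" using p18 permutes_in_image[OF perm] by blast
  ultimately show "k p \<in> {1, 3, 5}" using five unfolding list_all_iff ivl18 list.set by blast
qed

lemma kernel_comp: "k \<in> central_kernel \<Longrightarrow> k' \<in> central_kernel \<Longrightarrow> k \<circ> k' \<in> central_kernel"
  by (auto simp: central_kernel_def comp_Valentiner intro: covers_comp_eq)

text \<open>The quotient \<open>w \<circ> k'\<close> fixes 1 and is therefore trivial. Since 1 can
  only go to 1, 3 or 5, the kernel has at most three elements.\<close>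

lemma kernel_eqI:
  assumes "k \<in> central_kernel" "k' \<in> central_kernel" "k 1 = k' 1" shows "k = k'"
proof -
  obtain w where w: "w \<in> carrier Valentiner" "k \<circ> w = id" "w \<circ> k = id"
    using Valentiner_inverse assms(1) by (auto simp: central_kernel_def)
  have "covers (w \<circ> k) (val_proj w \<circ> id)"
    by (rule covers_comp) (use val_proj_covers[OF w(1)] assms(1) in \<open>simp_all add: central_kernel_def\<close>)
  then have "val_proj w = id" using w(3) covers_unique[OF _ covers_id] by simp
  then have "w \<in> central_kernel" using val_proj_covers[OF w(1)] w(1) by (simp add: central_kernel_def)
  then have "w \<circ> k' \<in> central_kernel" using assms(2) by (rule kernel_comp)
  moreover have "(w \<circ> k') 1 = 1" using assms(3) w(3) by (metis comp_apply id_apply)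
  ultimately have "w \<circ> k' = id" using kernel_fixed_point[of "w \<circ> k'" 1] by blast
  then show ?thesis using w(2) by (metis comp_assoc comp_id id_comp)
qed

text \<open>\<open>v1\<close> fixes 1, 3 and 5, so conjugating \<open>k\<close> by it yields a
  kernel element with the same value at 1.\<close>

lemma kernel_commute_v1:
  assumes "k \<in> central_kernel" shows "k \<circ> v1 = v1 \<circ> k"
proof -
  have "s1 \<circ> s1 = id"
    using covers_comp[OF covers_v1 covers_v1] covers_unique[OF _ covers_id] v_relations(1) by metis
  then have "covers (v1 \<circ> (k \<circ> v1)) id"
    using assms covers_v1 by (auto simp: central_kernel_def intro!: covers_comp_eq)
  then have k': "v1 \<circ> (k \<circ> v1) \<in> central_kernel"
    using assms v1_Valentiner comp_Valentiner by (auto simp: central_kernel_def)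
  have v1_fix: "v1 p = p" if "p \<in> {1, 3, 5}" for p using that by (auto simp: v_eqs)
  have "(v1 \<circ> (k \<circ> v1)) 1 = k 1"
    using v1_fix kernel_135[OF assms, of 1] v1_fix[of 1] by simp
  then have "v1 \<circ> (k \<circ> v1) = k" using kernel_eqI[OF k' assms] by blast
  then show ?thesis using v_relations(1) by (metis comp_assoc id_comp)
qed

lemma kernel_commute_conj:
  assumes k: "k \<in> central_kernel" and ab: "a \<circ> b = id" "a \<in> carrier Valentiner" "b \<in> carrier Valentiner"
  shows "k \<circ> (a \<circ> v1 \<circ> b) = (a \<circ> v1 \<circ> b) \<circ> k"
proof -
  obtain b' where "b \<circ> b' = id" using Valentiner_inverse[OF ab(3)] by blast
  then have ba: "b \<circ> a = id" using ab(1) by (metis comp_assoc comp_id id_comp)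
  have "covers (b \<circ> a) (val_proj b \<circ> val_proj a)"
    using val_proj_covers ab by (intro covers_comp)
  then have "val_proj b \<circ> val_proj a = id" using ba covers_unique[OF _ covers_id] by simp
  then have "covers (b \<circ> (k \<circ> a)) id"
    using k val_proj_covers ab by (intro covers_comp_eq[of _ "val_proj b" _ "val_proj a"] covers_comp_eq[of k id])
       (auto simp: central_kernel_def)
  then have "b \<circ> (k \<circ> a) \<in> central_kernel"
    using k ab comp_Valentiner by (auto simp: central_kernel_def)
  from kernel_commute_v1[OF this] have h: "(b \<circ> k \<circ> a) \<circ> v1 = v1 \<circ> (b \<circ> k \<circ> a)"
    by (simp add: comp_assoc)
  have "k \<circ> (a \<circ> v1 \<circ> b) = a \<circ> ((b \<circ> k \<circ> a) \<circ> v1) \<circ> b"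
    using ab(1) by (metis comp_assoc id_comp)
  also have "\<dots> = (a \<circ> v1 \<circ> b) \<circ> k" unfolding h using ab(1) by (metis comp_assoc comp_id)
  finally show ?thesis .
qed

text \<open>\<open>v2\<close> moves block 5, so the argument for \<open>v1\<close> does not carry
  over. Instead \<open>v2\<close> is a product of two conjugates of \<open>v1\<close>, and
  \<open>k\<close> commutes with each because \<open>v1\<close> commutes with the correspondingly
  conjugated kernel element.\<close>

lemma kernel_commute_v2:
  assumes k: "k \<in> central_kernel" shows "k \<circ> v2 = v2 \<circ> k"
proof -
  \<comment> \<open>Here \<open>b\<close> and \<open>d\<close> are the inverses of \<open>a\<close>
    and \<open>c\<close>, and the conjugates \<open>a \<circ> v1 \<circ> b\<close> and
    \<open>c \<circ> v1 \<circ> d\<close> multiply to \<open>v2\<close>.\<close>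
  define a b c d where "a = v_word [1, 2, 2, 2, 2, 2, 2, 1, 2, 2, 2, 1, 2, 2, 2]"
    and "b = v_word [2, 1, 2, 1, 2, 2, 1]"
    and "c = v_word [1, 2, 2, 2, 2, 2, 2, 2, 2, 2, 1, 2, 2, 2, 1, 2, 2, 2]"
    and "d = v_word [2, 1, 2, 1, 2, 2, 2, 1]"
  have perm: "a permutes {1..18}" "b permutes {1..18}" "c permutes {1..18}" "d permutes {1..18}"
    by (simp_all add: a_def b_def c_def d_def v_word_permutes del: v_word.simps)
  have "a \<circ> b = id" "c \<circ> d = id"
    by (rule permutes18_eqI[OF permutes_compose permutes_id],
        simp_all add: perm, simp add: a_def b_def c_def d_def v_eqs)+
  moreover have "a \<in> carrier Valentiner" "b \<in> carrier Valentiner" "c \<in> carrier Valentiner" "d \<in> carrier Valentiner"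
    by (simp_all add: a_def b_def c_def d_def Valentiner_words del: v_word.simps)
  ultimately have "k \<circ> (a \<circ> v1 \<circ> b) = (a \<circ> v1 \<circ> b) \<circ> k" "k \<circ> (c \<circ> v1 \<circ> d) = (c \<circ> v1 \<circ> d) \<circ> k"
    using kernel_commute_conj[OF k] by blast+
  then have "k \<circ> ((a \<circ> v1 \<circ> b) \<circ> (c \<circ> v1 \<circ> d)) = ((a \<circ> v1 \<circ> b) \<circ> (c \<circ> v1 \<circ> d)) \<circ> k"
    by (metis comp_assoc)
  moreover have "(a \<circ> v1 \<circ> b) \<circ> (c \<circ> v1 \<circ> d) = v2"
    by (rule permutes18_eqI[OF _ v2_permutes], intro permutes_compose perm v1_permutes)
       (simp add: a_def b_def c_def d_def v_eqs)
  ultimately show ?thesis by simp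
qed

lemma kernel_central:
  assumes k: "k \<in> central_kernel" and "v \<in> carrier Valentiner" shows "k \<circ> v = v \<circ> k"
proof -
  have "k \<circ> v_word w = v_word w \<circ> k" for w
  proof (induction w)
    case (Cons l w)
    have "k \<circ> (if l = 1 then v1 else v2) = (if l = 1 then v1 else v2) \<circ> k"
      using kernel_commute_v1[OF k] kernel_commute_v2[OF k] by simp
    then show ?case using Cons by (metis comp_assoc v_word.simps(2))
  qed simp
  then show ?thesis using assms(2) Valentiner_words by auto
qed

section \<open>Lifts and the lifting invariant\<close>

definition is_lift :: "(nat \<Rightarrow> nat) \<Rightarrow> (nat \<Rightarrow> nat) \<Rightarrow> bool" where
  "is_lift x w \<longleftrightarrow> w \<in> carrier Valentiner \<and> covers w x \<and> w \<circ> w = id \<and> w \<noteq> id"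

lemma ord_2_iff:
  assumes "w \<in> carrier Valentiner"
  shows "group.ord Valentiner w = 2 \<longleftrightarrow> w \<circ> w = id \<and> w \<noteq> id"
proof
  assume o2: "group.ord Valentiner w = 2"
  then have "w [^]\<^bsub>Valentiner\<^esub> (2::nat) = \<one>\<^bsub>Valentiner\<^esub>" using V.pow_ord_eq_1[OF assms] by simp
  moreover have "w \<noteq> \<one>\<^bsub>Valentiner\<^esub>" using V.ord_eq_1[OF assms] o2 by auto
  ultimately show "w \<circ> w = id \<and> w \<noteq> id"
    using assms by (simp add: numeral_2_eq_2 Valentiner_mult Valentiner_one)
next
  assume w: "w \<circ> w = id \<and> w \<noteq> id"
  then have "w [^]\<^bsub>Valentiner\<^esub> (2::nat) = \<one>\<^bsub>Valentiner\<^esub>"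
    using assms by (simp add: numeral_2_eq_2 Valentiner_mult Valentiner_one)
  then have d: "V.ord w dvd 2" using V.pow_eq_id[OF assms] by blast
  have "V.ord w \<noteq> 1" using V.ord_eq_1[OF assms] w by (auto simp: Valentiner_one)
  moreover have "V.ord w \<noteq> 0" using d by (intro notI) simp
  moreover have "V.ord w \<le> 2" using d by (rule dvd_imp_le) simp
  ultimately show "V.ord w = 2" by linarith
qed

text \<open>An involution of the three points 1, 3, 5 fixes one of them, and a kernel element with
  such a fixed point is trivial.\<close>

lemma kernel_involution:
  assumes k: "k \<in> central_kernel" "k \<circ> k = id" shows "k = id"
proof -
  have kk: "k (k p) = p" for p using k(2) by (metis comp_apply id_apply)
  have inj: "inj k" using kk by (metis injI)
  have "k 1 \<in> {1, 3, 5}" "k 3 \<in> {1, 3, 5}" "k 5 \<in> {1, 3, 5}" using kernel_135[OF k(1)] by blast+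
  then have "k 1 = 1 \<or> k 3 = 3 \<or> k 5 = 5"
    using kk[of 1] kk[of 3] kk[of 5] by auto
  then show ?thesis using kernel_fixed_point[OF k(1)] by blast
qed

text \<open>Two lifts differ by the kernel element \<open>w \<circ> w'\<close>. Centrality makes its
  square trivial, and the kernel contains no involution.\<close>

lemma is_lift_unique:
  assumes "is_lift x w" "is_lift x w'" shows "w = w'"
proof -
  have w: "w \<in> carrier Valentiner" "w' \<in> carrier Valentiner" "w \<circ> w = id" "w' \<circ> w' = id"
    using assms by (auto simp: is_lift_def)
  have c: "covers w x" "covers w' x" using assms by (auto simp: is_lift_def)
  have "x \<circ> x = id" using covers_comp[OF c(1) c(1)] covers_unique[OF _ covers_id] w(3) by metis
  then have "w \<circ> w' \<in> central_kernel"
    using w c comp_Valentiner covers_comp by (auto simp: central_kernel_def intro: covers_comp_eq)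
  note k = this
  have "(w \<circ> w') \<circ> (w \<circ> w') = ((w \<circ> w') \<circ> w) \<circ> w'" by (simp only: comp_assoc)
  also have "\<dots> = (w \<circ> (w \<circ> w')) \<circ> w'" by (simp only: kernel_central[OF k w(1)])
  also have "\<dots> = id" using w by (metis comp_assoc comp_id)
  finally have "w \<circ> w' = id" using kernel_involution[OF k] by blast
  then show ?thesis using w(4) by (metis comp_assoc comp_id id_comp)
qed

lemma inv_lift_eq: "is_lift x w \<Longrightarrow> inv_lift x = w"
  unfolding inv_lift_def
proof (rule the_equality)
  assume w: "is_lift x w"
  then show "w \<in> carrier Valentiner \<and> val_proj w = x \<and> group.ord Valentiner w = 2"
    by (auto simp: is_lift_def ord_2_iff val_proj_eq)
  fix u assume "u \<in> carrier Valentiner \<and> val_proj u = x \<and> group.ord Valentiner u = 2"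
  then have "is_lift x u" using val_proj_covers[of u] by (auto simp: is_lift_def ord_2_iff)
  then show "u = w" using is_lift_unique w by blast
qed

lemma is_lift_word:
  assumes "i < 45" "list_all (\<lambda>p. s_word w p = enc i p) [1, 2, 3, 4, 5, 6]"
    "list_all (\<lambda>p. v_word (w @ w) p = p) [1, 2, 3, 4, 5, 6, 7, 8, 9, 10, 11, 12, 13, 14, 15, 16, 17, 18]"
  shows "is_lift (enc i) (v_word w)"
proof -
  have e: "s_word w = enc i" by (rule permutes6_eqI[OF s_word_permutes enc_permutes assms(2)]) (rule assms(1))
  then have c: "covers (v_word w) (enc i)" using covers_word by metis
  have "v_word (w @ w) = id"
    by (rule permutes18_eqI[OF v_word_permutes permutes_id]) (use assms(3) in simp)
  then have "v_word w \<circ> v_word w = id" by (simp only: v_word_append)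
  moreover have "v_word w \<noteq> id"
  proof
    assume "v_word w = id"
    then have "enc i = id" using c covers_unique[OF _ covers_id] by metis
    \<comment> \<open>Every involution of the class fixes only two points, so it moves one of 1, 2,
      3.\<close>
    moreover have "list_all (\<lambda>i. \<not> (enc i 1 = 1 \<and> enc i 2 = 2 \<and> enc i 3 = 3)) [0..<45]"
      unfolding idx45 by (simp add: enc_eqs)
    ultimately show False using assms(1) less45E by fastforce
  qed
  ultimately show ?thesis using c Valentiner_words by (auto simp: is_lift_def)
qed

lemma is_lift_cj:
  assumes "is_lift (enc x) v" "is_lift (enc y) w" "x < 45" "y < 45"
  shows "is_lift (enc (cj x y)) (w \<circ> v \<circ> w)"
proof -
  have h: "v \<in> carrier Valentiner" "w \<in> carrier Valentiner" "v \<circ> v = id" "w \<circ> w = id" "v \<noteq> id"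
    "covers v (enc x)" "covers w (enc y)"
    using assms(1,2) by (auto simp: is_lift_def)
  have "covers (w \<circ> v \<circ> w) (enc (cj x y))"
    unfolding enc_cj[OF assms(3,4)] using h by (intro covers_comp)
  moreover have "(w \<circ> v \<circ> w) \<circ> (w \<circ> v \<circ> w) = id" using h by (metis comp_assoc comp_id)
  moreover have "w \<circ> v \<circ> w \<noteq> id"
  proof
    assume "w \<circ> v \<circ> w = id"
    then have "w \<circ> (w \<circ> v \<circ> w) \<circ> w = w \<circ> w" by simp
    then show False using h by (metis comp_assoc comp_id id_comp)
  qed
  ultimately show ?thesis using h by (auto simp: is_lift_def intro!: comp_Valentiner)
qed

text \<open>The lifts over 0, 1, 8 yield all others by conjugation; the remaining indices are the
  other entries of the two 5-tuples whose invariants are the nontrivial kernel elements.\<close>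

definition lift_words :: "(nat \<times> nat list) list" where
  "lift_words = [(0, [1]), (1, [2, 2, 1, 2, 2, 2, 1, 2, 2, 2, 1, 2, 1, 2, 1, 2, 2]),
     (8, [2, 1, 2, 1, 2, 2, 2, 1, 2, 2, 2]), (9, [2, 2, 1, 2, 2]), (40, [1, 2, 2, 2, 1, 2, 2, 1, 2, 1]),
     (24, [2, 1, 2, 1, 2, 1, 2, 2, 2, 1, 2, 1, 2, 2, 1, 2, 2, 2]),
     (30, [1, 2, 2, 2, 1, 2, 2, 2, 1, 2, 1, 2, 1]), (28, [1, 2, 1, 2, 1, 2, 2, 2, 1, 2, 1, 2, 2, 1])]"

lemma lift_words_check:
  "list_all (\<lambda>(i, w). i < 45 \<and> list_all (\<lambda>p. s_word w p = enc i p) [1, 2, 3, 4, 5, 6] \<and>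
     list_all (\<lambda>p. v_word (w @ w) p = p) [1, 2, 3, 4, 5, 6, 7, 8, 9, 10, 11, 12, 13, 14, 15, 16, 17, 18])
     lift_words"
  by (simp add: lift_words_def enc_eqs v_eqs s_eqs)

lemma lift_words: "(i, w) \<in> set lift_words \<Longrightarrow> is_lift (enc i) (v_word w)"
  using lift_words_check is_lift_word unfolding list_all_iff by blast

text \<open>The liftable indices form a subrack by \<open>is_lift_cj\<close>, and it contains the
  generating indices 0, 1, 8.\<close>

lemma is_lift_ex: "i < 45 \<Longrightarrow> \<exists>w. is_lift (enc i) w"
proof -
  define X where "X = {i. i < 45 \<and> (\<exists>w. is_lift (enc i) w)}"
  have "closed_rack X" using is_lift_cj by (fastforce simp: closed_rack_def X_def cj_lt)
  moreover have "set [0, 1, 8] \<subseteq> X"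
  proof -
    have "\<exists>w. is_lift (enc i) w" if "\<exists>w. (i, w) \<in> set lift_words" for i using lift_words that by blast
    then have "\<exists>w. is_lift (enc 0) w" "\<exists>w. is_lift (enc 1) w" "\<exists>w. is_lift (enc 8) w"
      by (simp_all add: lift_words_def)
    then show ?thesis by (simp add: X_def)
  qed
  ultimately have "X = {..<45}" using gen_018 by (simp only: gen_def)
  then show "i < 45 \<Longrightarrow> \<exists>w. is_lift (enc i) w" by (auto simp: X_def)
qed

definition hat :: "nat \<Rightarrow> nat \<Rightarrow> nat" where
  "hat i = inv_lift (enc i)"

lemma hat_lift: "i < 45 \<Longrightarrow> is_lift (enc i) (hat i)"
  unfolding hat_def using is_lift_ex inv_lift_eq by metis

lemma hat_props:
  assumes "i < 45"
  shows "hat i \<in> carrier Valentiner" "covers (hat i) (enc i)" "hat i \<circ> hat i = id"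
  using hat_lift[OF assms] by (auto simp: is_lift_def)

lemma hat_eq: "is_lift (enc i) w \<Longrightarrow> hat i = w"
  unfolding hat_def by (rule inv_lift_eq)

lemma hat_cj: "x < 45 \<Longrightarrow> y < 45 \<Longrightarrow> hat (cj x y) = hat y \<circ> hat x \<circ> hat y"
  by (intro hat_eq is_lift_cj hat_lift)

text \<open>By uniqueness of lifts, commuting involutions have commuting lifts. Their product is
  then an involution over \<open>enc z\<close>, hence the lift of \<open>enc z\<close>.\<close>

lemma hat_commuting:
  assumes "x < 45" "y < 45" "z < 45" "cj x y = x" "enc x \<circ> enc y = enc z"
  shows "hat x \<circ> hat y = hat z"
proof -
  have "hat y \<circ> hat x \<circ> hat y = hat x" using hat_cj[OF assms(1,2)] assms(4) by simp
  then have "(hat x \<circ> hat y) \<circ> (hat x \<circ> hat y) = id"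
    using hat_props(3)[OF assms(1)] by (metis comp_assoc)
  moreover have c: "covers (hat x \<circ> hat y) (enc z)"
    using hat_props assms by (metis covers_comp)
  moreover have "hat x \<circ> hat y \<noteq> id"
  proof
    assume "hat x \<circ> hat y = id"
    then have "enc z = id" using c covers_unique[OF _ covers_id] by simp
    then have "hat z \<in> central_kernel" using hat_props[OF assms(3)] by (simp add: central_kernel_def)
    then show False
      using kernel_involution hat_lift[OF assms(3)] unfolding is_lift_def by blast
  qed
  ultimately have "is_lift (enc z) (hat x \<circ> hat y)"
    using hat_props(1) assms by (auto simp: is_lift_def intro: comp_Valentiner)
  then show ?thesis using hat_eq by simp
qed

section \<open>Products of lifts and their invariance\<close>

definition lift_prod :: "nat list \<Rightarrow> nat \<Rightarrow> nat" where
  "lift_prod t = foldr (\<circ>) (map hat t) id"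

definition perm_prod :: "nat list \<Rightarrow> nat \<Rightarrow> nat" where
  "perm_prod t = foldr (\<circ>) (map enc t) id"

lemma lift_prod_simps: "lift_prod [] = id" "lift_prod (x # t) = hat x \<circ> lift_prod t"
  by (simp_all add: lift_prod_def)

lemma perm_prod_simps: "perm_prod [] = id" "perm_prod (x # t) = enc x \<circ> perm_prod t"
  by (simp_all add: perm_prod_def)

lemma lifting_invariant_enc: "lifting_invariant (map enc t) = lift_prod t"
  by (simp add: lifting_invariant_def tuple_prod_def Valentiner_mult Valentiner_one lift_prod_def hat_def[abs_def] comp_def)

lemma lift_prod_covers: "tup t \<Longrightarrow> lift_prod t \<in> carrier Valentiner \<and> covers (lift_prod t) (perm_prod t)"
proof (induction t)
  case Nil
  show ?case unfolding lift_prod_simps perm_prod_simps using id_Valentiner covers_id by blast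
next
  case (Cons x t)
  then show ?case unfolding lift_prod_simps perm_prod_simps
    by (intro conjI comp_Valentiner covers_comp hat_props) simp_all
qed

lemma perm_prod_iff_kernel:
  assumes "tup t" shows "perm_prod t = id \<longleftrightarrow> lift_prod t \<in> central_kernel"
proof
  assume "perm_prod t = id"
  then show "lift_prod t \<in> central_kernel" using lift_prod_covers[OF assms] by (simp add: central_kernel_def)
next
  assume "lift_prod t \<in> central_kernel"
  then have "covers (lift_prod t) id" by (simp add: central_kernel_def)
  with lift_prod_covers[OF assms, THEN conjunct2] show "perm_prod t = id" by (rule covers_unique)
qed

lemma lift_prod_bm: "tup t \<Longrightarrow> lift_prod (bm i t) = lift_prod t"
proof (induction i t rule: bm.induct)
  case (1 x y t)
  have "hat y \<circ> hat (cj x y) = hat x \<circ> hat y"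
    using hat_cj[of x y] hat_props(3)[of y] 1 by (simp add: comp_assoc[symmetric])
  then show ?case unfolding bm.simps lift_prod_simps comp_assoc[symmetric] by simp
qed (simp_all add: lift_prod_simps)

lemma lift_prod_bi: "tup t \<Longrightarrow> lift_prod (bi i t) = lift_prod t"
  using lift_prod_bm[OF tup_bi, of t i i] by (simp add: bm_bi)

lemma lift_prod_cj: "tup t \<Longrightarrow> c < 45 \<Longrightarrow> lift_prod (map (\<lambda>x. cj x c) t) = hat c \<circ> lift_prod t \<circ> hat c"
proof (induction t)
  case Nil
  show ?case unfolding list.map lift_prod_simps comp_id hat_props(3)[OF Nil(2)] ..
next
  case (Cons x t)
  have xc: "x < 45" "c < 45" and t: "tup t" using Cons.prems by simp_all
  note ih = Cons.IH[OF t xc(2)]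
  have "lift_prod (map (\<lambda>x. cj x c) (x # t)) = (hat c \<circ> hat x \<circ> hat c) \<circ> (hat c \<circ> lift_prod t \<circ> hat c)"
    unfolding list.map lift_prod_simps ih hat_cj[OF xc] ..
  also have "\<dots> = hat c \<circ> hat x \<circ> (hat c \<circ> hat c) \<circ> lift_prod t \<circ> hat c" by (simp only: comp_assoc)
  also have "\<dots> = hat c \<circ> lift_prod (x # t) \<circ> hat c"
    by (simp only: hat_props(3)[OF xc(2)] lift_prod_simps comp_assoc id_comp)
  finally show ?case .
qed

text \<open>Inner automorphisms conjugate the product of lifts, which is central as soon as the
  product in A_6 is trivial.\<close>

lemma lift_prod_seq: "seq t u \<Longrightarrow> perm_prod t = id \<Longrightarrow> lift_prod u = lift_prod t"
proof (induction rule: heq.induct)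
  case (heq_bm t u i)
  then show ?case using lift_prod_bm I.heq_tup by metis
next
  case (heq_bi t u i)
  then show ?case using lift_prod_bi I.heq_tup by metis
next
  case (heq_map t u f)
  then have tu: "tup t" "tup u" "lift_prod u = lift_prod t" using I.heq_tup by auto
  obtain c where c: "c < 45" "f = (\<lambda>x. cj x c)" using heq_map.hyps(2) by (auto simp: inners_def)
  have "lift_prod u \<in> central_kernel"
    unfolding tu(3) using perm_prod_iff_kernel[OF tu(1)] heq_map.prems by blast
  note k = kernel_central[OF this hat_props(1)[OF c(1)]]
  have "lift_prod (map f u) = lift_prod u \<circ> (hat c \<circ> hat c)"
    unfolding c(2) lift_prod_cj[OF tu(2) c(1)] k[symmetric] by (simp only: comp_assoc)
  then show ?case unfolding hat_props(3)[OF c(1)] comp_id tu(3) .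
qed simp

lemma perm_prod_seq: "seq t u \<Longrightarrow> perm_prod t = id \<Longrightarrow> perm_prod u = id"
  using lift_prod_seq perm_prod_iff_kernel I.heq_tup by metis

lemma lift_prod_pair: "a < 45 \<Longrightarrow> lift_prod (a # a # T) = lift_prod T"
  unfolding lift_prod_simps comp_assoc[symmetric] by (simp add: hat_props(3))

text \<open>Successive conjugation by the entries is conjugation by their product; this links
  \<open>product_one\<close> with \<open>perm_prod\<close>.\<close>

lemma perm_prod_foldl: "tup t \<Longrightarrow> b < 45 \<Longrightarrow> perm_prod t \<circ> enc (foldl cj b t) = enc b \<circ> perm_prod t"
proof (induction t arbitrary: b)
  case (Cons x t)
  then have xb: "x < 45" "b < 45" "tup t" by auto
  have "perm_prod (x # t) \<circ> enc (foldl cj b (x # t)) = enc x \<circ> (perm_prod t \<circ> enc (foldl cj (cj b x) t))"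
    by (simp only: perm_prod_simps comp_assoc foldl_Cons)
  also have "\<dots> = enc x \<circ> (enc (cj b x) \<circ> perm_prod t)"
    unfolding Cons.IH[OF xb(3) cj_lt[OF xb(2,1)]] ..
  also have "\<dots> = (enc x \<circ> enc x) \<circ> enc b \<circ> enc x \<circ> perm_prod t"
    by (simp only: enc_cj[OF xb(2,1)] comp_assoc)
  also have "\<dots> = enc b \<circ> perm_prod (x # t)"
    by (simp only: enc_enc[OF xb(1)] perm_prod_simps comp_assoc id_comp)
  finally show ?case .
qed (simp add: perm_prod_simps)

lemma product_oneI: "tup t \<Longrightarrow> perm_prod t = id \<Longrightarrow> product_one t"
  unfolding product_one_def using perm_prod_foldl[of t] cj_eqI foldl_cj_lt by (metis comp_id id_comp)

section \<open>Classification by the lifting invariant\<close>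

lemma hat_words:
  "hat 0 = v_word [1]" "hat 1 = v_word [2, 2, 1, 2, 2, 2, 1, 2, 2, 2, 1, 2, 1, 2, 1, 2, 2]"
  "hat 8 = v_word [2, 1, 2, 1, 2, 2, 2, 1, 2, 2, 2]" "hat 9 = v_word [2, 2, 1, 2, 2]"
  "hat 40 = v_word [1, 2, 2, 2, 1, 2, 2, 1, 2, 1]"
  "hat 24 = v_word [2, 1, 2, 1, 2, 1, 2, 2, 2, 1, 2, 1, 2, 2, 1, 2, 2, 2]"
  "hat 30 = v_word [1, 2, 2, 2, 1, 2, 2, 2, 1, 2, 1, 2, 1]"
  "hat 28 = v_word [1, 2, 1, 2, 1, 2, 2, 2, 1, 2, 1, 2, 2, 1]"
  by (rule hat_eq[OF lift_words], simp add: lift_words_def)+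

lemma lift_prod_rep5_values:
  "lift_prod [0, 1, 8, 9, 40] 1 = 3" "lift_prod [0, 1, 24, 30, 28] 1 = 5"
  unfolding lift_prod_simps hat_words by (simp_all add: v_eqs)

lemma perm_prod_eq_id:
  assumes "tup t" "list_all (\<lambda>p. foldr enc t p = p) [1, 2, 3, 4, 5, 6]"
  shows "perm_prod t = id"
proof (rule permutes6_eqI)
  show "perm_prod t permutes {1..6}"
    using assms(1)
  proof (induction t)
    case Nil
    show ?case unfolding perm_prod_simps by (rule permutes_id)
  next
    case (Cons x t)
    then show ?case unfolding perm_prod_simps by (intro permutes_compose enc_permutes) simp_all
  qed
  show "id permutes {1..6::nat}" by (rule permutes_id)
  have "perm_prod t p = foldr enc t p" for p by (induction t) (simp_all add: perm_prod_simps)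
  then show "list_all (\<lambda>p. perm_prod t p = id p) [1, 2, 3, 4, 5, 6]" using assms(2) by simp
qed

lemma perm_prod_rep5: "perm_prod [0, 1, 8, 9, 40] = id" "perm_prod [0, 1, 24, 30, 28] = id"
  by (rule perm_prod_eq_id; simp add: enc_eqs)+

lemma lift_prod_rep5_kernel: "lift_prod [0, 1, 8, 9, 40] \<in> central_kernel" "lift_prod [0, 1, 24, 30, 28] \<in> central_kernel"
  using perm_prod_rep5 perm_prod_iff_kernel[of "[0, 1, 8, 9, 40]"] perm_prod_iff_kernel[of "[0, 1, 24, 30, 28]"] by simp_all

lemma id_kernel: "id \<in> central_kernel"
  using id_Valentiner covers_id by (simp only: central_kernel_def mem_Collect_eq simp_thms)

text \<open>A kernel element is determined by the image of 1, and the possible images 1, 3, 5 are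
  attained by the identity and the invariants of the two 5-tuples.\<close>

lemma central_kernel_elems: "central_kernel = {id, lift_prod [0, 1, 8, 9, 40], lift_prod [0, 1, 24, 30, 28]}"
proof
  show "central_kernel \<subseteq> {id, lift_prod [0, 1, 8, 9, 40], lift_prod [0, 1, 24, 30, 28]}"
  proof
    fix k assume k: "k \<in> central_kernel"
    then have "k 1 = id 1 \<or> k 1 = lift_prod [0, 1, 8, 9, 40] 1 \<or> k 1 = lift_prod [0, 1, 24, 30, 28] 1"
      using kernel_135[of k 1] unfolding lift_prod_rep5_values id_apply by blast
    then show "k \<in> {id, lift_prod [0, 1, 8, 9, 40], lift_prod [0, 1, 24, 30, 28]}"
      using kernel_eqI[OF k] id_kernel lift_prod_rep5_kernel by blast
  qed
  show "{id, lift_prod [0, 1, 8, 9, 40], lift_prod [0, 1, 24, 30, 28]} \<subseteq> central_kernel"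
    using id_kernel lift_prod_rep5_kernel by blast
qed

lemma lift_prod_rep5_distinct:
  "lift_prod [0, 1, 8, 9, 40] \<noteq> id" "lift_prod [0, 1, 24, 30, 28] \<noteq> id"
  "lift_prod [0, 1, 8, 9, 40] \<noteq> lift_prod [0, 1, 24, 30, 28]"
  using lift_prod_rep5_values by force+

lemma enc_prod:
  assumes "x < 45" "y < 45" "z < 45" "list_all (\<lambda>p. enc x (enc y p) = enc z p) [1, 2, 3, 4, 5, 6]"
  shows "enc x \<circ> enc y = enc z"
  by (rule permutes6_eqI) (use assms in \<open>auto intro: permutes_compose enc_permutes\<close>)

text \<open>Splitting 40 and 28 into commuting factors turns the 5-tuples into the 6-tuples without
  changing the invariant; the last equation shows that the four-group entries 0, 5, 42 contribute
  nothing to the invariant of the 7-tuple.\<close>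

lemma hat_split: "hat 14 \<circ> hat 15 = hat 40" "hat 25 \<circ> hat 33 = hat 28" "hat 0 \<circ> hat 5 = hat 42"
  by (rule hat_commuting[OF _ _ _ _ enc_prod]; simp add: cj_eqs enc_eqs)+

lemma lift_prod_reps:
  "lift_prod [0, 1, 8, 9, 14, 15] = lift_prod [0, 1, 8, 9, 40]"
  "lift_prod [0, 1, 24, 30, 25, 33] = lift_prod [0, 1, 24, 30, 28]"
  "lift_prod [0, 0, 1, 1, 8, 8] = id" "lift_prod [0, 5, 42, 1, 1, 8, 8] = id"
proof -
  have split: "hat x \<circ> (hat y \<circ> f) = (hat x \<circ> hat y) \<circ> f" for x y f by (simp only: comp_assoc)
  have hh: "hat x \<circ> (hat x \<circ> f) = f" if "x < 45" for x f
    unfolding split hat_props(3)[OF that] by (rule id_comp)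
  show "lift_prod [0, 1, 8, 9, 14, 15] = lift_prod [0, 1, 8, 9, 40]"
    unfolding lift_prod_simps split[of 14] hat_split ..
  show "lift_prod [0, 1, 24, 30, 25, 33] = lift_prod [0, 1, 24, 30, 28]"
    unfolding lift_prod_simps split[of 25] hat_split ..
  have "0 < (45::nat)" "1 < (45::nat)" "8 < (45::nat)" "42 < (45::nat)" by simp_all
  note h = this[THEN hh]
  show "lift_prod [0, 0, 1, 1, 8, 8] = id" unfolding lift_prod_simps h ..
  show "lift_prod [0, 5, 42, 1, 1, 8, 8] = id" unfolding lift_prod_simps split[of 0 5] hat_split h ..
qed

text \<open>The index form of the Nielsen conditions, see \<open>nielsen_eq\<close>.\<close>

definition admissible :: "nat list \<Rightarrow> bool" where
  "admissible t \<longleftrightarrow> tup t \<and> gen t \<and> perm_prod t = id"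

lemma admissible_seq: "admissible t \<Longrightarrow> seq t u \<Longrightarrow> admissible u \<and> lift_prod u = lift_prod t \<and> length u = length t"
  unfolding admissible_def using I.heq_tup gen_weq[OF seq_weq] perm_prod_seq lift_prod_seq heq_length by blast

lemma admissible_lam: "admissible t \<Longrightarrow> lift_prod t \<in> central_kernel"
  unfolding admissible_def using perm_prod_iff_kernel by metis

lemma admissibleI: "tup t \<Longrightarrow> gen t \<Longrightarrow> lift_prod t \<in> central_kernel \<Longrightarrow> admissible t"
  unfolding admissible_def using perm_prod_iff_kernel by metis

lemma admissible_reps:
  "admissible [0, 1, 8, 9, 40]" "admissible [0, 1, 24, 30, 28]" "admissible [0, 0, 1, 1, 8, 8]"
  "admissible [0, 1, 8, 9, 14, 15]" "admissible [0, 1, 24, 30, 25, 33]" "admissible [0, 5, 42, 1, 1, 8, 8]"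
proof -
  have g: "gen [0, 1, 8, 9, 40]" "gen [0, 1, 8, 9, 14, 15]"
    using gen_018 by (rule gen_mono, simp)+
  have "gen (map alpha [0, 1, 8, 9, 40])" "gen (map alpha [0, 1, 8, 9, 14, 15])"
    by (rule gen_map1[OF rack_aut_alpha _ g(1)], simp, rule gen_map1[OF rack_aut_alpha _ g(2)], simp)
  then have g': "gen [0, 1, 24, 30, 28]" "gen [0, 1, 24, 30, 25, 33]"
    by (simp_all add: alpha_eqs)
  have g3: "gen [0, 0, 1, 1, 8, 8]" "gen [0, 5, 42, 1, 1, 8, 8]"
    using gen_018 by (rule gen_mono, simp)+
  have tup: "tup [0, 1, 8, 9, 40]" "tup [0, 1, 24, 30, 28]" "tup [0, 0, 1, 1, 8, 8]"
    "tup [0, 1, 8, 9, 14, 15]" "tup [0, 1, 24, 30, 25, 33]" "tup [0, 5, 42, 1, 1, 8, 8]" by simp_all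
  show "admissible [0, 1, 8, 9, 40]" "admissible [0, 1, 24, 30, 28]" "admissible [0, 0, 1, 1, 8, 8]"
    "admissible [0, 1, 8, 9, 14, 15]" "admissible [0, 1, 24, 30, 25, 33]" "admissible [0, 5, 42, 1, 1, 8, 8]"
    using admissibleI g g' g3 lift_prod_reps id_kernel lift_prod_rep5_kernel tup by metis+
qed

lemma admissible5:
  assumes "admissible t" "length t = 5"
  shows "lift_prod t = lift_prod [0, 1, 8, 9, 40] \<and> seq t [0, 1, 8, 9, 40] \<or>
    lift_prod t = lift_prod [0, 1, 24, 30, 28] \<and> seq t [0, 1, 24, 30, 28]"
  using product5[of t] assms product_oneI admissible_seq[OF assms(1)] unfolding admissible_def by metis

lemma admissible6:
  assumes "admissible t" "length t = 6"
  shows "lift_prod t = id \<and> seq t [0, 0, 1, 1, 8, 8] \<or>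
    lift_prod t = lift_prod [0, 1, 8, 9, 40] \<and> seq t [0, 1, 8, 9, 14, 15] \<or>
    lift_prod t = lift_prod [0, 1, 24, 30, 28] \<and> seq t [0, 1, 24, 30, 25, 33]"
  using product6[of t] assms product_oneI admissible_seq[OF assms(1)] lift_prod_reps unfolding admissible_def by metis

lemma admissible5_normal:
  assumes "admissible t" "length t = 5"
  shows "seq t (if lift_prod t = lift_prod [0, 1, 8, 9, 40] then [0, 1, 8, 9, 40] else [0, 1, 24, 30, 28])"
  using admissible5[OF assms] lift_prod_rep5_distinct(3) by presburger

lemma admissible6_normal:
  assumes "admissible t" "length t = 6"
  shows "seq t (if lift_prod t = id then [0, 0, 1, 1, 8, 8]
    else if lift_prod t = lift_prod [0, 1, 8, 9, 40] then [0, 1, 8, 9, 14, 15] else [0, 1, 24, 30, 25, 33])"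
  using admissible6[OF assms] lift_prod_rep5_distinct by presburger

lemma admissible_split:
  assumes "admissible t" "split_pair t"
  shows "\<exists>a T. seq t (a # a # T) \<and> a < 45 \<and> admissible T \<and> lift_prod T = lift_prod t \<and> length t = length T + 2"
proof -
  obtain a T where T: "gen T" "seq t (a # a # T)" using assms(2) by (auto simp: split_pair_def)
  have a: "a < 45" "tup T" using I.heq_tup[OF T(2)] by auto
  note c = admissible_seq[OF assms(1) T(2)]
  have "lift_prod T = lift_prod t" using c lift_prod_pair[OF a(1)] by metis
  moreover have "length t = length T + 2" using c by simp
  moreover have "admissible T" using admissibleI[OF a(2) T(1)] admissible_lam[OF assms(1)] \<open>lift_prod T = lift_prod t\<close> by metis
  ultimately show ?thesis using T(2) a(1) by blast
qed

text \<open>Carrying \<open>T\<close> to \<open>U\<close> may disturb the doubled entry in front,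
  but by \<open>pair_all\<close> it can then be exchanged for any other.\<close>

lemma seq_pair:
  assumes "seq T U" "a < 45" "b < 45" "gen T"
  shows "seq (a # a # T) (b # b # U)"
proof -
  have tup: "tup T" "tup U" using I.heq_tup[OF assms(1)] by auto
  obtain f where f: "\<forall>x<45. f x < 45" "seq ([a, a] @ T @ []) (map f [a, a] @ U @ map f [])"
    using I.heq_context[OF assms(1), of "[a, a]" "[]"] assms(2) by auto
  have "gen U" using gen_weq[OF seq_weq[OF assms(1)]] assms(4) by simp
  then have "seq (f a # f a # U) (b # b # U)" using I.pair_all tup f(1) assms(2,3) by simp
  moreover have "seq (a # a # T) (f a # f a # U)" using f(2) by simp
  ultimately show ?thesis by (rule heq_trans)
qed

text \<open>Two split tuples lose their doubled entries and are compared by induction two lengths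
  lower; length at least 7 keeps the shorter tuples within the range of the claim. Lengths 5 and 6
  have a normal form for each invariant.\<close>

lemma admissible_unique:
  assumes "admissible t" "admissible u" "length t = length u" "5 \<le> length t" "lift_prod t = lift_prod u"
  shows "seq t u"
  using assms
proof (induction "length t" arbitrary: t u rule: less_induct)
  case less
  have both: "seq t u" if sp: "split_pair t" "split_pair u" and len: "7 \<le> length t"
  proof -
    obtain a T where T: "seq t (a # a # T)" "a < 45" "admissible T" "lift_prod T = lift_prod t" "length t = length T + 2"
      using admissible_split[OF less.prems(1) sp(1)] by blast
    obtain b U where U: "seq u (b # b # U)" "b < 45" "admissible U" "lift_prod U = lift_prod u" "length u = length U + 2"
      using admissible_split[OF less.prems(2) sp(2)] by blast
    have "seq T U"
      by (rule less.hyps) (use T(3-5) U(3-5) less.prems(3,5) len in simp_all)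
    then have "seq (a # a # T) (b # b # U)" using seq_pair T(2,3) U(2) by (simp add: admissible_def)
    then show ?thesis using T(1) I.heq_sym[OF U(1)] heq_trans by blast
  qed
  consider "length t = 5" | "length t = 6" | "length t = 7" | "8 \<le> length t" using less.prems(4) by linarith
  then show ?case
  proof cases
    case 1
    then have 2: "length u = 5" using less.prems(3) by simp
    show ?thesis
      using admissible5_normal[OF less.prems(1) 1] I.heq_sym[OF admissible5_normal[OF less.prems(2) 2, folded less.prems(5)]]
      by (rule heq_trans[rotated])
  next
    case 2
    then have 3: "length u = 6" using less.prems(3) by simp
    show ?thesis
      using admissible6_normal[OF less.prems(1) 2] I.heq_sym[OF admissible6_normal[OF less.prems(2) 3, folded less.prems(5)]]
      by (rule heq_trans[rotated])
  next
    case 3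
    \<comment> \<open>A split 7-tuple has the invariant of a 5-tuple, which is nontrivial, while the
      exceptional 7-tuple has trivial invariant. Thus the invariant tells which case occurs.\<close>
    have seven: "split_pair s \<and> lift_prod s \<noteq> id \<or> seq s [0, 5, 42, 1, 1, 8, 8] \<and> lift_prod s = id"
      if s: "admissible s" "length s = 7" for s
    proof (cases "split_pair s")
      case True
      then obtain a T where T: "admissible T" "lift_prod T = lift_prod s" "length s = length T + 2"
        using admissible_split[OF s(1)] by blast
      have "length T = 5" using T(3) s(2) by simp
      then show ?thesis using True admissible5[OF T(1)] lift_prod_rep5_distinct T(2) by metis
    next
      case False
      then have "seq s [0, 5, 42, 1, 1, 8, 8]" using product7[of s] s by (simp add: admissible_def)
      then show ?thesis using admissible_seq[OF s(1)] lift_prod_reps(4) by metis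
    qed
    have u7: "length u = 7" "7 \<le> length t" using less.prems(3) 3 by simp_all
    show ?thesis
    proof (cases "lift_prod t = id")
      case True
      then have "seq t [0, 5, 42, 1, 1, 8, 8]" "seq u [0, 5, 42, 1, 1, 8, 8]"
        using seven[OF less.prems(1) 3] seven[OF less.prems(2) u7(1)] less.prems(5) by metis+
      then show ?thesis using I.heq_sym heq_trans by blast
    next
      case False
      then have "split_pair t" "split_pair u"
        using seven[OF less.prems(1) 3] seven[OF less.prems(2) u7(1)] less.prems(5) by metis+
      then show ?thesis using both u7(2) by blast
    qed
  next
    case 4
    then show ?thesis using both class8 less.prems by (simp add: admissible_def)
  qed
qed

lemma admissible_pair:
  assumes "admissible T" shows "admissible (0 # 0 # T) \<and> lift_prod (0 # 0 # T) = lift_prod T"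
proof
  show l: "lift_prod (0 # 0 # T) = lift_prod T" by (rule lift_prod_pair) simp
  show "admissible (0 # 0 # T)"
  proof (rule admissibleI)
    show "tup (0 # 0 # T)" "gen (0 # 0 # T)"
      using assms gen_mono[of T "0 # 0 # T"] by (auto simp: admissible_def)
    show "lift_prod (0 # 0 # T) \<in> central_kernel" unfolding l by (rule admissible_lam[OF assms])
  qed
qed

text \<open>Prefixing \<open>0, 0\<close> preserves the invariant and adds 2 to the length. At
  length 7 the trivial invariant needs a tuple of its own, since no 5-tuple provides it.\<close>

lemma admissible_ex:
  "6 \<le> k \<Longrightarrow> z \<in> central_kernel \<Longrightarrow> \<exists>t. admissible t \<and> length t = k \<and> lift_prod t = z"
proof (induction k rule: less_induct)
  case (less k)
  consider "k = 6" | "k = 7" "z = id" | "k = 7" "z \<noteq> id" | "8 \<le> k" using less.prems(1) by linarith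
  then show ?case
  proof cases
    case 1
    have "length [0, 0, 1, 1, 8, 8::nat] = 6" "length [0, 1, 8, 9, 14, 15::nat] = 6"
      "length [0, 1, 24, 30, 25, 33::nat] = 6" by simp_all
    then show ?thesis using less.prems(2) 1 lift_prod_reps admissible_reps unfolding central_kernel_elems by blast
  next
    case 2
    have "length [0, 5, 42, 1, 1, 8, 8::nat] = 7" by simp
    then show ?thesis using 2 lift_prod_reps admissible_reps by blast
  next
    case 3
    have "length (0 # 0 # [0, 1, 8, 9, 40::nat]) = 7" "length (0 # 0 # [0, 1, 24, 30, 28::nat]) = 7" by simp_all
    then show ?thesis
      using 3 less.prems(2) admissible_pair[OF admissible_reps(1)] admissible_pair[OF admissible_reps(2)]
      unfolding central_kernel_elems by blast
  next
    case 4
    then have "k - 2 < k" "6 \<le> k - 2" by linarith+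
    then obtain t where "admissible t" "length t = k - 2" "lift_prod t = z"
      using less.IH[of "k - 2"] less.prems by blast
    moreover have "length (0 # 0 # t) = k" using calculation(2) 4 by simp
    ultimately show ?thesis using admissible_pair[of t] by blast
  qed
qed

section \<open>Nielsen tuples and components\<close>

abbreviation conj_act :: "(nat \<Rightarrow> nat) \<Rightarrow> (nat \<Rightarrow> nat) list \<Rightarrow> (nat \<Rightarrow> nat) list" where
  "conj_act \<equiv> inner_act (alt_group 6)"

interpretation A6: group "alt_group 6" by (rule alt_group_is_group)

lemma enc_carrier: "i < 45 \<Longrightarrow> enc i \<in> carrier (alt_group 6)"
  using hat_props(2) unfolding covers_def by blast

lemma enc_inv: "i < 45 \<Longrightarrow> inv\<^bsub>alt_group 6\<^esub> (enc i) = enc i"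
  by (rule A6.inv_equality) (simp_all only: alt_group_mult alt_group_one enc_enc enc_carrier)

lemma set_enc_carrier: "tup t \<Longrightarrow> set (map enc t) \<subseteq> carrier (alt_group 6)"
  using enc_carrier by (auto simp: tup_def)

lemma tuple_prod_enc: "tuple_prod (alt_group 6) (map enc t) = perm_prod t"
  by (simp only: tuple_prod_def alt_group_mult alt_group_one perm_prod_def)

text \<open>A 3-cycle is \<open>(a b)(b c)\<close>; the trivial product \<open>(d e)(d e)\<close> is
  inserted in the middle, with \<open>d\<close> and \<open>e\<close> outside the cycle.\<close>

lemma three_cycle_C22:
  assumes "p \<in> three_cycles 6" shows "\<exists>x\<in>C22. \<exists>y\<in>C22. p = x \<circ> y"
proof -
  obtain cs where cs: "p = cycle_of_list cs" "cycle cs" "length cs = 3" "set cs \<subseteq> {1..6}"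
    using assms by auto
  then obtain a b c where abc: "cs = [a, b, c]"
    by (auto simp: length_Suc_conv numeral_3_eq_3)
  have d3: "distinct [a, b, c]" "{a, b, c} \<subseteq> {1..6}" using cs abc by auto
  define S where "S = {1..6::nat} - {a, b, c}"
  have "card S = 3" unfolding S_def using d3 by (subst card_Diff_subset) auto
  then have "\<not> card S \<le> Suc 0" by simp
  moreover have "finite S" by (simp add: S_def)
  ultimately obtain d e where de: "d \<in> S" "e \<in> S" "d \<noteq> e"
    using card_le_Suc0_iff_eq[of S] by blast
  have "p = transpose a b \<circ> transpose b c" using cs(1) abc by simp
  also have "\<dots> = transpose a b \<circ> ((transpose d e \<circ> transpose d e) \<circ> transpose b c)"
    by (simp only: transpose_comp_involutory id_comp)
  finally have p: "p = (transpose a b \<circ> transpose d e) \<circ> (transpose d e \<circ> transpose b c)"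
    by (simp only: comp_assoc)
  have x: "cycle_of_list [a, b] \<circ> cycle_of_list [d, e] \<in> C22"
    unfolding C22_def using d3 de by (intro CollectI exI conjI; (rule refl)?) (auto simp: S_def)
  have y: "cycle_of_list [d, e] \<circ> cycle_of_list [b, c] \<in> C22"
    unfolding C22_def using d3 de by (intro CollectI exI conjI; (rule refl)?) (auto simp: S_def)
  have two: "cycle_of_list [u, v] = transpose u v" for u v :: nat by simp
  show ?thesis using p x y unfolding two by blast
qed

lemma C22_generates:
  assumes "S \<subseteq> carrier (alt_group 6)" "C22 \<subseteq> generate (alt_group 6) S"
  shows "generate (alt_group 6) S = carrier (alt_group 6)"
proof
  show "generate (alt_group 6) S \<subseteq> carrier (alt_group 6)"
    by (rule A6.generate_incl[OF assms(1)])
  have sub: "subgroup (generate (alt_group 6) S) (alt_group 6)"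
    by (rule A6.generate_is_subgroup[OF assms(1)])
  have "three_cycles 6 \<subseteq> generate (alt_group 6) S"
  proof
    fix p assume "p \<in> three_cycles 6"
    then obtain x y where xy: "x \<in> C22" "y \<in> C22" "p = x \<circ> y" using three_cycle_C22 by blast
    then have "x \<otimes>\<^bsub>alt_group 6\<^esub> y \<in> generate (alt_group 6) S"
      using assms(2) subgroup.m_closed[OF sub] by blast
    then show "p \<in> generate (alt_group 6) S" unfolding alt_group_mult xy(3) .
  qed
  then show "carrier (alt_group 6) \<subseteq> generate (alt_group 6) S"
    unfolding alt_group_carrier_as_three_cycles[of 6] by (rule A6.generate_subgroup_incl[OF _ sub])
qed

text \<open>Indices whose permutation lies in the generated subgroup form a subrack containing the
  entries. So the subgroup contains the whole class, hence all 3-cycles.\<close>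

lemma gen_generate:
  assumes "tup t" "gen t" shows "generate (alt_group 6) (set (map enc t)) = carrier (alt_group 6)"
proof (rule C22_generates[OF set_enc_carrier[OF assms(1)]])
  let ?H = "generate (alt_group 6) (set (map enc t))"
  define X where "X = {i. i < 45 \<and> enc i \<in> ?H}"
  have "closed_rack X"
    unfolding closed_rack_def
  proof (intro conjI ballI)
    show "X \<subseteq> {..<45}" by (auto simp: X_def)
    fix x y assume "x \<in> X" "y \<in> X"
    then have xy: "x < 45" "y < 45" "enc x \<in> ?H" "enc y \<in> ?H" by (simp_all add: X_def)
    have "enc y \<otimes>\<^bsub>alt_group 6\<^esub> enc x \<otimes>\<^bsub>alt_group 6\<^esub> enc y \<in> ?H"
      by (intro generate.eng xy)
    then have "enc (cj x y) \<in> ?H" unfolding alt_group_mult enc_cj[OF xy(1,2)] .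
    then show "cj x y \<in> X" using xy by (simp add: X_def cj_lt)
  qed
  moreover have "set t \<subseteq> X"
  proof
    fix x assume x: "x \<in> set t"
    then have "enc x \<in> ?H" by (intro generate.incl) simp
    then show "x \<in> X" using x assms(1) by (auto simp: X_def tup_def)
  qed
  ultimately have "X = {..<45}" using assms(2) by (simp only: gen_def)
  then show "C22 \<subseteq> ?H" unfolding C22_enc by (auto simp: X_def)
qed

text \<open>Let \<open>X\<close> be a subrack containing the entries. Each element \<open>h\<close>
  of the generated group satisfies \<open>enc i \<circ> h = h \<circ> enc j\<close> with
  \<open>j\<close> in \<open>X\<close> for every \<open>i\<close> in \<open>X\<close>. As that group
  is all of A_6, \<open>X\<close> is stable under conjugation by every index; being nonempty it is
  the whole class.\<close>

lemma generate_gen: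
  assumes "tup t" "t \<noteq> []" "generate (alt_group 6) (set (map enc t)) = carrier (alt_group 6)"
  shows "gen t"
  unfolding gen_def
proof (intro allI impI)
  fix X assume X: "closed_rack X" "set t \<subseteq> X"
  have X45: "x < 45" if "x \<in> X" for x using X(1) that by (auto simp: closed_rack_def)
  have swap: "enc i \<circ> enc y = enc y \<circ> enc (cj i y)" if "i < 45" "y < 45" for i y
  proof -
    have "enc y \<circ> enc (cj i y) = (enc y \<circ> enc y) \<circ> (enc i \<circ> enc y)"
      by (simp only: enc_cj[OF that] comp_assoc)
    then show ?thesis by (simp only: enc_enc[OF that(2)] id_comp)
  qed
  have H: "\<forall>i\<in>X. \<exists>j\<in>X. enc i \<circ> h = h \<circ> enc j"
    if "h \<in> generate (alt_group 6) (set (map enc t))" for h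
    using that
  proof (induction rule: generate.induct)
    case one
    then show ?case unfolding alt_group_one by (metis comp_id id_comp)
  next
    case (incl h)
    then obtain y where y: "y \<in> X" "h = enc y" using X(2) by auto
    show ?case
    proof
      fix i assume "i \<in> X"
      then show "\<exists>j\<in>X. enc i \<circ> h = h \<circ> enc j"
        using swap[OF X45 X45] y X(1) unfolding closed_rack_def by blast
    qed
  next
    case (inv h)
    then obtain y where y: "y \<in> X" "h = enc y" using X(2) by auto
    show ?case
    proof
      fix i assume "i \<in> X"
      then show "\<exists>j\<in>X. enc i \<circ> inv\<^bsub>alt_group 6\<^esub> h = inv\<^bsub>alt_group 6\<^esub> h \<circ> enc j"
        using swap[OF X45 X45] y X(1) unfolding closed_rack_def y(2) enc_inv[OF X45[OF y(1)]] by blast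
    qed
  next
    case (eng h1 h2)
    show ?case unfolding alt_group_mult
    proof
      fix i assume "i \<in> X"
      then obtain j where j: "j \<in> X" "enc i \<circ> h1 = h1 \<circ> enc j" using eng.IH(1) by blast
      then obtain l where l: "l \<in> X" "enc j \<circ> h2 = h2 \<circ> enc l" using eng.IH(2) by blast
      have "enc i \<circ> (h1 \<circ> h2) = (h1 \<circ> h2) \<circ> enc l" using j l by (metis comp_assoc)
      then show "\<exists>j\<in>X. enc i \<circ> (h1 \<circ> h2) = (h1 \<circ> h2) \<circ> enc j" using l(1) by blast
    qed
  qed
  obtain a where a: "a \<in> X" using assms(2) X(2) by (cases t) auto
  have "cj x y \<in> X" if xy: "x \<in> X" "y < 45" for x y
  proof -
    obtain j where j: "j \<in> X" "enc x \<circ> enc y = enc y \<circ> enc j"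
      using H[of "enc y"] assms(3) enc_carrier[OF xy(2)] xy(1) by blast
    have "enc (cj x y) = enc y \<circ> (enc y \<circ> enc j)"
      by (simp only: enc_cj[OF X45[OF xy(1)] xy(2)] comp_assoc j(2))
    also have "\<dots> = enc j" by (simp only: comp_assoc[symmetric] enc_enc[OF xy(2)] id_comp)
    finally have "cj x y = j" by (intro cj_eqI) (use X45 xy j(1) cj_lt in blast)+
    then show ?thesis using j(1) by simp
  qed
  then show "X = {..<45}" using rack_connected[OF a] X(1) unfolding closed_rack_def by blast
qed

abbreviation nielsen :: "nat \<Rightarrow> (nat \<Rightarrow> nat) list set" where
  "nielsen k \<equiv> nielsen_class (alt_group 6) C22 k"

lemma nielsen_eq:
  assumes "0 < k" shows "nielsen k = map enc ` {t. admissible t \<and> length t = k}"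
proof
  show "map enc ` {t. admissible t \<and> length t = k} \<subseteq> nielsen k"
  proof
    fix gs assume "gs \<in> map enc ` {t. admissible t \<and> length t = k}"
    then obtain t where t: "gs = map enc t" "admissible t" "length t = k" by blast
    have tg: "tup t" "gen t" "perm_prod t = id" using t(2) by (auto simp: admissible_def)
    have "set gs \<subseteq> C22" using tg(1) t(1) by (auto simp: C22_enc tup_def)
    moreover have "tuple_prod (alt_group 6) gs = \<one>\<^bsub>alt_group 6\<^esub>"
      unfolding t(1) tuple_prod_enc alt_group_one by (rule tg(3))
    moreover have "generate (alt_group 6) (set gs) = carrier (alt_group 6)"
      unfolding t(1) by (rule gen_generate[OF tg(1,2)])
    ultimately show "gs \<in> nielsen k" using t by (simp add: nielsen_class_def)
  qed
  show "nielsen k \<subseteq> map enc ` {t. admissible t \<and> length t = k}"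
  proof
    fix gs assume "gs \<in> nielsen k"
    then have gs: "length gs = k" "set gs \<subseteq> C22" "tuple_prod (alt_group 6) gs = \<one>\<^bsub>alt_group 6\<^esub>"
      "generate (alt_group 6) (set gs) = carrier (alt_group 6)"
      by (auto simp: nielsen_class_def)
    have "\<exists>t. tup t \<and> gs = map enc t" using gs(2)
    proof (induction gs)
      case Nil
      then show ?case by (intro exI[of _ "[]"]) simp
    next
      case (Cons g gs)
      then obtain t x where "tup t" "gs = map enc t" "x < 45" "g = enc x" by (auto simp: C22_enc)
      then show ?case by (intro exI[of _ "x # t"]) simp
    qed
    then obtain t where t: "tup t" "gs = map enc t" by blast
    have "t \<noteq> []" using gs(1) t(2) assms by auto
    then have "gen t" using generate_gen[OF t(1)] gs(4) t(2) by blast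
    moreover have "perm_prod t = id" using gs(3) unfolding t(2) tuple_prod_enc alt_group_one .
    ultimately have "admissible t" using t(1) unfolding admissible_def by blast
    then show "gs \<in> map enc ` {t. admissible t \<and> length t = k}" using t(2) gs(1) by auto
  qed
qed

lemma map_enc_inj: "tup t \<Longrightarrow> tup u \<Longrightarrow> map enc t = map enc u \<Longrightarrow> t = u"
  by (subst (asm) inj_on_map_eq_map) (auto intro: inj_on_subset[OF enc_inj] simp: tup_def)

lemma inner_act_enc:
  assumes "tup t" "c < 45"
  shows "conj_act (enc c) (map enc t) = map enc (map (\<lambda>x. cj x c) t)"
proof -
  have "inv\<^bsub>alt_group 6\<^esub> (enc c) \<otimes>\<^bsub>alt_group 6\<^esub> enc x \<otimes>\<^bsub>alt_group 6\<^esub> enc c = enc (cj x c)" if "x < 45" for x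
    unfolding alt_group_mult enc_inv[OF assms(2)] enc_cj[OF that assms(2)] ..
  then show ?thesis using assms(1) by (auto simp: inner_act_def tup_def)
qed

lemma inner_act_one: "set gs \<subseteq> carrier (alt_group 6) \<Longrightarrow> conj_act \<one>\<^bsub>alt_group 6\<^esub> gs = gs"
  unfolding inner_act_def by (rule map_idI) auto

text \<open>The inner action is a right action: in a product the left factor acts first, in
  agreement with reading words of conjugations from the left.\<close>

lemma inner_act_mult:
  assumes "s \<in> carrier (alt_group 6)" "r \<in> carrier (alt_group 6)" "set gs \<subseteq> carrier (alt_group 6)"
  shows "conj_act (s \<otimes>\<^bsub>alt_group 6\<^esub> r) gs = conj_act r (conj_act s gs)"
  unfolding inner_act_def map_map
  by (rule map_cong[OF refl]) (use assms in \<open>auto simp: A6.inv_mult_group A6.m_assoc\<close>)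

section \<open>Words for inner automorphisms and for braids\<close>

definition conj_word :: "nat list \<Rightarrow> nat list \<Rightarrow> nat list" where
  "conj_word cs t = fold (\<lambda>c. map (\<lambda>x. cj x c)) cs t"

lemma conj_word_simps: "conj_word [] t = t" "conj_word (c # cs) t = conj_word cs (map (\<lambda>x. cj x c) t)"
  "conj_word (cs @ ds) t = conj_word ds (conj_word cs t)"
  by (simp_all add: conj_word_def)

lemma tup_map_cj: "tup t \<Longrightarrow> c < 45 \<Longrightarrow> tup (map (\<lambda>x. cj x c) t)"
  using tup_map[OF rack_aut_cj] by blast

lemma seq_conj_word: "tup t \<Longrightarrow> tup cs \<Longrightarrow> seq t (conj_word cs t)"
proof (induction cs arbitrary: t)
  case Nil
  then show ?case by (simp add: conj_word_simps heq_refl)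
next
  case (Cons c cs)
  have "(\<lambda>x. cj x c) \<in> inners" using Cons.prems(2) unfolding inners_def by auto
  then have "seq t (map (\<lambda>x. cj x c) t)" by (intro heq_map heq_refl Cons.prems(1))
  moreover have "seq (map (\<lambda>x. cj x c) t) (conj_word cs (map (\<lambda>x. cj x c) t))"
    using Cons.IH[of "map (\<lambda>x. cj x c) t"] Cons.prems tup_map_cj by simp
  ultimately show ?case unfolding conj_word_simps by (rule heq_trans[rotated])
qed

lemma tup_conj_word: "tup t \<Longrightarrow> tup cs \<Longrightarrow> tup (conj_word cs t)"
  using I.heq_tup seq_conj_word by blast

lemma inner_act_conj_word:
  assumes "s \<in> carrier (alt_group 6)"
  shows "\<exists>cs. tup cs \<and> (\<forall>t. tup t \<longrightarrow> conj_act s (map enc t) = map enc (conj_word cs t))"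
proof -
  have C: "C22 \<subseteq> carrier (alt_group 6)" using enc_carrier by (auto simp: C22_enc)
  have gen: "generate (alt_group 6) C22 = carrier (alt_group 6)"
    by (rule C22_generates[OF C]) (auto intro: generate.incl)
  have "s \<in> generate (alt_group 6) C22" unfolding gen by (rule assms)
  then show ?thesis
  proof (induction rule: generate.induct)
    case one
    show ?case
      by (rule exI[of _ "[]"]) (use inner_act_one set_enc_carrier in \<open>simp add: conj_word_simps\<close>)
  next
    case (incl h)
    then obtain c where "c < 45" "h = enc c" by (auto simp: C22_enc)
    then show ?case by (intro exI[of _ "[c]"]) (simp add: inner_act_enc conj_word_simps)
  next
    case (inv h)
    then obtain c where "c < 45" "h = enc c" by (auto simp: C22_enc)
    then show ?case by (intro exI[of _ "[c]"]) (simp add: inner_act_enc conj_word_simps enc_inv)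
  next
    case (eng h1 h2)
    obtain cs where cs: "tup cs" "\<forall>t. tup t \<longrightarrow> conj_act h1 (map enc t) = map enc (conj_word cs t)"
      using eng.IH(1) by blast
    obtain ds where ds: "tup ds" "\<forall>t. tup t \<longrightarrow> conj_act h2 (map enc t) = map enc (conj_word ds t)"
      using eng.IH(2) by blast
    have h: "h1 \<in> carrier (alt_group 6)" "h2 \<in> carrier (alt_group 6)" using eng.hyps gen by auto
    have "conj_act (h1 \<otimes>\<^bsub>alt_group 6\<^esub> h2) (map enc t) = map enc (conj_word (cs @ ds) t)"
      if t: "tup t" for t
      using cs(2) ds(2) t tup_conj_word[OF t cs(1)] inner_act_mult[OF h set_enc_carrier[OF t]]
      by (simp only: conj_word_simps simp_thms)
    moreover have "tup (cs @ ds)" using cs(1) ds(1) by simp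
    ultimately show ?case by blast
  qed
qed

lemma conj_word_inner_act:
  assumes "tup cs"
  shows "\<exists>s\<in>carrier (alt_group 6). \<forall>t. tup t \<longrightarrow> map enc (conj_word cs t) = conj_act s (map enc t)"
  using assms
proof (induction cs)
  case Nil
  show ?case
    by (rule bexI[OF _ A6.one_closed]) (use inner_act_one set_enc_carrier in \<open>simp add: conj_word_simps\<close>)
next
  case (Cons c cs)
  then obtain s where s: "s \<in> carrier (alt_group 6)"
    "\<forall>t. tup t \<longrightarrow> map enc (conj_word cs t) = conj_act s (map enc t)" by auto
  have c: "c < 45" "enc c \<in> carrier (alt_group 6)" using Cons.prems enc_carrier by auto
  show ?case
  proof (rule bexI[OF _ A6.m_closed[OF c(2) s(1)]], intro allI impI)
    fix t assume t: "tup t"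
    show "map enc (conj_word (c # cs) t) = conj_act (enc c \<otimes>\<^bsub>alt_group 6\<^esub> s) (map enc t)"
      unfolding conj_word_simps inner_act_mult[OF c(2) s(1) set_enc_carrier[OF t]] inner_act_enc[OF t c(1)]
      using s(2) tup_map_cj[OF t c(1)] by blast
  qed
qed

text \<open>\<open>True\<close> marks a braid move and \<open>False\<close> an inverse one; the
  first letter acts first.\<close>

definition braid_word :: "(bool \<times> nat) list \<Rightarrow> nat list \<Rightarrow> nat list" where
  "braid_word w t = fold (\<lambda>(b, i). if b then bm i else bi i) w t"

lemma braid_word_simps: "braid_word [] t = t"
  "braid_word ((b, i) # w) t = braid_word w (if b then bm i t else bi i t)"
  "braid_word (v @ w) t = braid_word w (braid_word v t)"
  by (simp_all add: braid_word_def)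

lemma braid_word_map_cj:
  "tup t \<Longrightarrow> c < 45 \<Longrightarrow> braid_word w (map (\<lambda>x. cj x c) t) = map (\<lambda>x. cj x c) (braid_word w t)"
proof (induction w arbitrary: t)
  case (Cons l w)
  obtain b i where l: "l = (b, i)" by (cases l)
  have m: "(if b then bm i (map (\<lambda>x. cj x c) t) else bi i (map (\<lambda>x. cj x c) t)) =
      map (\<lambda>x. cj x c) (if b then bm i t else bi i t)"
    using bm_map[OF rack_aut_cj] bi_map[OF rack_aut_cj] Cons.prems by simp
  have "tup (if b then bm i t else bi i t)" using Cons.prems tup_bm tup_bi by simp
  then show ?case unfolding l braid_word_simps m using Cons by blast
qed (simp add: braid_word_simps)

lemma seq_braid_word: "tup t \<Longrightarrow> seq t (braid_word w t)"
proof (induction w rule: rev_induct)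
  case (snoc l w)
  obtain b i where l: "l = (b, i)" by (cases l)
  have "seq t (if b then bm i (braid_word w t) else bi i (braid_word w t))"
    using snoc heq_bm heq_bi by simp
  then show ?case unfolding l braid_word_simps .
qed (simp add: braid_word_simps heq_refl)

lemma tup_braid_word: "tup t \<Longrightarrow> tup (braid_word w t)"
  using I.heq_tup seq_braid_word by blast

lemma braid_word_conj_word:
  "tup t \<Longrightarrow> tup cs \<Longrightarrow> braid_word w (conj_word cs t) = conj_word cs (braid_word w t)"
proof (induction cs arbitrary: t)
  case (Cons c cs)
  then have c: "c < 45" "tup cs" by auto
  show ?case unfolding conj_word_simps
    using Cons.IH[OF tup_map_cj[OF Cons.prems(1) c(1)] c(2)] braid_word_map_cj[OF Cons.prems(1) c(1)] by simp
qed (simp add: conj_word_simps)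

text \<open>Conjugations commute with braid moves, so all of them can be collected after the braid
  word.\<close>

lemma seq_words: "seq t u \<Longrightarrow> \<exists>w cs. tup cs \<and> u = conj_word cs (braid_word w t)"
proof (induction rule: heq.induct)
  case (heq_refl t)
  show ?case by (rule exI[of _ "[]"], rule exI[of _ "[]"]) (simp add: braid_word_simps conj_word_simps)
next
  case (heq_bm t u i)
  then obtain w cs where w: "tup cs" "u = conj_word cs (braid_word w t)" by blast
  have t: "tup t" using I.heq_tup[OF heq_bm.hyps] by blast
  have "bm i u = conj_word cs (braid_word (w @ [(True, i)]) t)"
    using braid_word_conj_word[OF tup_braid_word[OF t] w(1), of "[(True, i)]" w] w(2)
    by (simp add: braid_word_simps)
  then show ?case using w(1) by blast
next
  case (heq_bi t u i)
  then obtain w cs where w: "tup cs" "u = conj_word cs (braid_word w t)" by blast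
  have t: "tup t" using I.heq_tup[OF heq_bi.hyps] by blast
  have "bi i u = conj_word cs (braid_word (w @ [(False, i)]) t)"
    using braid_word_conj_word[OF tup_braid_word[OF t] w(1), of "[(False, i)]" w] w(2)
    by (simp add: braid_word_simps)
  then show ?case using w(1) by blast
next
  case (heq_map t u f)
  then obtain w cs c where w: "tup cs" "u = conj_word cs (braid_word w t)" "c < 45" "f = (\<lambda>x. cj x c)"
    by (auto simp: inners_def)
  have "map f u = conj_word (cs @ [c]) (braid_word w t)"
    unfolding w(2,4) conj_word_simps ..
  moreover have "tup (cs @ [c])" using w(1,3) by simp
  ultimately show ?case by blast
qed

section \<open>The braid group acting on Nielsen tuples\<close>

lemma braid_move_enc:
  "tup t \<Longrightarrow> Suc i < length t \<Longrightarrow> braid_move (alt_group 6) i (map enc t) = map enc (bm i t)"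
proof (induction i t rule: bm.induct)
  case (1 x y t)
  then have "inv\<^bsub>alt_group 6\<^esub> (enc y) \<otimes>\<^bsub>alt_group 6\<^esub> enc x \<otimes>\<^bsub>alt_group 6\<^esub> enc y = enc (cj x y)"
    unfolding alt_group_mult using enc_inv[of y] enc_cj[of x y] by (simp only: tup_simps)
  then show ?case by (simp add: braid_move_def)
next
  case (2 i x t)
  then have "braid_move (alt_group 6) i (map enc t) = map enc (bm i t)" by simp
  moreover have "braid_move (alt_group 6) (Suc i) (enc x # map enc t) = enc x # braid_move (alt_group 6) i (map enc t)"
    by (simp add: braid_move_def)
  ultimately show ?case by simp
qed simp_all

definition tuples :: "nat \<Rightarrow> nat list set" where
  "tuples k = {t. admissible t \<and> length t = k}"

lemma tuples_seq: "t \<in> tuples k \<Longrightarrow> seq t u \<Longrightarrow> u \<in> tuples k \<and> lift_prod u = lift_prod t"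
  using admissible_seq[of t u] unfolding tuples_def by simp

lemma tuples_tup: "t \<in> tuples k \<Longrightarrow> tup t"
  by (simp add: tuples_def admissible_def)

lemma nielsen_tuples: "0 < k \<Longrightarrow> nielsen k = map enc ` tuples k"
  unfolding tuples_def by (rule nielsen_eq)

lemma tuples_bm: "t \<in> tuples k \<Longrightarrow> bm i t \<in> tuples k" and tuples_bi: "t \<in> tuples k \<Longrightarrow> bi i t \<in> tuples k"
  using tuples_seq heq_bm[OF heq_refl] heq_bi[OF heq_refl] tuples_tup by blast+

abbreviation move :: "nat \<Rightarrow> nat \<Rightarrow> (nat \<Rightarrow> nat) list \<Rightarrow> (nat \<Rightarrow> nat) list" where
  "move k i \<equiv> restrict (braid_move (alt_group 6) i) (nielsen k)"

lemma move_enc: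
  assumes "Suc i < k" "t \<in> tuples k" shows "move k i (map enc t) = map enc (bm i t)"
proof -
  have "map enc t \<in> nielsen k" using nielsen_tuples[of k] assms by simp
  moreover have "length t = k" using assms(2) by (simp add: tuples_def)
  ultimately show ?thesis using braid_move_enc[OF tuples_tup[OF assms(2)], of i] assms(1) by simp
qed

lemma move_Bij:
  assumes i: "Suc i < k" shows "move k i \<in> Bij (nielsen k)"
proof -
  have k: "0 < k" using i by simp
  have "inj_on (move k i) (nielsen k)"
  proof (rule inj_onI)
    fix g h assume "g \<in> nielsen k" "h \<in> nielsen k" and eq: "move k i g = move k i h"
    then obtain t u where t: "g = map enc t" "t \<in> tuples k" and u: "h = map enc u" "u \<in> tuples k"
      unfolding nielsen_tuples[OF k] by blast
    have "map enc (bm i t) = map enc (bm i u)" using eq unfolding t(1) u(1) move_enc[OF i t(2)] move_enc[OF i u(2)] .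
    then have "bm i t = bm i u"
      by (rule map_enc_inj[OF tuples_tup[OF tuples_bm[OF t(2)]] tuples_tup[OF tuples_bm[OF u(2)]]])
    then have "t = u" using bi_bm[OF tuples_tup[OF t(2)]] bi_bm[OF tuples_tup[OF u(2)]] by metis
    then show "g = h" using t u by simp
  qed
  moreover have "move k i ` nielsen k = nielsen k"
  proof
    show "move k i ` nielsen k \<subseteq> nielsen k"
    proof
      fix g assume "g \<in> move k i ` nielsen k"
      then obtain h where "h \<in> nielsen k" "g = move k i h" by blast
      then obtain t where t: "t \<in> tuples k" "g = move k i (map enc t)" unfolding nielsen_tuples[OF k] by blast
      then have "g = map enc (bm i t)" using move_enc[OF i t(1)] by metis
      then show "g \<in> nielsen k" unfolding nielsen_tuples[OF k] using tuples_bm[OF t(1)] by blast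
    qed
    show "nielsen k \<subseteq> move k i ` nielsen k"
    proof
      fix g assume "g \<in> nielsen k"
      then obtain t where t: "t \<in> tuples k" "g = map enc t" unfolding nielsen_tuples[OF k] by blast
      have "g = move k i (map enc (bi i t))"
        unfolding move_enc[OF i tuples_bi[OF t(1)]] bm_bi[OF tuples_tup[OF t(1)]] by (rule t(2))
      moreover have "map enc (bi i t) \<in> nielsen k" unfolding nielsen_tuples[OF k] using tuples_bi[OF t(1)] by simp
      ultimately show "g \<in> move k i ` nielsen k" by (rule image_eqI)
    qed
  qed
  ultimately show ?thesis unfolding Bij_def bij_betw_def by simp
qed

lemma inv_move_enc:
  assumes i: "Suc i < k" and t: "t \<in> tuples k"
  shows "(inv\<^bsub>BijGroup (nielsen k)\<^esub> move k i) (map enc t) = map enc (bi i t)"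
proof -
  have k: "0 < k" using i by simp
  have N: "map enc u \<in> nielsen k" if "u \<in> tuples k" for u unfolding nielsen_tuples[OF k] using that by simp
  have inj: "inj_on (move k i) (nielsen k)" using move_Bij[OF i] unfolding Bij_def bij_betw_def by blast
  have "move k i (map enc (bi i t)) = map enc t"
    unfolding move_enc[OF i tuples_bi[OF t]] bm_bi[OF tuples_tup[OF t]] ..
  then have "inv_into (nielsen k) (move k i) (map enc t) = map enc (bi i t)"
    by (rule inv_into_f_eq[OF inj N[OF tuples_bi[OF t]]])
  then show ?thesis unfolding inv_BijGroup[OF move_Bij[OF i]] using N[OF t] by simp
qed

abbreviation braids :: "nat \<Rightarrow> ((nat \<Rightarrow> nat) list \<Rightarrow> (nat \<Rightarrow> nat) list) monoid" where
  "braids k \<equiv> braid_image (alt_group 6) C22 k"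

lemma braids_carrier:
  "carrier (braids k) = generate (BijGroup (nielsen k)) {move k i | i. Suc i < k}"
  by (simp add: braid_image_def Let_def)

lemma BijGroup_mult_apply:
  "f \<in> Bij S \<Longrightarrow> g \<in> Bij S \<Longrightarrow> x \<in> S \<Longrightarrow> (f \<otimes>\<^bsub>BijGroup S\<^esub> g) x = f (g x)"
  by (simp add: BijGroup_def compose_def)

lemma braids_Bij: "carrier (braids k) \<subseteq> Bij (nielsen k)"
proof -
  interpret P: group "BijGroup (nielsen k)" by (rule group_BijGroup)
  have B: "carrier (BijGroup (nielsen k)) = Bij (nielsen k)" by (simp add: BijGroup_def)
  have "{move k i | i. Suc i < k} \<subseteq> carrier (BijGroup (nielsen k))"
  proof
    fix h assume "h \<in> {move k i | i. Suc i < k}"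
    then obtain i where "Suc i < k" "h = move k i" by blast
    then show "h \<in> carrier (BijGroup (nielsen k))" unfolding B by (simp only: move_Bij)
  qed
  from P.generate_incl[OF this] show ?thesis unfolding braids_carrier B .
qed

lemma braids_word:
  assumes "0 < k" "\<beta> \<in> carrier (braids k)"
  shows "\<exists>w. \<forall>t\<in>tuples k. \<beta> (map enc t) = map enc (braid_word w t)"
proof -
  have N: "map enc u \<in> nielsen k" if "u \<in> tuples k" for u unfolding nielsen_tuples[OF assms(1)] using that by simp
  show ?thesis using assms(2) unfolding braids_carrier
  proof (induction rule: generate.induct)
    case one
    show ?case
      by (rule exI[of _ "[]"]) (use N in \<open>simp add: BijGroup_def braid_word_simps\<close>)
  next
    case (incl h)
    then obtain i where "Suc i < k" "h = move k i" by blast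
    then have "\<forall>t\<in>tuples k. h (map enc t) = map enc (braid_word [(True, i)] t)"
      using move_enc by (simp only: braid_word_simps if_True ball_simps) blast
    then show ?case by blast
  next
    case (inv h)
    then obtain i where "Suc i < k" "h = move k i" by blast
    then have "\<forall>t\<in>tuples k. (inv\<^bsub>BijGroup (nielsen k)\<^esub> h) (map enc t) = map enc (braid_word [(False, i)] t)"
      using inv_move_enc by (simp only: braid_word_simps if_False ball_simps) blast
    then show ?case by blast
  next
    case (eng h1 h2)
    obtain w1 where w1: "\<forall>t\<in>tuples k. h1 (map enc t) = map enc (braid_word w1 t)" using eng.IH(1) by blast
    obtain w2 where w2: "\<forall>t\<in>tuples k. h2 (map enc t) = map enc (braid_word w2 t)" using eng.IH(2) by blast
    have B: "h1 \<in> Bij (nielsen k)" "h2 \<in> Bij (nielsen k)"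
      using eng.hyps braids_Bij unfolding braids_carrier by blast+
    \<comment> \<open>The product applies \<open>h2\<close> first, whereas words are read from the
      left, so the two words change places.\<close>
    have "(h1 \<otimes>\<^bsub>BijGroup (nielsen k)\<^esub> h2) (map enc t) = map enc (braid_word (w2 @ w1) t)"
      if t: "t \<in> tuples k" for t
    proof -
      have "braid_word w2 t \<in> tuples k" using tuples_seq[OF t seq_braid_word[OF tuples_tup[OF t]]] by blast
      then show ?thesis
        unfolding BijGroup_mult_apply[OF B N[OF t]] braid_word_simps using w1 w2 t by simp
    qed
    then show ?case by blast
  qed
qed

lemma word_braids:
  assumes "0 < k"
  shows "\<exists>\<beta>\<in>carrier (braids k). \<forall>t\<in>tuples k. \<beta> (map enc t) = map enc (braid_word w t)"
proof (induction w rule: rev_induct)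
  case Nil
  have N: "map enc u \<in> nielsen k" if "u \<in> tuples k" for u unfolding nielsen_tuples[OF assms(1)] using that by simp
  show ?case unfolding braids_carrier
    by (rule bexI[OF _ generate.one]) (use N in \<open>simp add: BijGroup_def braid_word_simps\<close>)
next
  case (snoc l w)
  obtain b i where l: "l = (b, i)" by (cases l)
  obtain \<beta> where \<beta>: "\<beta> \<in> carrier (braids k)" "\<forall>t\<in>tuples k. \<beta> (map enc t) = map enc (braid_word w t)"
    using snoc by blast
  have w: "braid_word w t \<in> tuples k" if t: "t \<in> tuples k" for t
    using tuples_seq[OF t seq_braid_word[OF tuples_tup[OF t]]] by blast
  show ?case
  proof (cases "Suc i < k")
    case True
    define g where "g = (if b then move k i else inv\<^bsub>BijGroup (nielsen k)\<^esub> move k i)"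
    have "move k i \<in> {move k i | i. Suc i < k}" using True by blast
    note m = generate.incl[OF this] generate.inv[OF this]
    have g: "g \<in> carrier (braids k)" unfolding braids_carrier g_def by (cases b) (simp_all only: m if_True if_False)
    have gB: "g \<in> Bij (nielsen k)" "\<beta> \<in> Bij (nielsen k)" using g \<beta>(1) braids_Bij by blast+
    have "(g \<otimes>\<^bsub>BijGroup (nielsen k)\<^esub> \<beta>) (map enc t) = map enc (braid_word (w @ [l]) t)"
      if t: "t \<in> tuples k" for t
    proof -
      have N: "map enc t \<in> nielsen k" unfolding nielsen_tuples[OF assms(1)] using t by simp
      have b: "\<beta> (map enc t) = map enc (braid_word w t)" using \<beta>(2) t by blast
      have "g (map enc (braid_word w t)) = map enc (if b then bm i (braid_word w t) else bi i (braid_word w t))"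
        unfolding g_def using move_enc[OF True w[OF t]] inv_move_enc[OF True w[OF t]] by (cases b) (simp_all only: if_True if_False)
      then show ?thesis unfolding BijGroup_mult_apply[OF gB N] b l braid_word_simps .
    qed
    moreover have "g \<otimes>\<^bsub>BijGroup (nielsen k)\<^esub> \<beta> \<in> carrier (braids k)"
      using g \<beta>(1) unfolding braids_carrier by (rule generate.eng)
    ultimately show ?thesis by blast
  next
    case False
    \<comment> \<open>A letter out of range acts trivially, so the element found for
      \<open>w\<close> serves again.\<close>
    have "braid_word (w @ [l]) t = braid_word w t" if t: "t \<in> tuples k" for t
    proof -
      have "length (braid_word w t) \<le> Suc i" using w[OF t] False by (simp add: tuples_def)
      then show ?thesis unfolding l braid_word_simps by (simp add: bm_outside bi_outside)
    qed
    then show ?thesis using \<beta> by (intro bexI[OF _ \<beta>(1)]) simp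
  qed
qed

section \<open>Inner classes, Hurwitz orbits and loci\<close>

abbreviation inner_class :: "(nat \<Rightarrow> nat) list \<Rightarrow> (nat \<Rightarrow> nat) list set" where
  "inner_class gs \<equiv> orbit (alt_group 6) conj_act gs"

lemma inner_class_self: "set gs \<subseteq> carrier (alt_group 6) \<Longrightarrow> gs \<in> inner_class gs"
  unfolding orbit_def using inner_act_one A6.one_closed by (metis (mono_tags, lifting) mem_Collect_eq)

lemma inner_class_inner_act:
  assumes s: "s \<in> carrier (alt_group 6)" and gs: "set gs \<subseteq> carrier (alt_group 6)"
  shows "inner_class (conj_act s gs) = inner_class gs"
proof
  show "inner_class (conj_act s gs) \<subseteq> inner_class gs"
  proof
    fix h assume "h \<in> inner_class (conj_act s gs)"
    then obtain r where r: "r \<in> carrier (alt_group 6)"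
      "h = conj_act r (conj_act s gs)"
      unfolding orbit_def by blast
    then have "h = conj_act (s \<otimes>\<^bsub>alt_group 6\<^esub> r) gs"
      using inner_act_mult[OF s r(1) gs] by simp
    then show "h \<in> inner_class gs" unfolding orbit_def using A6.m_closed[OF s r(1)] by blast
  qed
  show "inner_class gs \<subseteq> inner_class (conj_act s gs)"
  proof
    fix h assume "h \<in> inner_class gs"
    then obtain r where r: "r \<in> carrier (alt_group 6)" "h = conj_act r gs"
      unfolding orbit_def by blast
    define q where "q = inv\<^bsub>alt_group 6\<^esub> s \<otimes>\<^bsub>alt_group 6\<^esub> r"
    have q: "q \<in> carrier (alt_group 6)" "s \<otimes>\<^bsub>alt_group 6\<^esub> q = r"
      using s r(1) by (simp_all add: q_def A6.m_assoc[symmetric])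
    have "h = conj_act q (conj_act s gs)"
      unfolding r(2) inner_act_mult[OF s q(1) gs, symmetric] q(2) ..
    then show "h \<in> inner_class (conj_act s gs)" unfolding orbit_def using q(1) by blast
  qed
qed

text \<open>Holds because braid words commute with conjugations; thus the action on inner classes
  can be computed on one member.\<close>

lemma braid_image_inner_class:
  assumes "t \<in> tuples k" "\<forall>t\<in>tuples k. \<beta> (map enc t) = map enc (braid_word w t)"
  shows "\<beta> ` inner_class (map enc t) = inner_class (map enc (braid_word w t))"
proof -
  have t: "tup t" by (rule tuples_tup[OF assms(1)])
  have "\<beta> (conj_act s (map enc t)) = conj_act s (map enc (braid_word w t))"
    if s: "s \<in> carrier (alt_group 6)" for s
  proof -
    obtain cs where cs: "tup cs" "\<forall>t. tup t \<longrightarrow> conj_act s (map enc t) = map enc (conj_word cs t)"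
      using inner_act_conj_word[OF s] by blast
    have ct: "conj_word cs t \<in> tuples k" using tuples_seq[OF assms(1) seq_conj_word[OF t cs(1)]] by blast
    have "\<beta> (conj_act s (map enc t)) = map enc (braid_word w (conj_word cs t))"
      using cs(2) t assms(2) ct by simp
    also have "\<dots> = map enc (conj_word cs (braid_word w t))" unfolding braid_word_conj_word[OF t cs(1)] ..
    also have "\<dots> = conj_act s (map enc (braid_word w t))"
      using cs(2) tup_braid_word[OF t] by simp
    finally show ?thesis .
  qed
  note h = this
  show ?thesis unfolding orbit_def
  proof (intro equalityI subsetI)
    fix g assume "g \<in> \<beta> ` {conj_act s (map enc t) | s. s \<in> carrier (alt_group 6)}"
    then show "g \<in> {conj_act s (map enc (braid_word w t)) | s. s \<in> carrier (alt_group 6)}"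
      using h by blast
  next
    fix g assume "g \<in> {conj_act s (map enc (braid_word w t)) | s. s \<in> carrier (alt_group 6)}"
    then obtain s where "s \<in> carrier (alt_group 6)" "g = \<beta> (conj_act s (map enc t))" using h by auto
    then show "g \<in> \<beta> ` {conj_act s (map enc t) | s. s \<in> carrier (alt_group 6)}" by blast
  qed
qed

lemma hurwitz_locus_tuples:
  assumes "0 < k" shows "hurwitz_locus k z = {inner_class (map enc t) | t. t \<in> tuples k \<and> lift_prod t = z}"
  unfolding hurwitz_locus_def nielsen_tuples[OF assms] by (auto simp: lifting_invariant_enc)

text \<open>An orbit stays inside the locus by invariance. Conversely
  \<open>admissible_unique\<close> joins two tuples of equal invariant by a braid word followed by
  conjugations, and the latter do not change the inner class.\<close>

lemma component_eq_locus:
  assumes k: "5 \<le> k" and t: "t \<in> tuples k"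
  shows "orbit (braids k) (\<lambda>\<beta> c. \<beta> ` c) (inner_class (map enc t)) = hurwitz_locus k (lift_prod t)"
proof -
  have k0: "0 < k" using k by simp
  have tt: "tup t" by (rule tuples_tup[OF t])
  show ?thesis unfolding hurwitz_locus_tuples[OF k0]
  proof (intro equalityI subsetI)
    fix c assume "c \<in> orbit (braids k) (\<lambda>\<beta> c. \<beta> ` c) (inner_class (map enc t))"
    then obtain \<beta> where b: "\<beta> \<in> carrier (braids k)" "c = \<beta> ` inner_class (map enc t)"
      unfolding orbit_def[of "braids k"] by blast
    obtain w where w: "\<forall>t\<in>tuples k. \<beta> (map enc t) = map enc (braid_word w t)" using braids_word[OF k0 b(1)] by blast
    have "c = inner_class (map enc (braid_word w t))" unfolding b(2) by (rule braid_image_inner_class[OF t w])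
    then show "c \<in> {inner_class (map enc u) | u. u \<in> tuples k \<and> lift_prod u = lift_prod t}"
      using tuples_seq[OF t seq_braid_word[OF tt]] by blast
  next
    fix c assume "c \<in> {inner_class (map enc u) | u. u \<in> tuples k \<and> lift_prod u = lift_prod t}"
    then obtain u where u: "c = inner_class (map enc u)" "u \<in> tuples k" "lift_prod u = lift_prod t" by blast
    have "seq t u" by (rule admissible_unique) (use t u k in \<open>simp_all add: tuples_def\<close>)
    then obtain w cs where w: "tup cs" "u = conj_word cs (braid_word w t)" using seq_words by blast
    obtain s where s: "s \<in> carrier (alt_group 6)"
      "\<forall>t. tup t \<longrightarrow> map enc (conj_word cs t) = conj_act s (map enc t)"
      using conj_word_inner_act[OF w(1)] by blast
    have bt: "tup (braid_word w t)" by (rule tup_braid_word[OF tt])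
    have "map enc u = conj_act s (map enc (braid_word w t))" unfolding w(2) using s(2) bt by blast
    then have c: "c = inner_class (map enc (braid_word w t))"
      unfolding u(1) using inner_class_inner_act[OF s(1) set_enc_carrier[OF bt]] by simp
    obtain \<beta> where b: "\<beta> \<in> carrier (braids k)" "\<forall>t\<in>tuples k. \<beta> (map enc t) = map enc (braid_word w t)"
      using word_braids[OF k0] by blast
    have "c = \<beta> ` inner_class (map enc t)" unfolding c braid_image_inner_class[OF t b(2)] ..
    then show "c \<in> orbit (braids k) (\<lambda>\<beta> c. \<beta> ` c) (inner_class (map enc t))"
      unfolding orbit_def[of "braids k"] using b(1) by blast
  qed
qed

lemma hurwitz_components_eq:
  assumes "5 \<le> k" shows "hurwitz_components (alt_group 6) C22 k = hurwitz_locus k ` lift_prod ` tuples k"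
proof -
  have "inner_nielsen_class (alt_group 6) C22 k = {inner_class (map enc t) | t. t \<in> tuples k}"
    using nielsen_tuples[of k] assms by (auto simp: inner_nielsen_class_def orbits_def)
  then show ?thesis
    unfolding hurwitz_components_def orbits_def[of "braids k"]
    using component_eq_locus[OF assms] by (auto simp: image_iff) blast+
qed

text \<open>An inner class determines its invariant, so loci that share a class coincide. Only
  attained values are compared, since the loci of all other values are empty.\<close>

lemma hurwitz_locus_inj:
  assumes "0 < k" shows "inj_on (hurwitz_locus k) (lift_prod ` tuples k)"
proof (rule inj_onI)
  fix z z' assume z: "z \<in> lift_prod ` tuples k" and eq: "hurwitz_locus k z = hurwitz_locus k z'"
  obtain t where t: "t \<in> tuples k" "lift_prod t = z" using z by blast
  have "inner_class (map enc t) \<in> hurwitz_locus k (lift_prod t)"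
    unfolding hurwitz_locus_tuples[OF assms] using t(1) by blast
  then have "inner_class (map enc t) \<in> hurwitz_locus k z'" using eq t(2) by simp
  then obtain u where u: "u \<in> tuples k" "lift_prod u = z'" "inner_class (map enc t) = inner_class (map enc u)"
    unfolding hurwitz_locus_tuples[OF assms] by blast
  have tu: "tup t" "tup u" using tuples_tup t(1) u(1) by blast+
  have "map enc t \<in> inner_class (map enc u)"
    unfolding u(3)[symmetric] by (rule inner_class_self[OF set_enc_carrier[OF tu(1)]])
  then obtain s where s: "s \<in> carrier (alt_group 6)" "map enc t = conj_act s (map enc u)"
    unfolding orbit_def by blast
  obtain cs where cs: "tup cs" "\<forall>t. tup t \<longrightarrow> conj_act s (map enc t) = map enc (conj_word cs t)"
    using inner_act_conj_word[OF s(1)] by blast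
  have "map enc t = map enc (conj_word cs u)" using s(2) cs(2) tu(2) by simp
  then have "t = conj_word cs u" by (rule map_enc_inj[OF tu(1) tup_conj_word[OF tu(2) cs(1)]])
  then have "lift_prod t = lift_prod u" using tuples_seq[OF u(1) seq_conj_word[OF tu(2) cs(1)]] by simp
  then show "z = z'" using t(2) u(2) by simp
qed

lemma lift_prod_tuples:
  assumes "6 \<le> k" shows "lift_prod ` tuples k = central_kernel"
proof
  show "lift_prod ` tuples k \<subseteq> central_kernel" using admissible_lam by (auto simp: tuples_def)
  show "central_kernel \<subseteq> lift_prod ` tuples k"
  proof
    fix z assume "z \<in> central_kernel"
    then obtain t where "admissible t" "length t = k" "lift_prod t = z" using admissible_ex[OF assms] by blast
    then show "z \<in> lift_prod ` tuples k" unfolding tuples_def by blast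
  qed
qed

lemma lift_prod_tuples5: "lift_prod ` tuples 5 = central_kernel - {id}"
proof
  show "lift_prod ` tuples 5 \<subseteq> central_kernel - {id}"
  proof
    fix z assume "z \<in> lift_prod ` tuples 5"
    then obtain t where t: "admissible t" "length t = 5" "z = lift_prod t" unfolding tuples_def by blast
    have "lift_prod t \<noteq> id" using admissible5[OF t(1,2)] lift_prod_rep5_distinct by metis
    then show "z \<in> central_kernel - {id}" using admissible_lam[OF t(1)] t(3) by (metis DiffI singletonD)
  qed
  have "[0, 1, 8, 9, 40] \<in> tuples 5" "[0, 1, 24, 30, 28] \<in> tuples 5"
    using admissible_reps(1,2) by (simp_all add: tuples_def)
  then show "central_kernel - {id} \<subseteq> lift_prod ` tuples 5" unfolding central_kernel_elems by blast
qed

theorem theorem2p6: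
  fixes \<sigma> :: "nat \<Rightarrow> nat"
  assumes "\<sigma> \<in> kernel Valentiner (alt_group 6) val_proj"
    and "group.ord Valentiner \<sigma> = 3"
  shows "(\<forall>k\<ge>6.
            hurwitz_components (alt_group 6) C22 k =
              {hurwitz_locus k (\<sigma> [^]\<^bsub>Valentiner\<^esub> (0::nat)),
               hurwitz_locus k (\<sigma> [^]\<^bsub>Valentiner\<^esub> (1::nat)),
               hurwitz_locus k (\<sigma> [^]\<^bsub>Valentiner\<^esub> (2::nat))} \<and>
            card (hurwitz_components (alt_group 6) C22 k) = 3) \<and>
         hurwitz_components (alt_group 6) C22 5 =
           {hurwitz_locus 5 (\<sigma> [^]\<^bsub>Valentiner\<^esub> (1::nat)),
            hurwitz_locus 5 (\<sigma> [^]\<^bsub>Valentiner\<^esub> (2::nat))} \<and>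
         card (hurwitz_components (alt_group 6) C22 5) = 2"
proof -
  have \<sigma>: "\<sigma> \<in> central_kernel" using assms(1) unfolding kernel_eq .
  then have \<sigma>V: "\<sigma> \<in> carrier Valentiner" by (simp add: central_kernel_def)
  define pw where "pw n = \<sigma> [^]\<^bsub>Valentiner\<^esub> n" for n :: nat
  have pw0: "pw 0 = id" by (simp only: pw_def V.nat_pow_0 Valentiner_one)
  have pwK: "pw n \<in> central_kernel" for n
  proof (induction n)
    case 0
    show ?case unfolding pw0 by (rule id_kernel)
  next
    case (Suc n)
    show ?case unfolding pw_def V.nat_pow_Suc Valentiner_mult
      by (rule kernel_comp[OF Suc[unfolded pw_def] \<sigma>])
  qed
  \<comment> \<open>The exponents below the order 3 give distinct powers.\<close>
  have inj: "inj_on pw {0..2}"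
    using V.ord_inj[OF \<sigma>V] assms(2) unfolding pw_def by simp
  have "pw i \<noteq> pw j" if "i \<le> 2" "j \<le> 2" "i \<noteq> j" for i j
    using inj_onD[OF inj, of i j] that by auto
  from this[of 1 0] this[of 2 0] this[of 1 2]
  have ne: "pw 1 \<noteq> pw 0" "pw 2 \<noteq> pw 0" "pw 1 \<noteq> pw 2" by simp_all
  then have card3: "card {pw 0, pw 1, pw 2} = 3" by (simp add: card_insert_if)
  have K3: "central_kernel = set [id, lift_prod [0, 1, 8, 9, 40], lift_prod [0, 1, 24, 30, 28]]"
    unfolding central_kernel_elems by simp
  have fin: "finite central_kernel" unfolding K3 by (rule List.finite_set)
  have le: "card central_kernel \<le> 3" unfolding K3 by (rule order_trans[OF card_length]) simp
  \<comment> \<open>Three distinct powers fill a set of at most three elements, so the given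
    \<open>\<sigma>\<close> accounts for every invariant.\<close>
  have K: "central_kernel = {pw 0, pw 1, pw 2}"
    by (rule card_seteq[OF fin _ _, symmetric]) (use pwK le card3 in auto)
  have "{pw 0, pw 1, pw 2} - {pw 0} = {pw 1, pw 2}" using ne by auto
  then have K5: "central_kernel - {id} = {pw 1, pw 2}" unfolding K pw0 .
  have c3: "card central_kernel = 3" unfolding K by (rule card3)
  have c2: "card {pw 1, pw 2} = 2" using ne(3) by simp
  have main: "hurwitz_components (alt_group 6) C22 k = {hurwitz_locus k (pw 0), hurwitz_locus k (pw 1), hurwitz_locus k (pw 2)} \<and>
      card (hurwitz_components (alt_group 6) C22 k) = 3" if k: "6 \<le> k" for k
  proof -
    have h: "hurwitz_components (alt_group 6) C22 k = hurwitz_locus k ` central_kernel"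
      using hurwitz_components_eq[of k] lift_prod_tuples[OF k] k by simp
    have "inj_on (hurwitz_locus k) central_kernel"
      using hurwitz_locus_inj[of k] k unfolding lift_prod_tuples[OF k] by simp
    then have "card (hurwitz_components (alt_group 6) C22 k) = 3"
      unfolding h by (simp only: card_image c3)
    then show ?thesis using h unfolding K by simp
  qed
  have h5: "hurwitz_components (alt_group 6) C22 5 = hurwitz_locus 5 ` {pw 1, pw 2}"
    using hurwitz_components_eq[of 5] unfolding lift_prod_tuples5 K5 by simp
  have "inj_on (hurwitz_locus 5) {pw 1, pw 2}"
    using hurwitz_locus_inj[of 5] unfolding lift_prod_tuples5 K5 by simp
  then have c5: "card (hurwitz_components (alt_group 6) C22 5) = 2"
    unfolding h5 by (simp only: card_image c2)
  have e5: "hurwitz_components (alt_group 6) C22 5 = {hurwitz_locus 5 (pw 1), hurwitz_locus 5 (pw 2)}"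
    unfolding h5 by simp
  show ?thesis unfolding pw_def[symmetric] using main e5 c5 by blast
qed

end
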